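(* Let $\tau>0$ and let $\mu$ be a finite signed Borel measure on $[-\tau,0]$. For $\psi\in C([-\tau,0];\mathbb{R})$ and $f\in L^1_{loc}(\mathbb{R}_+;\mathbb{R})$, let $x(\cdot,\psi)$ be the solution of $$\dot{x}(t)=\int_{[-\tau,0]}x(t+u)\,\mu(du)+f(t),\quad t\ge 0;\qquad x(t)=\psi(t),\quad t\in[-\tau,0],$$ and let $r_\tau$ be the resolvent of this equation. (A) Suppose $r_\tau\in L^1(\mathbb{R}_+;\mathbb{R})$ and let $f\in L^1_{loc}(\mathbb{R}_+;\mathbb{R})$. Then for all $\psi\in C([-\tau,0];\mathbb{R})$ the following hold. (i) $t\mapsto\int_t^{t+\theta}f(s)\,ds$ belongs to $\mathrm{Ces}(\mathbb{R}_+;\mathbb{R})$ for all $\theta\in(0,1]$ if and only if $x(\cdot,\psi)\in\mathrm{Ces}(\mathbb{R}_+;\mathbb{R})$. (ii) $f\in\mathrm{Ces}(\mathbb{R}_+;\mathbb{R})$ if and only if both $x(\cdot,\psi)\in\mathrm{Ces}(\mathbb{R}_+;\mathbb{R})$ and $\dot{x}(\cdot,\psi)\in\mathrm{Ces}(\mathbb{R}_+;\mathbb{R})$. Moreover, in each case the limits are given explicitly. In case (i), when the equivalent conditions hold, there is $C\in\mathbb{R}$ such that, as $t\to\infty$, $$\frac1t\int_0^t\int_s^{s+\theta}f(u)\,du\,ds\to C\theta\ \text{ for all }\theta\in(0,1],\qquad \frac1t\int_0^t x(s,\psi)\,ds\to\frac{-C}{\mu([-\tau,0])}.$$ In case (ii),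 when the equivalent conditions hold, there is $C\in\mathbb{R}$ such that, as $t\to\infty$, $$\frac1t\int_0^t f(s)\,ds\to C,\qquad \frac1t\int_0^t x(s,\psi)\,ds\to\frac{-C}{\mu([-\tau,0])},\qquad \frac1t\int_0^t\dot{x}(s,\psi)\,ds\to 0.$$ (B) The following are equivalent. (i) $r_\tau\in L^1(\mathbb{R}_+;\mathbb{R})$. (ii) For all $\psi\in C([-\tau,0];\mathbb{R})$ and all $f\in\mathrm{Ces}(\mathbb{R}_+;\mathbb{R})$ we have $x(\cdot,\psi)\in\mathrm{Ces}(\mathbb{R}_+;\mathbb{R})$. (iii) For all $\psi\in C([-\tau,0];\mathbb{R})$ and all $f\in L^1_{loc}(\mathbb{R}_+;\mathbb{R})$ such that $t\mapsto\int_t^{t+\theta}f(s)\,ds$ belongs to $\mathrm{Ces}(\mathbb{R}_+;\mathbb{R})$ for all $\theta\in(0,1]$, we have $x(\cdot,\psi)\in\mathrm{Ces}(\mathbb{R}_+;\mathbb{R})$.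
   Context: $\mathbb{R}_+=[0,\infty)$. $L^1_{loc}(\mathbb{R}_+;\mathbb{R})$ is the space of functions that are Lebesgue integrable on every compact subset of $\mathbb{R}_+$. A solution $x(\cdot,\psi)$ is a function on $[-\tau,\infty)$ equal to $\psi$ on $[-\tau,0]$, locally absolutely continuous on $[0,\infty)$, and satisfying the differential equation for almost all $t>0$; membership of $x(\cdot,\psi)$ in $\mathrm{Ces}(\mathbb{R}_+;\mathbb{R})$ refers to its restriction to $\mathbb{R}_+$. The resolvent $r_\tau$ is the unique function $r_\tau:\mathbb{R}\to\mathbb{R}$ with $r_\tau(t)=0$ for $t<0$, $r_\tau(0)=1$, locally absolutely continuous on $\mathbb{R}_+$, and $\dot r_\tau(t)=\int_{[-\tau,0]}r_\tau(t+u)\,\mu(du)$ for (almost all) $t>0$. The space of Cesàro functions is $$\mathrm{Ces}(\mathbb{R}_+;\mathbb{R})=\Big\{g\in L^1_{loc}(\mathbb{R}_+;\mathbb{R}):\ \lim_{t\to\infty}\frac1t\int_0^t g(s)\,ds=C\ \text{for some } C\in\mathbb{R}\Big\}.$$ *)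

theory Defs
  imports "HOL-Analysis.Analysis"
begin

section \<open>Finite signed measures\<close>

text \<open>
  A finite signed measure is a real-valued countably additive set function on the measurable
  sets of \<open>M\<close>. Only the \<open>\<sigma>\<close>-algebra of \<open>M\<close> matters; values of \<open>\<mu>\<close> outside it are irrelevant.
  Additivity on the constant empty sequence forces \<open>\<mu> {} = 0\<close>.
\<close>

definition finite_signed_measure :: "'a measure \<Rightarrow> ('a set \<Rightarrow> real) \<Rightarrow> bool" where
  "finite_signed_measure M \<mu> \<longleftrightarrow>
     (\<forall>A :: nat \<Rightarrow> 'a set. range A \<subseteq> sets M \<longrightarrow> disjoint_family A \<longrightarrow>
        (\<lambda>n. \<mu> (A n)) sums \<mu> (\<Union>n. A n))"

text \<open>
  The Jordan decomposition: the positive part of \<open>\<mu>\<close> is the upper variation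
  \<open>A \<mapsto> sup {\<mu> B | B \<subseteq> A measurable}\<close>. Truncation by \<open>ennreal\<close> is harmless, because \<open>B = {}\<close>
  contributes \<open>0\<close>.
\<close>

definition upper_variation :: "'a measure \<Rightarrow> ('a set \<Rightarrow> real) \<Rightarrow> 'a measure" where
  "upper_variation M \<mu> =
     measure_of (space M) (sets M) (\<lambda>A. SUP B \<in> {B \<in> sets M. B \<subseteq> A}. ennreal (\<mu> B))"

definition lower_variation :: "'a measure \<Rightarrow> ('a set \<Rightarrow> real) \<Rightarrow> 'a measure" where
  "lower_variation M \<mu> = upper_variation M (\<lambda>A. - \<mu> A)"

definition signed_integral :: "'a measure \<Rightarrow> ('a set \<Rightarrow> real) \<Rightarrow> ('a \<Rightarrow> real) \<Rightarrow> real" where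
  "signed_integral M \<mu> g =
     (LINT u|upper_variation M \<mu>. g u) - (LINT u|lower_variation M \<mu>. g u)"

abbreviation borel_Icc :: "real \<Rightarrow> real \<Rightarrow> real measure" where
  "borel_Icc a b \<equiv> restrict_space borel {a..b}"


section \<open>Function spaces on the half-line\<close>

text \<open>
  Functions on \<open>[0, \<infinity>)\<close> are represented by functions on all of \<open>real\<close>, whose values at negative
  arguments are not constrained.
\<close>

definition L1 :: "(real \<Rightarrow> real) set" where
  "L1 = {g. g absolutely_integrable_on {0..}}"

definition L1_loc :: "(real \<Rightarrow> real) set" where
  "L1_loc = {g. \<forall>K. compact K \<and> K \<subseteq> {0..} \<longrightarrow> g absolutely_integrable_on K}"

definition cesaro_mean :: "(real \<Rightarrow> real) \<Rightarrow> real \<Rightarrow> real" where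
  "cesaro_mean g t = (1 / t) * (LINT s:{0..t}|lebesgue. g s)"

definition Ces :: "(real \<Rightarrow> real) set" where
  "Ces = {g \<in> L1_loc. \<exists>C. (cesaro_mean g \<longlongrightarrow> C) at_top}"

definition window_integral :: "real \<Rightarrow> (real \<Rightarrow> real) \<Rightarrow> real \<Rightarrow> real" where
  "window_integral \<theta> f t = (LINT s:{t..t + \<theta>}|lebesgue. f s)"

text \<open>
  The usual \<open>\<epsilon>\<close>-\<open>\<delta>\<close> notion: \<open>D\<close> ranges over the finite families of non-overlapping compact
  intervals \<open>K = [Inf K, Sup K]\<close> contained in \<open>S\<close>.
\<close>

definition absolutely_continuous_on :: "real set \<Rightarrow> (real \<Rightarrow> real) \<Rightarrow> bool" where
  "absolutely_continuous_on S g \<longleftrightarrow>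
     (\<forall>\<epsilon>>0. \<exists>\<delta>>0. \<forall>D. D division_of \<Union>D \<and> \<Union>D \<subseteq> S \<and> (\<Sum>K\<in>D. Sup K - Inf K) < \<delta> \<longrightarrow>
        (\<Sum>K\<in>D. \<bar>g (Sup K) - g (Inf K)\<bar>) < \<epsilon>)"

definition locally_absolutely_continuous :: "(real \<Rightarrow> real) \<Rightarrow> bool" where
  "locally_absolutely_continuous g \<longleftrightarrow> (\<forall>T>0. absolutely_continuous_on {0..T} g)"


section \<open>The delay equation\<close>

definition delay_term :: "real \<Rightarrow> (real set \<Rightarrow> real) \<Rightarrow> (real \<Rightarrow> real) \<Rightarrow> real \<Rightarrow> real" where
  "delay_term \<tau> \<mu> x t = signed_integral (borel_Icc (-\<tau>) 0) \<mu> (\<lambda>u. x (t + u))"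

definition is_solution ::
  "real \<Rightarrow> (real set \<Rightarrow> real) \<Rightarrow> (real \<Rightarrow> real) \<Rightarrow> (real \<Rightarrow> real) \<Rightarrow> (real \<Rightarrow> real) \<Rightarrow> bool" where
  "is_solution \<tau> \<mu> f \<psi> x \<longleftrightarrow>
     (\<forall>t\<in>{-\<tau>..0}. x t = \<psi> t) \<and>
     locally_absolutely_continuous x \<and>
     (AE t in lebesgue. t > 0 \<longrightarrow> (x has_real_derivative delay_term \<tau> \<mu> x t + f t) (at t))"

text \<open>
  The solution lives on \<open>[-\<tau>, \<infinity>)\<close>; extending it by \<open>0\<close> makes it unique as a function on \<open>real\<close>.
\<close>

definition solution ::
  "real \<Rightarrow> (real set \<Rightarrow> real) \<Rightarrow> (real \<Rightarrow> real) \<Rightarrow> (real \<Rightarrow> real) \<Rightarrow> real \<Rightarrow> real" where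
  "solution \<tau> \<mu> f \<psi> = (THE x. is_solution \<tau> \<mu> f \<psi> x \<and> (\<forall>t < - \<tau>. x t = 0))"

definition is_resolvent :: "real \<Rightarrow> (real set \<Rightarrow> real) \<Rightarrow> (real \<Rightarrow> real) \<Rightarrow> bool" where
  "is_resolvent \<tau> \<mu> r \<longleftrightarrow>
     (\<forall>t<0. r t = 0) \<and> r 0 = 1 \<and>
     locally_absolutely_continuous r \<and>
     (AE t in lebesgue. t > 0 \<longrightarrow> (r has_real_derivative delay_term \<tau> \<mu> r t) (at t))"

definition resolvent :: "real \<Rightarrow> (real set \<Rightarrow> real) \<Rightarrow> real \<Rightarrow> real" where
  "resolvent \<tau> \<mu> = (THE r. is_resolvent \<tau> \<mu> r)"

end

theory Submission
  imports Defs
begin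

text \<open>
  Integrating the equation replaces the forcing by its primitive. Let \<open>y\<close> be the solution on
  \<open>[0, \<infinity>)\<close>, extended by \<open>0\<close> to the left, \<open>F\<close> the primitive of \<open>f\<close>, and \<open>D y t = \<integral> y (t + u) \<mu>(du)\<close>. Then
  \<open>y = H + 1 * D y\<close>, where \<open>*\<close> is convolution on the half-line, \<open>1\<close> is the indicator of \<open>[0, \<infinity>)\<close>, and
  \<open>H\<close> is \<open>F\<close> plus a bounded function that carries the initial data. The operator \<open>D\<close> commutes with
  convolution, \<open>D (a * b) = D a * b\<close> (\<open>D_conv\<close>), so from \<open>r = 1 + 1 * D r\<close> one gets
  \<open>1 * y = r * H\<close> (\<open>volterra_solution_unique_integrated\<close>). The mean of the solution is therefore
  \<open>(r * H) t / t\<close>. Only the continuous function \<open>F\<close> is ever convolved with \<open>r\<close>, never \<open>f\<close> itself.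

  Let \<open>r\<close> be integrable. Convolution with \<open>r\<close> carries \<open>F t / t \<longrightarrow> C\<close> over to
  \<open>(r * F) t / t \<longrightarrow> C \<integral> r\<close> by dominated convergence, the bounded part of \<open>H\<close> disappears in the limit, and
  the constant forcing \<open>1\<close> shows that \<open>\<mu> [-\<tau>, 0] \<integral> r = -1\<close> (\<open>resolvent_integral_times_mass\<close>). This
  settles forcings in \<open>Ces\<close>. Means of windows of \<open>f\<close> control only \<open>\<integral> F\<close> over \<open>[t, t + \<theta>]\<close>. Split
  \<open>F\<close> into its running average \<open>u\<close> over unit intervals and the rest \<open>G\<close>. The average satisfies \<open>u t / t \<longrightarrow> C\<close>. The rest
  satisfies \<open>V t / t \<longrightarrow> K\<close> for its primitive \<open>V\<close>, and since \<open>r * G = V + r * D V\<close>, its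
  contribution tends to \<open>K + K \<mu> [-\<tau>, 0] \<integral> r = 0\<close> (\<open>conv_r_tendsto_of_windows\<close>). The limit \<open>K\<close> is an
  average of the window limits over \<open>\<theta>\<close>; a Baire category argument (\<open>window_uniform_bound\<close>) gives the
  bound that allows the exchange of limit and average. The opposite implications read \<open>F\<close> off from
  \<open>H = y - D (1 * y)\<close>.

  If \<open>r\<close> is not integrable, a gliding hump yields a forcing in \<open>Ces\<close>, with primitive of size \<open>o(t)\<close>, for
  which \<open>(r * F) t / t\<close> is unbounded (\<open>integrable_r_if_means_converge\<close>): each hump follows the sign of
  \<open>s \<mapsto> r (t - s)\<close>, so that \<open>(r * F) t / t\<close> picks up a multiple of \<open>\<integral> |r|\<close> over \<open>[0, t / 2]\<close>.

  Some real analysis comes first: the fundamental theorem of calculus for absolutely continuous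
  functions, which makes the differential equation equivalent to its integrated form, and the fact
  that the two variations of a finite signed measure are finite measures.
\<close>

section \<open>Absolutely continuous functions are indefinite integrals\<close>

text \<open>
  Two tags can share an interval only if its interior is empty, and such an interval contributes
  nothing.
\<close>

lemma sum_abs_tagged_eq_division:
  fixes g :: "real \<Rightarrow> real"
  assumes "q tagged_division_of S"
  shows "(\<Sum>(x,K)\<in>q. \<bar>g (Sup K) - g (Inf K)\<bar>) = (\<Sum>K\<in>snd ` q. \<bar>g (Sup K) - g (Inf K)\<bar>)"
proof -
  let ?d = "\<lambda>K. if K = {} then 0 else \<bar>g (Sup K) - g (Inf K)\<bar>"
  have "K \<noteq> {}" if "(x, K) \<in> q" for x K
    using tagged_division_ofD(2)[OF assms that] by auto
  then have "(\<Sum>(x,K)\<in>q. \<bar>g (Sup K) - g (Inf K)\<bar>) = (\<Sum>(x,K)\<in>q. ?d K)"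
    by (intro sum.cong) auto
  also have "\<dots> = (\<Sum>K\<in>snd ` q. ?d K)"
  proof (rule sum.over_tagged_division_lemma[OF assms])
    fix u v :: real
    assume "box u v = {}"
    then show "?d (cbox u v) = 0"
      by (cases "u = v") (auto simp: box_eq_empty)
  qed
  also have "\<dots> = (\<Sum>K\<in>snd ` q. \<bar>g (Sup K) - g (Inf K)\<bar>)"
    using \<open>\<And>x K. (x, K) \<in> q \<Longrightarrow> K \<noteq> {}\<close> by (intro sum.cong) auto
  finally show ?thesis .
qed

text \<open>
  A gauge argument. Away from the null set \<open>N\<close>, differentiability makes the Riemann sum track the
  increments of \<open>g\<close>. Tags in \<open>N\<close> get intervals inside an open set of measure less than \<open>\<delta>\<close>, and
  absolute continuity bounds the total increment there; the integrand may be set to \<open>0\<close> on \<open>N\<close>.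
\<close>

lemma absolutely_continuous_on_has_integral:
  fixes g g' :: "real \<Rightarrow> real"
  assumes "a \<le> b" and ac: "absolutely_continuous_on {a..b} g" and N: "negligible N"
    and der: "\<And>t. t \<in> {a..b} - N \<Longrightarrow> (g has_real_derivative g' t) (at t within {a..b})"
  shows "(g' has_integral (g b - g a)) {a..b}"
proof -
  define h where "h = (\<lambda>t. if t \<in> N then 0 else g' t)"
  have "(h has_integral (g b - g a)) {a..b}"
    unfolding has_integral_real
  proof (intro allI impI)
    fix e :: real
    assume e: "e > 0"
    define e1 where "e1 = e / (2 * (b - a + 1))"
    have e1: "e1 > 0" "e1 * (b - a) < e / 2"
      using e \<open>a \<le> b\<close> by (auto simp: e1_def field_simps)
    obtain \<delta> where \<delta>: "\<delta> > 0"
      and ac\<delta>: "\<And>D. \<lbrakk>D division_of \<Union>D; \<Union>D \<subseteq> {a..b}; (\<Sum>K\<in>D. Sup K - Inf K) < \<delta>\<rbrakk>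
              \<Longrightarrow> (\<Sum>K\<in>D. \<bar>g (Sup K) - g (Inf K)\<bar>) < e / 2"
      using ac[unfolded absolutely_continuous_on_def, rule_format, of "e/2"] e by auto
    obtain U where U: "open U" "N \<subseteq> U" "U \<in> lmeasurable" "measure lebesgue U < \<delta>"
    proof -
      have "N \<in> null_sets lebesgue" using N by (simp add: negligible_iff_null_sets)
      then have "N \<in> sets lebesgue" "emeasure lebesgue N = 0" by auto
      then obtain U where "open U" "N \<subseteq> U" "U - N \<in> lmeasurable" "emeasure lebesgue (U - N) < ennreal \<delta>"
        using sets_lebesgue_outer_open[OF _ \<delta>] by metis
      moreover have "U \<in> lmeasurable"
        using \<open>N \<in> null_sets lebesgue\<close> calculation
        by (metis Diff_partition fmeasurable.Un fmeasurableI_null_sets)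
      moreover have "measure lebesgue U = measure lebesgue (U - N)"
        using \<open>N \<in> null_sets lebesgue\<close> \<open>U \<in> lmeasurable\<close> by (simp add: fmeasurableD measure_Diff_null_set)
      ultimately show thesis
        using that \<delta> by (metis emeasure_eq_measure2 ennreal_less_iff measure_nonneg)
    qed
    have "\<forall>t. \<exists>d>0. (t \<in> {a..b} - N \<longrightarrow> (\<forall>y\<in>{a..b}. norm (y - t) < d \<longrightarrow>
                \<bar>g y - g t - (y - t) * g' t\<bar> \<le> e1 * \<bar>y - t\<bar>)) \<and> (t \<in> N \<longrightarrow> ball t d \<subseteq> U)"
    proof
      fix t
      show "\<exists>d>0. (t \<in> {a..b} - N \<longrightarrow> (\<forall>y\<in>{a..b}. norm (y - t) < d \<longrightarrow>
                \<bar>g y - g t - (y - t) * g' t\<bar> \<le> e1 * \<bar>y - t\<bar>)) \<and> (t \<in> N \<longrightarrow> ball t d \<subseteq> U)"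
      proof (cases "t \<in> N")
        case True
        then show ?thesis
          using U by (meson DiffE openE subsetD)
      next
        case False
        show ?thesis
        proof (cases "t \<in> {a..b}")
          case True
          have "\<exists>d>0. \<forall>y\<in>{a..b}. norm (y - t) < d \<longrightarrow> norm (g y - g t - g' t * (y - t)) \<le> e1 * norm (y - t)"
            using der[of t] True False e1(1)
            unfolding has_field_derivative_def has_derivative_within_alt by auto
          then show ?thesis
            using False by (auto simp: mult.commute)
        qed (use False zero_less_one in blast)
      qed
    qed
    then obtain d where d: "\<And>t. d t > 0"
      and d1: "\<And>t y. \<lbrakk>t \<in> {a..b} - N; y \<in> {a..b}; norm (y - t) < d t\<rbrakk> \<Longrightarrow>
                \<bar>g y - g t - (y - t) * g' t\<bar> \<le> e1 * \<bar>y - t\<bar>"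
      and d2: "\<And>t. t \<in> N \<Longrightarrow> ball t (d t) \<subseteq> U"
      by metis
    show "\<exists>\<gamma>. gauge \<gamma> \<and> (\<forall>\<D>. \<D> tagged_division_of {a..b} \<and> \<gamma> fine \<D> \<longrightarrow>
            norm ((\<Sum>(x, K)\<in>\<D>. measure lborel K *\<^sub>R h x) - (g b - g a)) < e)"
    proof (intro exI conjI allI impI)
      show "gauge (\<lambda>t. ball t (d t))"
        using d by (simp add: gauge_ball_dependent)
      fix p
      assume "p tagged_division_of {a..b} \<and> (\<lambda>t. ball t (d t)) fine p"
      then have p: "p tagged_division_of {a..b}" and fine: "(\<lambda>t. ball t (d t)) fine p"
        by auto
      have finp: "finite p" using p by auto
      have Kform: "\<exists>u v. K = {u..v} \<and> u \<le> v \<and> x \<in> {u..v} \<and> {u..v} \<subseteq> {a..b} \<and> {u..v} \<subseteq> ball x (d x)"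
        if "(x,K) \<in> p" for x K
        using tagged_division_ofD(2,3,4)[OF p that] fineD[OF fine that] by auto
      define bad where "bad = {xk \<in> p. fst xk \<in> N}"
      define good where "good = {xk \<in> p. fst xk \<notin> N}"
      define E where "E = (\<lambda>(x, K). measure lborel K *\<^sub>R h x - (g (Sup K) - g (Inf K)))"
      have split: "sum E p = sum E good + sum E bad"
        unfolding good_def bad_def using finp
        by (subst sum.union_disjoint[symmetric]) (auto intro!: sum.cong)
      have "(\<Sum>(x, K)\<in>p. measure lborel K *\<^sub>R h x) - (g b - g a) = sum E p"
        using additive_tagged_division_1[OF \<open>a \<le> b\<close> p, of g]
        by (simp add: E_def split_def sum_subtractf)
      moreover have "\<bar>sum E good\<bar> \<le> e1 * (b - a)"
      proof -
        have "\<bar>sum E good\<bar> \<le> (\<Sum>(x,K)\<in>good. e1 * measure lborel K)"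
        proof (rule order_trans[OF sum_abs], rule sum_mono)
          fix xk assume xk: "xk \<in> good"
          obtain x K where [simp]: "xk = (x,K)" by force
          have xp: "(x,K) \<in> p" "x \<notin> N" using xk by (auto simp: good_def)
          obtain u v where K: "K = {u..v}" "u \<le> v" "x \<in> {u..v}" "{u..v} \<subseteq> {a..b}" "{u..v} \<subseteq> ball x (d x)"
            using Kform[OF xp(1)] by blast
          have "u \<in> {u..v}" "v \<in> {u..v}" using K(2) by auto
          with K have "u \<in> ball x (d x)" "v \<in> ball x (d x)" "u \<in> {a..b}" "v \<in> {a..b}" "x \<in> {a..b}"
            by blast+
          then have "\<bar>g u - g x - (u - x) * g' x\<bar> \<le> e1 * \<bar>u - x\<bar>"
            "\<bar>g v - g x - (v - x) * g' x\<bar> \<le> e1 * \<bar>v - x\<bar>"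
            using d1[of x u] d1[of x v] xp by (auto simp: dist_real_def abs_minus_commute)
          moreover have "(v - u) * g' x - (g v - g u) = (g u - g x - (u - x) * g' x) - (g v - g x - (v - x) * g' x)"
            by (simp add: algebra_simps)
          moreover have "\<bar>u - x\<bar> = x - u" "\<bar>v - x\<bar> = v - x" using K by auto
          ultimately have "\<bar>(v - u) * g' x - (g v - g u)\<bar> \<le> e1 * (x - u) + e1 * (v - x)"
            by simp
          then show "\<bar>E xk\<bar> \<le> (case xk of (x, K) \<Rightarrow> e1 * measure lborel K)"
            using K xp by (simp add: E_def h_def algebra_simps)
        qed
        also have "\<dots> \<le> (\<Sum>(x,K)\<in>p. e1 * measure lborel K)"
          using finp e1 by (intro sum_mono2) (auto simp: good_def)
        also have "\<dots> = e1 * (b - a)"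
          using additive_content_tagged_division[of p a b] p \<open>a \<le> b\<close>
          by (simp add: split_def flip: sum_distrib_left)
        finally show ?thesis .
      qed
      moreover have "\<bar>sum E bad\<bar> < e / 2"
      proof -
        have badp: "bad \<subseteq> p" by (auto simp: bad_def)
        have "p tagged_partial_division_of {a..b}"
          using p by (simp add: tagged_division_of_def)
        then have tagbad: "bad tagged_division_of \<Union>(snd ` bad)"
          by (rule tagged_partial_division_of_Union_self[OF tagged_partial_division_subset[OF _ badp]]) 
        have divbad: "snd ` bad division_of \<Union>(snd ` bad)"
          by (rule division_of_tagged_division[OF tagbad])
        have sub: "\<Union>(snd ` bad) \<subseteq> {a..b}" "\<Union>(snd ` bad) \<subseteq> U"
        proof -
          show "\<Union>(snd ` bad) \<subseteq> {a..b}"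
          proof (rule Union_least)
            fix K assume "K \<in> snd ` bad"
            then obtain x where "(x, K) \<in> p" by (auto simp: bad_def)
            then show "K \<subseteq> {a..b}" by (rule tagged_division_ofD(3)[OF p])
          qed
          have "K \<subseteq> U" if "(x, K) \<in> p" "x \<in> N" for x K
            using fineD[OF fine that(1)] d2[OF that(2)] by blast
          then show "\<Union>(snd ` bad) \<subseteq> U"
            unfolding bad_def by (simp add: image_def) blast
        qed
        have "(\<Sum>K\<in>snd ` bad. Sup K - Inf K) = (\<Sum>K\<in>snd ` bad. measure lebesgue K)"
        proof (rule sum.cong[OF refl])
          fix K assume "K \<in> snd ` bad"
          then obtain x where "(x,K) \<in> p" by (auto simp: bad_def)
          from Kform[OF this] show "Sup K - Inf K = measure lebesgue K" by auto
        qed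
        also have "\<dots> = measure lebesgue (\<Union>(snd ` bad))"
          using divbad by (rule content_division)
        also have "\<dots> \<le> measure lebesgue U"
          using sub U divbad by (intro measure_mono_fmeasurable) (auto intro: lmeasurable_division fmeasurableD)
        finally have "(\<Sum>K\<in>snd ` bad. \<bar>g (Sup K) - g (Inf K)\<bar>) < e / 2"
          using U by (intro ac\<delta> divbad sub) auto
        moreover have "\<bar>sum E bad\<bar> \<le> (\<Sum>(x,K)\<in>bad. \<bar>g (Sup K) - g (Inf K)\<bar>)"
          by (rule order_trans[OF sum_abs], rule sum_mono) (auto simp: E_def bad_def h_def)
        ultimately show ?thesis
          using sum_abs_tagged_eq_division[OF tagbad, of g] by simp
      qed
      ultimately show "norm ((\<Sum>(x, K)\<in>p. measure lborel K *\<^sub>R h x) - (g b - g a)) < e"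
        using split e1 by simp
    qed
  qed
  then show ?thesis
    by (rule has_integral_spike[OF N, rotated]) (auto simp: h_def)
qed

text \<open>
  Up to an error \<open>w\<close> with small integral, \<open>\<bar>f\<bar>\<close> is bounded by some \<open>n\<close>, and for bounded functions
  the claim is obvious.
\<close>

lemma absolutely_continuous_on_indefinite_integral:
  fixes f :: "real \<Rightarrow> real"
  assumes f: "f absolutely_integrable_on {a..b}"
    and g: "\<And>t. t \<in> {a..b} \<Longrightarrow> g t = c + integral {a..t} f"
  shows "absolutely_continuous_on {a..b} g"
  unfolding absolutely_continuous_on_def
proof (intro allI impI)
  fix e :: real assume e: "e > 0"
  let ?S = "{a..b}"
  have intf: "(\<lambda>x. \<bar>f x\<bar>) absolutely_integrable_on ?S"
    using f by (rule set_integrable_abs)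
  define ind where "ind = (\<lambda>n::nat. \<lambda>x. indicator {x. real n < \<bar>f x\<bar>} x * \<bar>f x\<bar>)"
  have "(\<lambda>n. LINT x:?S|lebesgue. min \<bar>f x\<bar> (real n)) \<longlonglongrightarrow> (LINT x:?S|lebesgue. \<bar>f x\<bar>)"
    unfolding set_lebesgue_integral_def
  proof (rule integral_dominated_convergence[where w = "\<lambda>x. indicator ?S x *\<^sub>R \<bar>f x\<bar>"])
    have m: "(\<lambda>x. indicator ?S x *\<^sub>R \<bar>f x\<bar>) \<in> borel_measurable lebesgue"
      using intf by (simp add: set_integrable_def borel_measurable_integrable)
    then show "(\<lambda>x. indicator ?S x *\<^sub>R \<bar>f x\<bar>) \<in> borel_measurable lebesgue" .
    show "integrable lebesgue (\<lambda>x. indicator ?S x *\<^sub>R \<bar>f x\<bar>)"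
      using intf by (simp add: set_integrable_def)
    have "(\<lambda>x. indicator ?S x *\<^sub>R min \<bar>f x\<bar> (real n)) = (\<lambda>x. min (indicator ?S x *\<^sub>R \<bar>f x\<bar>) (indicator ?S x * real n))" for n
      by (auto simp: indicator_def)
    then show "(\<lambda>x. indicator ?S x *\<^sub>R min \<bar>f x\<bar> (real n)) \<in> borel_measurable lebesgue" for n
      using borel_measurable_min[OF m, of "\<lambda>x. indicator ?S x * real n"]
      by (simp add: borel_measurable_times borel_measurable_indicator min.commute)
    show "AE x in lebesgue. (\<lambda>n. indicator ?S x *\<^sub>R min \<bar>f x\<bar> (real n)) \<longlonglongrightarrow> indicator ?S x *\<^sub>R \<bar>f x\<bar>"
    proof (rule AE_I2, rule tendsto_eventually)
      fix x
      obtain m :: nat where "\<bar>f x\<bar> \<le> m" using real_arch_simple by blast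
      then show "\<forall>\<^sub>F n in sequentially. indicator ?S x *\<^sub>R min \<bar>f x\<bar> (real n) = indicator ?S x *\<^sub>R \<bar>f x\<bar>"
        by (intro eventually_sequentiallyI[of m]) (auto simp: min_def)
    qed
    show "AE x in lebesgue. norm (indicator ?S x *\<^sub>R min \<bar>f x\<bar> (real n)) \<le> indicator ?S x *\<^sub>R \<bar>f x\<bar>" for n
      by (auto simp: indicator_def)
  qed
  then obtain n where n: "\<bar>(LINT x:?S|lebesgue. min \<bar>f x\<bar> (real n)) - (LINT x:?S|lebesgue. \<bar>f x\<bar>)\<bar> < e / 2"
    using e by (metis LIMSEQ_iff half_gt_zero order_refl real_norm_def)
  define w where "w = (\<lambda>x. \<bar>f x\<bar> - min \<bar>f x\<bar> (real n))"
  have minint: "(\<lambda>x. min \<bar>f x\<bar> (real n)) absolutely_integrable_on ?S"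
    by (rule absolutely_integrable_min_1) (use intf in auto)
  have wint: "w absolutely_integrable_on ?S"
    unfolding w_def by (rule set_integral_diff(1)[OF intf minint])
  have wsmall: "integral ?S w < e / 2"
    using n set_integral_diff(2)[OF intf minint] set_lebesgue_integral_eq_integral(2)[OF wint]
    unfolding w_def by linarith
  define \<delta> where "\<delta> = e / (2 * (real n + 1))"
  show "\<exists>\<delta>>0. \<forall>D. D division_of \<Union>D \<and> \<Union>D \<subseteq> {a..b} \<and> (\<Sum>K\<in>D. Sup K - Inf K) < \<delta> \<longrightarrow>
        (\<Sum>K\<in>D. \<bar>g (Sup K) - g (Inf K)\<bar>) < e"
  proof (intro exI[of _ \<delta>] conjI allI impI)
    show "\<delta> > 0" using e by (simp add: \<delta>_def)
    fix D assume D: "D division_of \<Union>D \<and> \<Union>D \<subseteq> {a..b} \<and> (\<Sum>K\<in>D. Sup K - Inf K) < \<delta>"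
    then have Ddiv: "D division_of \<Union>D" and Dsub: "\<Union>D \<subseteq> {a..b}"
      and Dlen: "(\<Sum>K\<in>D. Sup K - Inf K) < \<delta>"
      by blast+
    have Kform: "\<exists>u v. K = {u..v} \<and> u \<le> v \<and> {u..v} \<subseteq> {a..b}" if "K \<in> D" for K
    proof -
      have "K \<noteq> {}" "\<exists>u v. K = cbox u v"
        using division_ofD(3,4)[OF Ddiv that] by auto
      then obtain u v where "K = cbox u v" "K \<noteq> {}" by blast
      moreover have "K \<subseteq> {a..b}" using Dsub that by blast
      ultimately show ?thesis by (intro exI[of _ u] exI[of _ v]) auto
    qed
    have fint: "f integrable_on {a..b}"
      using f by (rule set_lebesgue_integral_eq_integral(1))
    have wi: "w integrable_on {a..b}" using wint by (rule set_lebesgue_integral_eq_integral(1))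
    have each: "\<bar>g (Sup K) - g (Inf K)\<bar> \<le> integral K w + real n * (Sup K - Inf K)" if KD: "K \<in> D" for K
    proof -
      obtain u v where K: "K = {u..v}" "u \<le> v" "{u..v} \<subseteq> {a..b}"
        using Kform[OF KD] by blast
      then have uv: "u \<in> {a..b}" "v \<in> {a..b}" by auto
      have "integral {a..u} f + integral {u..v} f = integral {a..v} f"
        using uv K by (intro Henstock_Kurzweil_Integration.integral_combine integrable_on_subinterval[OF fint]) auto
      then have "g v - g u = integral {u..v} f"
        using g[OF uv(1)] g[OF uv(2)] by simp
      moreover have "\<bar>integral {u..v} f\<bar> \<le> integral {u..v} (\<lambda>x. w x + real n)"
        unfolding real_norm_def[symmetric]
      proof (rule integral_norm_bound_integral)
        show "f integrable_on {u..v}" using fint K(3) by (rule integrable_on_subinterval)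
        show "(\<lambda>x. w x + real n) integrable_on {u..v}"
          by (intro integrable_add integrable_on_subinterval[OF wi K(3)] integrable_const_ivl)
        show "norm (f x) \<le> w x + real n" for x by (simp add: w_def)
      qed
      moreover have "integral {u..v} (\<lambda>x. w x + real n) = integral {u..v} w + real n * (v - u)"
        using K(2) by (subst integral_add[OF integrable_on_subinterval[OF wi K(3)] integrable_const_ivl]) simp
      ultimately show ?thesis using K by simp
    qed
    have wU: "w integrable_on \<Union>D"
      by (rule integrable_on_subdivision[OF Ddiv wi Dsub])
    have "(\<Sum>K\<in>D. \<bar>g (Sup K) - g (Inf K)\<bar>) \<le> (\<Sum>K\<in>D. integral K w) + real n * (\<Sum>K\<in>D. Sup K - Inf K)"
      using sum_mono[OF each] by (simp add: sum.distrib sum_distrib_left)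
    also have "(\<Sum>K\<in>D. integral K w) = integral (\<Union>D) w"
      by (rule integral_combine_division_topdown[OF wU Ddiv, symmetric])
    also have "\<dots> \<le> integral ?S w"
      by (rule integral_subset_le[OF Dsub wU wi]) (simp add: w_def)
    also have "real n * (\<Sum>K\<in>D. Sup K - Inf K) \<le> real n * \<delta>"
      using Dlen by (intro mult_left_mono) auto
    also have "real n * \<delta> \<le> e / 2"
      using e by (simp add: \<delta>_def field_simps)
    finally show "(\<Sum>K\<in>D. \<bar>g (Sup K) - g (Inf K)\<bar>) < e"
      using wsmall by simp
  qed
qed

lemma indefinite_integral_right_derivative_AE:
  fixes f :: "real \<Rightarrow> real"
  assumes f: "\<And>a b. f integrable_on {a..b}"
  obtains N where "negligible N"
    "\<And>x. x \<notin> N \<Longrightarrow> ((\<lambda>h. integral {x..x + h} f / h) \<longlongrightarrow> f x) (at_right 0)"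
proof -
  obtain N where N: "negligible N"
    "\<And>x e. \<lbrakk>x \<notin> N; 0 < e\<rbrakk> \<Longrightarrow> \<exists>d>0. \<forall>h. 0 < h \<and> h < d \<longrightarrow>
                 norm (integral (cbox x (x + h *\<^sub>R One)) f /\<^sub>R h ^ DIM(real) - f x) < e"
    using integrable_ccontinuous_explicit[of f] f by (metis box_real(2))
  show thesis
  proof (rule that[OF N(1)])
    fix x assume "x \<notin> N"
    show "((\<lambda>h. integral {x..x + h} f / h) \<longlongrightarrow> f x) (at_right 0)"
    proof (rule tendstoI)
      fix e :: real assume "e > 0"
      then obtain d where "d > 0" "\<And>h. 0 < h \<and> h < d \<Longrightarrow> \<bar>integral {x..x + h} f / h - f x\<bar> < e"
        using N(2)[OF \<open>x \<notin> N\<close> \<open>e > 0\<close>] by (auto simp: divide_inverse mult.commute)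
      then show "\<forall>\<^sub>F h in at_right 0. dist (integral {x..x + h} f / h) (f x) < e"
        unfolding eventually_at_right_field dist_real_def by (intro exI[of _ d]) auto
    qed
  qed
qed

text \<open>
  The left derivative is the right derivative of the reflected function.
\<close>

lemma indefinite_integral_derivative_AE:
  fixes f :: "real \<Rightarrow> real"
  assumes f: "\<And>a b. f integrable_on {a..b}"
    and g: "\<And>t. t > 0 \<Longrightarrow> g t = c + integral {0..t} f"
  shows "AE t in lebesgue. t > 0 \<longrightarrow> (g has_real_derivative f t) (at t)"
proof -
  obtain N1 where N1: "negligible N1"
    "\<And>x. x \<notin> N1 \<Longrightarrow> ((\<lambda>h. integral {x..x + h} f / h) \<longlongrightarrow> f x) (at_right 0)"
    using indefinite_integral_right_derivative_AE[OF f] by blast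
  have "(\<lambda>x. f (- x)) integrable_on {a..b}" for a b
    using f[of "-b" "-a"] Henstock_Kurzweil_Integration.integrable_reflect_real[of f "-a" "-b"] by simp
  then obtain N2 where N2: "negligible N2"
    "\<And>x. x \<notin> N2 \<Longrightarrow> ((\<lambda>h. integral {x..x + h} (\<lambda>x. f (- x)) / h) \<longlongrightarrow> f (- x)) (at_right 0)"
    using indefinite_integral_right_derivative_AE[of "\<lambda>x. f (- x)"] by blast
  have "negligible (N1 \<union> uminus ` N2)"
    using N1(1) N2(1)
    by (intro negligible_Un negligible_differentiable_image_negligible) (auto intro!: derivative_intros)
  then have "AE t in lebesgue. t \<notin> N1 \<union> uminus ` N2"
    unfolding negligible_iff_null_sets by (rule AE_not_in)
  then show ?thesis
  proof eventually_elim
    fix t assume t: "t \<notin> N1 \<union> uminus ` N2"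
    show "t > 0 \<longrightarrow> (g has_real_derivative f t) (at t)"
    proof
      assume "t > 0"
      have R: "((\<lambda>h. (g (t + h) - g t) / h) \<longlongrightarrow> f t) (at_right 0)"
      proof (rule Lim_transform_eventually[OF N1(2)])
        show "t \<notin> N1" using t by auto
        show "\<forall>\<^sub>F h in at_right 0. integral {t..t + h} f / h = (g (t + h) - g t) / h"
          using eventually_at_right_less[of 0]
        proof eventually_elim
          case (elim h)
          then have "integral {0..t} f + integral {t..t + h} f = integral {0..t + h} f"
            using \<open>t > 0\<close> by (intro Henstock_Kurzweil_Integration.integral_combine f) auto
          then show ?case using g[of t] g[of "t + h"] \<open>t > 0\<close> elim by simp
        qed
      qed
      have L: "((\<lambda>h. (g (t + h) - g t) / h) \<longlongrightarrow> f t) (at_left 0)"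
      proof -
        have "- t \<notin> N2" using t by force
        have N2t: "((\<lambda>h. integral {- t..- t + h} (\<lambda>x. f (- x)) / h) \<longlongrightarrow> f t) (at_right 0)"
          using N2(2)[OF \<open>- t \<notin> N2\<close>] by simp
        have "((\<lambda>h. (g (t + (- h)) - g t) / (- h)) \<longlongrightarrow> f t) (at_right 0)"
        proof (rule Lim_transform_eventually[OF N2t])
          have "\<forall>\<^sub>F h in at_right 0. h < t"
            using \<open>t > 0\<close> by (intro eventually_at_right_real[THEN eventually_mono]) auto
          with eventually_at_right_less[of 0]
          show "\<forall>\<^sub>F h in at_right 0. integral {- t..- t + h} (\<lambda>x. f (- x)) / h = (g (t + (- h)) - g t) / (- h)"
          proof eventually_elim
            case (elim h)
            have "integral {0..t - h} f + integral {t - h..t} f = integral {0..t} f"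
              using elim by (intro Henstock_Kurzweil_Integration.integral_combine f) auto
            moreover have "integral {- t..- t + h} (\<lambda>x. f (- x)) = integral {t - h..t} f"
              using Henstock_Kurzweil_Integration.integral_reflect_real[of t "t - h" f] by simp
            ultimately show ?case using g[of t] g[of "t - h"] elim by (simp add: field_simps)
          qed
        qed
        then show ?thesis
          by (subst filterlim_at_left_to_right) simp
      qed
      show "(g has_real_derivative f t) (at t)"
        unfolding DERIV_def by (rule filterlim_split_at[OF L R])
    qed
  qed
qed

section \<open>The Jordan decomposition of a finite signed measure\<close>

locale signed_measure =
  fixes M :: "'a measure" and \<mu> :: "'a set \<Rightarrow> real"
  assumes fsm: "finite_signed_measure M \<mu>"
begin

lemma countably_additive:
  fixes A :: "nat \<Rightarrow> 'a set"
  assumes "\<And>n. A n \<in> sets M" "disjoint_family A"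
  shows "(\<lambda>n. \<mu> (A n)) sums \<mu> (\<Union>n. A n)"
  using fsm assms unfolding finite_signed_measure_def by auto

lemma empty_eq_0: "\<mu> {} = 0"
proof -
  have "(\<lambda>n::nat. \<mu> {}) sums \<mu> {}"
    using countably_additive[of "\<lambda>n. {}"] by (auto simp: disjoint_family_on_def)
  then have "(\<lambda>n::nat. \<mu> {}) \<longlonglongrightarrow> 0"
    using sums_summable summable_LIMSEQ_zero by blast
  then show ?thesis
    using LIMSEQ_unique tendsto_const by blast
qed

lemma additive:
  assumes "A \<in> sets M" "B \<in> sets M" "A \<inter> B = {}"
  shows "\<mu> (A \<union> B) = \<mu> A + \<mu> B"
proof -
  have "(\<lambda>n. \<mu> (binaryset A B n)) sums \<mu> (\<Union>n. binaryset A B n)"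
    by (rule countably_additive) (use assms in \<open>auto simp: disjoint_family_on_def binaryset_def\<close>)
  then have "(\<lambda>n. \<mu> (binaryset A B n)) sums \<mu> (A \<union> B)"
    by (simp add: UN_binaryset_eq)
  then show ?thesis
    using binaryset_sums[of \<mu>, OF empty_eq_0] sums_unique2 by blast
qed

lemma diff:
  assumes "A \<in> sets M" "B \<in> sets M" "B \<subseteq> A"
  shows "\<mu> (A - B) = \<mu> A - \<mu> B"
  using additive[of "A - B" B] assms by (simp add: Un_absorb2 Int_commute)

text \<open>
  If \<open>\<mu>\<close> were unbounded on the subsets of \<open>A\<close>, then one could split off from \<open>A\<close> a piece with
  \<open>\<bar>\<mu>\<bar> \<ge> 1\<close> such that \<open>\<mu>\<close> is still unbounded below the remainder. Repeating this yields
  disjoint pieces whose \<open>\<mu>\<close>-values do not tend to \<open>0\<close>, contrary to countable additivity.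
\<close>

lemma bounded_range:
  obtains K where "\<And>B. B \<in> sets M \<Longrightarrow> \<bar>\<mu> B\<bar> \<le> K"
proof (rule ccontr)
  define bad where "bad A \<longleftrightarrow> A \<in> sets M \<and> (\<forall>K. \<exists>B\<in>sets M. B \<subseteq> A \<and> \<bar>\<mu> B\<bar> > K)" for A
  assume "\<not> thesis"
  then have "\<forall>K. \<exists>B\<in>sets M. \<bar>\<mu> B\<bar> > K"
    using that by (meson not_le)
  then have bad0: "bad (space M)"
    unfolding bad_def by (meson sets.sets_into_space sets.top)
  have split: "bad B \<or> bad (A - B)" if A: "bad A" and B: "B \<in> sets M" "B \<subseteq> A" for A B
  proof (rule ccontr)
    assume "\<not> (bad B \<or> bad (A - B))"
    then obtain K1 K2 where K: "\<And>C. \<lbrakk>C \<in> sets M; C \<subseteq> B\<rbrakk> \<Longrightarrow> \<bar>\<mu> C\<bar> \<le> K1"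
       "\<And>C. \<lbrakk>C \<in> sets M; C \<subseteq> A - B\<rbrakk> \<Longrightarrow> \<bar>\<mu> C\<bar> \<le> K2"
      using A B unfolding bad_def by (metis not_le sets.Diff)
    obtain C where C: "C \<in> sets M" "C \<subseteq> A" "\<bar>\<mu> C\<bar> > K1 + K2"
      using A unfolding bad_def by blast
    have "\<mu> C = \<mu> (C \<inter> B) + \<mu> (C - B)"
      using additive[of "C \<inter> B" "C - B"] C B by (simp add: Int_Diff_Un Int_Diff_disjoint sets.Int sets.Diff)
    moreover have "\<bar>\<mu> (C \<inter> B)\<bar> \<le> K1" "\<bar>\<mu> (C - B)\<bar> \<le> K2"
      using K(1)[of "C \<inter> B"] K(2)[of "C - B"] C B by auto
    ultimately show False using C by linarith
  qed
  have step: "\<exists>A'. bad A' \<and> A' \<subseteq> A \<and> \<bar>\<mu> (A - A')\<bar> \<ge> 1" if A: "bad A" for A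
  proof -
    have Am: "A \<in> sets M" using A by (simp add: bad_def)
    obtain B where B: "B \<in> sets M" "B \<subseteq> A" "\<bar>\<mu> B\<bar> > \<bar>\<mu> A\<bar> + 1"
      using A unfolding bad_def by blast
    have "\<mu> (A - B) = \<mu> A - \<mu> B" using diff[OF Am] B by blast
    then have "\<bar>\<mu> (A - B)\<bar> \<ge> 1" using B by linarith
    moreover have "A - (A - B) = B" using B by blast
    moreover have "\<bar>\<mu> B\<bar> \<ge> 1" using B by linarith
    ultimately have *: "\<bar>\<mu> (A - (A - B))\<bar> \<ge> 1" by simp
    show ?thesis
      using split[OF A B(1,2)]
    proof
      assume "bad B"
      then show ?thesis using B(2) \<open>\<bar>\<mu> (A - B)\<bar> \<ge> 1\<close> by (intro exI[of _ B]) simp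
    next
      assume "bad (A - B)"
      then show ?thesis using * by (intro exI[of _ "A - B"]) simp
    qed
  qed
  have "\<exists>f::nat \<Rightarrow> 'a set. \<forall>n. bad (f n) \<and> (f (Suc n) \<subseteq> f n \<and> \<bar>\<mu> (f n - f (Suc n))\<bar> \<ge> 1)"
  proof (rule dependent_nat_choice)
    show "\<exists>A. bad A" using bad0 ..
    show "\<exists>A'. bad A' \<and> (A' \<subseteq> A \<and> \<bar>\<mu> (A - A')\<bar> \<ge> 1)" if "bad A" for A and n :: nat
      by (rule step[OF that])
  qed
  then obtain f :: "nat \<Rightarrow> 'a set" where "\<forall>n. bad (f n) \<and> (f (Suc n) \<subseteq> f n \<and> \<bar>\<mu> (f n - f (Suc n))\<bar> \<ge> 1)" ..
  then have f: "\<And>n. bad (f n)" "\<And>n. f (Suc n) \<subseteq> f n" "\<And>n. \<bar>\<mu> (f n - f (Suc n))\<bar> \<ge> 1"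
    by simp_all
  have "decseq f" using f(2) by (rule decseq_SucI)
  have disj: "disjoint_family (\<lambda>n. f n - f (Suc n))"
  proof -
    have "(f m - f (Suc m)) \<inter> (f n - f (Suc n)) = {}" if "m < n" for m n
      using decseqD[OF \<open>decseq f\<close>, of "Suc m" n] that by auto
    then show ?thesis
      unfolding disjoint_family_on_def by (metis Int_commute linorder_neqE_nat)
  qed
  have "(\<lambda>n. \<mu> (f n - f (Suc n))) \<longlonglongrightarrow> 0"
  proof (rule summable_LIMSEQ_zero[OF sums_summable[OF countably_additive[OF _ disj]]])
    show "f n - f (Suc n) \<in> sets M" for n
      using f(1) by (simp add: bad_def sets.Diff)
  qed
  then have "\<forall>\<^sub>F n in sequentially. \<bar>\<mu> (f n - f (Suc n))\<bar> < 1"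
    using order_tendstoD(2)[OF tendsto_rabs_zero, of "\<lambda>n. \<mu> (f n - f (Suc n))" sequentially 1] by simp
  then show False
    using eventually_happens'[OF sequentially_bot] f(3) not_less by auto
qed

lemma sets_upper_variation [simp]: "sets (upper_variation M \<mu>) = sets M"
  by (simp add: upper_variation_def sets.space_closed)

lemma space_upper_variation [simp]: "space (upper_variation M \<mu>) = space M"
  by (simp add: upper_variation_def sets.space_closed)

definition upvar :: "'a set \<Rightarrow> real" where
  "upvar A = (SUP B\<in>{B \<in> sets M. B \<subseteq> A}. \<mu> B)"

lemma bdd: "bdd_above (\<mu> ` {B \<in> sets M. B \<subseteq> A})"
proof -
  obtain K where "\<And>B. B \<in> sets M \<Longrightarrow> \<bar>\<mu> B\<bar> \<le> K" using bounded_range by blast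
  then show ?thesis by (intro bdd_aboveI2[of _ _ K]) force
qed

lemma upvar_upper: "\<lbrakk>B \<in> sets M; B \<subseteq> A\<rbrakk> \<Longrightarrow> \<mu> B \<le> upvar A"
  unfolding upvar_def by (rule cSUP_upper[OF _ bdd]) auto

lemma upvar_least: "(\<And>B. \<lbrakk>B \<in> sets M; B \<subseteq> A\<rbrakk> \<Longrightarrow> \<mu> B \<le> c) \<Longrightarrow> upvar A \<le> c"
  unfolding upvar_def by (rule cSUP_least) auto

lemma upvar_nonneg: "0 \<le> upvar A"
  using upvar_upper[of "{}" A] by (simp add: empty_eq_0)

lemma ennreal_upvar: "(SUP B \<in> {B \<in> sets M. B \<subseteq> A}. ennreal (\<mu> B)) = ennreal (upvar A)"
proof (rule antisym)
  show "(SUP B \<in> {B \<in> sets M. B \<subseteq> A}. ennreal (\<mu> B)) \<le> ennreal (upvar A)"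
    by (rule SUP_least) (auto intro: ennreal_leI upvar_upper)
  show "ennreal (upvar A) \<le> (SUP B \<in> {B \<in> sets M. B \<subseteq> A}. ennreal (\<mu> B))"
  proof (rule ennreal_le_epsilon)
    fix e :: real assume "e > 0"
    then obtain B where B: "B \<in> sets M" "B \<subseteq> A" "upvar A - e < \<mu> B"
      using upvar_least[of A "upvar A - e"] by force
    then have "ennreal (upvar A) \<le> ennreal (\<mu> B + e)" by (intro ennreal_leI) auto
    also have "\<dots> \<le> ennreal (\<mu> B) + ennreal e"
      using \<open>e > 0\<close> ennreal_plus_if[of "\<mu> B" e]
      by (cases "\<mu> B \<ge> 0") (auto simp: ennreal_neg ennreal_leI)
    also have "\<dots> \<le> (SUP B \<in> {B \<in> sets M. B \<subseteq> A}. ennreal (\<mu> B)) + ennreal e"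
      using B by (intro add_right_mono SUP_upper) auto
    finally show "ennreal (upvar A) \<le> (SUP B \<in> {B \<in> sets M. B \<subseteq> A}. ennreal (\<mu> B)) + ennreal e" .
  qed
qed

lemma upvar_disjoint_Un:
  assumes "A \<in> sets M" "B \<in> sets M" "A \<inter> B = {}"
  shows "upvar A + upvar B \<le> upvar (A \<union> B)"
proof -
  have "\<mu> C \<le> upvar (A \<union> B) - \<mu> D" if "C \<in> sets M" "C \<subseteq> A" "D \<in> sets M" "D \<subseteq> B" for C D
  proof -
    have "\<mu> (C \<union> D) = \<mu> C + \<mu> D" using that assms by (intro additive) auto
    moreover have "\<mu> (C \<union> D) \<le> upvar (A \<union> B)" using that by (intro upvar_upper) auto
    ultimately show ?thesis by simp
  qed
  then have "upvar A \<le> upvar (A \<union> B) - \<mu> D" if "D \<in> sets M" "D \<subseteq> B" for D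
    using that by (intro upvar_least) auto
  then have "upvar B \<le> upvar (A \<union> B) - upvar A"
    by (intro upvar_least) (simp add: algebra_simps)
  then show ?thesis by simp
qed

lemma upvar_mono: "A \<subseteq> B \<Longrightarrow> upvar A \<le> upvar B"
  by (rule upvar_least) (meson upvar_upper order_trans)

lemma upvar_UN:
  fixes A :: "nat \<Rightarrow> 'a set"
  assumes A: "\<And>n. A n \<in> sets M" and disj: "disjoint_family A"
  shows "(\<lambda>n. upvar (A n)) sums upvar (\<Union>n. A n)"
proof -
  have part: "(\<Sum>i<n. upvar (A i)) \<le> upvar (\<Union>i<n. A i)" for n
  proof (induction n)
    case (Suc n)
    have "A i \<inter> A n = {}" if "i < n" for i
      using disj that by (auto simp: disjoint_family_on_def)
    then have "(\<Union>i<n. A i) \<inter> A n = {}"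
      by blast
    then have "upvar (\<Union>i<n. A i) + upvar (A n) \<le> upvar ((\<Union>i<n. A i) \<union> A n)"
      using A by (intro upvar_disjoint_Un) auto
    then show ?case using Suc by (simp add: lessThan_Suc Un_commute)
  qed (simp add: upvar_nonneg)
  have le: "(\<Sum>i<n. upvar (A i)) \<le> upvar (\<Union>n. A n)" for n
    by (rule order_trans[OF part upvar_mono]) auto
  have sm: "summable (\<lambda>n. upvar (A n))"
    using le upvar_nonneg by (intro bounded_imp_summable[where B = "upvar (\<Union>n. A n)"])
      (auto simp flip: lessThan_Suc_atMost simp del: sum.lessThan_Suc)
  have "upvar (\<Union>n. A n) \<le> (\<Sum>n. upvar (A n))"
  proof (rule upvar_least)
    fix B assume B: "B \<in> sets M" "B \<subseteq> (\<Union>n. A n)"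
    have "(\<lambda>n. \<mu> (B \<inter> A n)) sums \<mu> (\<Union>n. B \<inter> A n)"
    proof (rule countably_additive)
      show "disjoint_family (\<lambda>n. B \<inter> A n)"
        by (rule disjoint_family_on_bisimulation[OF disj]) auto
    qed (use A B in auto)
    moreover have "(\<Union>n. B \<inter> A n) = B" using B by blast
    ultimately have sB: "(\<lambda>n. \<mu> (B \<inter> A n)) sums \<mu> B" by simp
    show "\<mu> B \<le> (\<Sum>n. upvar (A n))"
    proof (rule sums_le[OF _ sB summable_sums[OF sm]])
      show "\<mu> (B \<inter> A n) \<le> upvar (A n)" for n
        using A B by (intro upvar_upper) auto
    qed
  qed
  moreover have "(\<Sum>n. upvar (A n)) \<le> upvar (\<Union>n. A n)"
    using le by (intro suminf_le_const[OF sm])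
  ultimately show ?thesis
    using sm by (simp add: sums_iff)
qed

lemma emeasure_upper_variation:
  assumes "A \<in> sets M"
  shows "emeasure (upper_variation M \<mu>) A = ennreal (upvar A)"
proof -
  have "emeasure (upper_variation M \<mu>) A = (SUP B \<in> {B \<in> sets M. B \<subseteq> A}. ennreal (\<mu> B))"
  proof (rule emeasure_measure_of[OF upper_variation_def])
    show "sets M \<subseteq> Pow (space M)" by (rule sets.space_closed)
    show "positive (sets (upper_variation M \<mu>)) (\<lambda>A. SUP B \<in> {B \<in> sets M. B \<subseteq> A}. ennreal (\<mu> B))"
      unfolding ennreal_upvar positive_def
      using upvar_least[of "{}" 0] upvar_nonneg[of "{}"] by (auto simp: empty_eq_0)
    show "countably_additive (sets (upper_variation M \<mu>)) (\<lambda>A. SUP B \<in> {B \<in> sets M. B \<subseteq> A}. ennreal (\<mu> B))"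
      unfolding ennreal_upvar countably_additive_def
    proof (intro allI impI)
      fix F :: "nat \<Rightarrow> 'a set"
      assume F: "range F \<subseteq> sets (upper_variation M \<mu>)" "disjoint_family F"
      then have "(\<lambda>n. upvar (F n)) sums upvar (\<Union>n. F n)"
        by (intro upvar_UN) auto
      then show "(\<Sum>i. ennreal (upvar (F i))) = ennreal (upvar (\<Union> (range F)))"
        using upvar_nonneg by (intro suminf_ennreal_eq)
    qed
    show "A \<in> sets (upper_variation M \<mu>)" using assms by simp
  qed
  then show ?thesis by (simp add: ennreal_upvar)
qed

lemma finite_measure_upper_variation: "finite_measure (upper_variation M \<mu>)"
  by (rule finite_measureI) (simp add: emeasure_upper_variation)

lemma signed_measure_uminus: "signed_measure M (\<lambda>A. - \<mu> A)"
proof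
  show "finite_signed_measure M (\<lambda>A. - \<mu> A)"
    using fsm unfolding finite_signed_measure_def by (auto intro: sums_minus)
qed

lemma upvar_minus: 
  assumes "A \<in> sets M"
  shows "upvar A - signed_measure.upvar M (\<lambda>A. - \<mu> A) A = \<mu> A"
proof -
  interpret neg: signed_measure M "\<lambda>A. - \<mu> A" by (rule signed_measure_uminus)
  have 1: "upvar A \<le> \<mu> A + neg.upvar A"
  proof (rule upvar_least)
    fix B assume B: "B \<in> sets M" "B \<subseteq> A"
    show "\<mu> B \<le> \<mu> A + neg.upvar A"
      using neg.upvar_upper[of "A - B" A] diff[OF assms B] assms B by simp
  qed
  have 2: "neg.upvar A \<le> upvar A - \<mu> A"
  proof (rule neg.upvar_least)
    fix B assume B: "B \<in> sets M" "B \<subseteq> A"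
    show "- \<mu> B \<le> upvar A - \<mu> A"
      using upvar_upper[of "A - B" A] diff[OF assms B] assms B by simp
  qed
  show ?thesis using 1 2 by simp
qed

end

lemma jordan_decomposition:
  assumes "finite_signed_measure M \<mu>"
  shows "finite_measure (upper_variation M \<mu>)" "finite_measure (lower_variation M \<mu>)"
    "sets (upper_variation M \<mu>) = sets M" "sets (lower_variation M \<mu>) = sets M"
    "A \<in> sets M \<Longrightarrow> measure (upper_variation M \<mu>) A - measure (lower_variation M \<mu>) A = \<mu> A"
proof -
  interpret signed_measure M \<mu> by standard fact
  interpret neg: signed_measure M "\<lambda>A. - \<mu> A" by (rule signed_measure_uminus)
  show "finite_measure (upper_variation M \<mu>)" "finite_measure (lower_variation M \<mu>)"
    "sets (upper_variation M \<mu>) = sets M" "sets (lower_variation M \<mu>) = sets M"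
    by (simp_all add: lower_variation_def finite_measure_upper_variation neg.finite_measure_upper_variation)
  show "measure (upper_variation M \<mu>) A - measure (lower_variation M \<mu>) A = \<mu> A" if "A \<in> sets M"
    using upvar_minus[OF that] that
    by (simp add: measure_def lower_variation_def emeasure_upper_variation
        neg.emeasure_upper_variation upvar_nonneg neg.upvar_nonneg)
qed

section \<open>Causal functions and their convolution\<close>

text \<open>
  Local boundedness is built in: every convolution of two such functions is then an integral of a
  bounded function over a compact interval, and Fubini's theorem applies without further checks.
\<close>

definition causal :: "(real \<Rightarrow> real) \<Rightarrow> bool" where
  "causal a \<longleftrightarrow> a \<in> borel_measurable borel \<and> (\<forall>t<0. a t = 0) \<and> (\<forall>T. \<exists>B. \<forall>t\<le>T. \<bar>a t\<bar> \<le> B)"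

definition conv :: "(real \<Rightarrow> real) \<Rightarrow> (real \<Rightarrow> real) \<Rightarrow> real \<Rightarrow> real" where
  "conv a b t = (LINT s|lborel. a (t - s) * b s)"

text \<open>
  The Heaviside step: convolution with it is integration from \<open>0\<close>.
\<close>

abbreviation one :: "real \<Rightarrow> real" where
  "one \<equiv> indicator {0..}"

lemma causal_measurable: "causal a \<Longrightarrow> a \<in> borel_measurable borel"
  by (simp add: causal_def)

lemma causal_neg: "causal a \<Longrightarrow> t < 0 \<Longrightarrow> a t = 0"
  by (simp add: causal_def)

lemma causal_bound:
  assumes "causal a"
  shows "\<exists>B\<ge>0. \<forall>t\<le>T. \<bar>a t\<bar> \<le> B"
proof -
  obtain B where B: "\<forall>t\<le>T. \<bar>a t\<bar> \<le> B" using assms unfolding causal_def by blast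
  then have "B \<ge> 0" using abs_ge_zero[of "a T"] by force
  with B show ?thesis by blast
qed

lemma causal_one: "causal one"
  by (auto simp: causal_def indicator_def intro!: exI[of _ 1])

lemma causal_add: "causal a \<Longrightarrow> causal b \<Longrightarrow> causal (\<lambda>t. a t + b t)"
  unfolding causal_def
proof (intro conjI allI impI; (elim conjE)?)
  fix T
  assume "\<forall>T. \<exists>B. \<forall>t\<le>T. \<bar>a t\<bar> \<le> B" "\<forall>T. \<exists>B. \<forall>t\<le>T. \<bar>b t\<bar> \<le> B"
  then obtain A B where "\<forall>t\<le>T. \<bar>a t\<bar> \<le> A" "\<forall>t\<le>T. \<bar>b t\<bar> \<le> B" by blast
  then show "\<exists>B. \<forall>t\<le>T. \<bar>a t + b t\<bar> \<le> B" by (intro exI[of _ "A + B"]) (smt (verit))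
qed auto

lemma causal_cmult: "causal a \<Longrightarrow> causal (\<lambda>t. c * a t)"
  unfolding causal_def
proof (intro conjI allI impI; (elim conjE)?)
  fix T
  assume "\<forall>T. \<exists>B. \<forall>t\<le>T. \<bar>a t\<bar> \<le> B"
  then obtain A where "\<forall>t\<le>T. \<bar>a t\<bar> \<le> A" by blast
  then show "\<exists>B. \<forall>t\<le>T. \<bar>c * a t\<bar> \<le> B"
    by (intro exI[of _ "\<bar>c\<bar> * A"]) (auto simp: abs_mult intro: mult_left_mono)
qed auto

lemma causal_diff: "causal a \<Longrightarrow> causal b \<Longrightarrow> causal (\<lambda>t. a t - b t)"
  using causal_add[of a "\<lambda>t. (-1) * b t"] causal_cmult[of b "-1"] by simp

lemma conv_integrand_bound:
  assumes "causal a" "causal b"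
  shows "\<exists>C\<ge>0. \<forall>t\<le>T. \<forall>s. \<bar>a (t - s) * b s\<bar> \<le> C * indicator {0..t} s"
proof -
  obtain A where A: "A \<ge> 0" "\<And>t. t \<le> T \<Longrightarrow> \<bar>a t\<bar> \<le> A" using causal_bound[OF assms(1)] by blast
  obtain B where B: "B \<ge> 0" "\<And>t. t \<le> T \<Longrightarrow> \<bar>b t\<bar> \<le> B" using causal_bound[OF assms(2)] by blast
  show ?thesis
  proof (intro exI[of _ "A * B"] conjI allI impI)
    show "\<bar>a (t - s) * b s\<bar> \<le> A * B * indicator {0..t} s" if "t \<le> T" for t s
    proof (cases "s \<in> {0..t}")
      case True
      then show ?thesis using A(2)[of "t - s"] B(2)[of s] that A(1)
        by (auto simp: abs_mult intro!: mult_mono)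
    next
      case False
      then have "a (t - s) = 0 \<or> b s = 0"
        using causal_neg[OF assms(1), of "t - s"] causal_neg[OF assms(2), of s] by auto
      then show ?thesis using A B by (auto simp: indicator_def)
    qed
  qed (use A B in simp)
qed

lemma integrable_indicator_Icc: "integrable lborel (\<lambda>s::real. C * indicator {a..b} s :: real)"
  by (intro integrable_mult_right integrable_real_indicator) (auto simp: emeasure_lborel_Icc_eq)

lemma integral_indicator_Icc: "a \<le> b \<Longrightarrow> (LINT s|lborel. C * indicator {a..b} s) = C * (b - a :: real)"
  by simp

lemma conv_integrable:
  assumes "causal a" "causal b"
  shows "integrable lborel (\<lambda>s. a (t - s) * b s)"
proof -
  note [measurable] = assms[THEN causal_measurable]
  obtain C where C: "C \<ge> 0" "\<And>r s. r \<le> t \<Longrightarrow> \<bar>a (r - s) * b s\<bar> \<le> C * indicator {0..r} s"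
    using conv_integrand_bound[OF assms, of t] by blast
  show ?thesis
    by (rule Bochner_Integration.integrable_bound[OF integrable_indicator_Icc[of C 0 t]])
      (use C in \<open>auto simp del: abs_mult\<close>)
qed

lemma conv_commute: "conv a b = conv b a"
proof
  fix t
  show "conv a b t = conv b a t"
    using lborel_integral_real_affine[of "-1" "\<lambda>s. a (t - s) * b s" t]
    by (simp add: conv_def mult.commute)
qed

lemma causal_conv:
  assumes "causal a" "causal b"
  shows "causal (conv a b)"
  unfolding causal_def
proof (intro conjI allI impI)
  note [measurable] = assms[THEN causal_measurable]
  show "conv a b \<in> borel_measurable borel"
    unfolding conv_def by measurable
  show "conv a b t = 0" if "t < 0" for t
  proof -
    have "a (t - s) * b s = 0" for s
      using causal_neg[OF assms(1), of "t - s"] causal_neg[OF assms(2), of s] that by (cases "s < 0") auto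
    then have "(\<lambda>s. a (t - s) * b s) = (\<lambda>s. 0)" by blast
    then have "conv a b t = (LINT s|lborel. 0)"
      unfolding conv_def by simp
    then show ?thesis by simp
  qed
  fix T
  obtain C where C: "C \<ge> 0" "\<And>t s. t \<le> T \<Longrightarrow> \<bar>a (t - s) * b s\<bar> \<le> C * indicator {0..t} s"
    using conv_integrand_bound[OF assms, of T] by blast
  show "\<exists>B. \<forall>t\<le>T. \<bar>conv a b t\<bar> \<le> B"
  proof (intro exI allI impI)
    fix t assume t: "t \<le> T"
    have "\<bar>conv a b t\<bar> \<le> (LINT s|lborel. C * indicator {0..\<bar>T\<bar>} s)"
      unfolding conv_def
    proof (rule order_trans[OF integral_abs_bound], rule integral_mono[OF integrable_abs[OF conv_integrable[OF assms]] integrable_indicator_Icc])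
      show "\<bar>a (t - s) * b s\<bar> \<le> C * indicator {0..\<bar>T\<bar>} s" for s
      proof (rule order_trans[OF C(2)[OF t]], rule mult_left_mono[OF _ C(1)])
        show "indicator {0..t} s \<le> (indicator {0..\<bar>T\<bar>} s :: real)"
          using t by (auto simp: indicator_def)
      qed
    qed
    also have "\<dots> = C * \<bar>T\<bar>" by (simp add: integral_indicator_Icc)
    finally show "\<bar>conv a b t\<bar> \<le> C * \<bar>T\<bar>" .
  qed
qed

lemma conv_assoc:
  assumes a: "causal a" and b: "causal b" and c: "causal c"
  shows "conv (conv a b) c = conv a (conv b c)"
proof
  fix t
  note [measurable] = a[THEN causal_measurable] b[THEN causal_measurable] c[THEN causal_measurable]
  obtain A where A: "A \<ge> 0" "\<And>s. s \<le> t \<Longrightarrow> \<bar>a s\<bar> \<le> A" using causal_bound[OF a] by blast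
  obtain B where B: "B \<ge> 0" "\<And>s. s \<le> t \<Longrightarrow> \<bar>b s\<bar> \<le> B" using causal_bound[OF b] by blast
  obtain C where C: "C \<ge> 0" "\<And>s. s \<le> t \<Longrightarrow> \<bar>c s\<bar> \<le> C" using causal_bound[OF c] by blast
  have int: "integrable (lborel \<Otimes>\<^sub>M lborel) (\<lambda>(v, s). a (t - v) * b (v - s) * c s)"
  proof (rule Bochner_Integration.integrable_bound)
    show "integrable (lborel \<Otimes>\<^sub>M lborel) (\<lambda>p. A * B * C * indicator ({0..t} \<times> {0..t}) p :: real)"
      by (intro integrable_mult_right integrable_real_indicator)
        (auto simp: lborel.emeasure_pair_measure_Times emeasure_lborel_Icc_eq ennreal_mult_less_top)
    show "AE p in lborel \<Otimes>\<^sub>M lborel. norm (case p of (v, s) \<Rightarrow> a (t - v) * b (v - s) * c s)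
        \<le> norm (A * B * C * indicator ({0..t} \<times> {0..t}) p :: real)"
    proof (rule AE_I2, clarify)
      fix v s :: real
      show "norm (a (t - v) * b (v - s) * c s) \<le> norm (A * B * C * indicator ({0..t} \<times> {0..t}) (v, s) :: real)"
      proof (cases "s \<ge> 0 \<and> v \<ge> s \<and> v \<le> t")
        case True
        then have "\<bar>a (t - v)\<bar> * \<bar>b (v - s)\<bar> * \<bar>c s\<bar> \<le> A * B * C"
          using A B C by (intro mult_mono mult_nonneg_nonneg) auto
        then show ?thesis using True A B C by (simp add: abs_mult)
      next
        case False
        then have "a (t - v) = 0 \<or> b (v - s) = 0 \<or> c s = 0"
          using causal_neg[OF a, of "t - v"] causal_neg[OF b, of "v - s"] causal_neg[OF c, of s] by force
        then show ?thesis by auto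
      qed
    qed
  qed (measurable)
  have "conv (conv a b) c t = (LINT s|lborel. (LINT v|lborel. a (t - v) * b (v - s) * c s))"
    unfolding conv_def
  proof (rule Bochner_Integration.integral_cong[OF refl])
    fix s
    have "(LINT v|lborel. a (t - s - v) * b v) = (LINT v|lborel. a (t - v) * b (v - s))"
      using lborel_integral_real_affine[of 1 "\<lambda>v. a (t - s - v) * b v" "- s"]
      by (simp add: algebra_simps)
    then show "(LINT v|lborel. a (t - s - v) * b v) * c s = (LINT v|lborel. a (t - v) * b (v - s) * c s)"
      by simp
  qed
  also have "\<dots> = (LINT v|lborel. (LINT s|lborel. a (t - v) * b (v - s) * c s))"
    by (rule lborel_pair.Fubini_integral[OF int])
  also have "\<dots> = conv a (conv b c) t"
    unfolding conv_def by (simp add: mult.assoc)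
  finally show "conv (conv a b) c t = conv a (conv b c) t" .
qed

lemma conv_add_left:
  assumes "causal a" "causal b" "causal c"
  shows "conv (\<lambda>t. a t + b t) c = (\<lambda>t. conv a c t + conv b c t)"
  unfolding conv_def using conv_integrable[OF assms(1,3)] conv_integrable[OF assms(2,3)]
  by (auto simp: distrib_right)

lemma conv_diff_left:
  assumes "causal a" "causal b" "causal c"
  shows "conv (\<lambda>t. a t - b t) c = (\<lambda>t. conv a c t - conv b c t)"
  unfolding conv_def using conv_integrable[OF assms(1,3)] conv_integrable[OF assms(2,3)]
  by (auto simp: left_diff_distrib)

lemma conv_add_right:
  assumes "causal a" "causal b" "causal c"
  shows "conv c (\<lambda>t. a t + b t) = (\<lambda>t. conv c a t + conv c b t)"
  using conv_add_left[OF assms] by (simp add: conv_commute[of c])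

lemma conv_diff_right:
  assumes "causal a" "causal b" "causal c"
  shows "conv c (\<lambda>t. a t - b t) = (\<lambda>t. conv c a t - conv c b t)"
  using conv_diff_left[OF assms] by (simp add: conv_commute[of c])

lemma conv_cmult_right: "conv c (\<lambda>t. k * a t) = (\<lambda>t. k * conv c a t)"
  unfolding conv_def by (simp add: mult.left_commute)

lemma conv_one_eq_LINT:
  assumes "causal a"
  shows "conv one a t = (LINT s:{0..t}|lborel. a s)"
  unfolding conv_def set_lebesgue_integral_def
  by (rule Bochner_Integration.integral_cong) (use causal_neg[OF assms] in \<open>auto simp: indicator_def\<close>)

lemma causal_set_integrable:
  assumes "causal a"
  shows "set_integrable lborel {p..q} a"
proof -
  note [measurable] = assms[THEN causal_measurable]
  obtain B where B: "B \<ge> 0" "\<And>s. s \<le> q \<Longrightarrow> \<bar>a s\<bar> \<le> B" using causal_bound[OF assms] by blast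
  show ?thesis
    unfolding set_integrable_def
    by (rule Bochner_Integration.integrable_bound[OF integrable_indicator_Icc[of B p q]])
      (use B in \<open>auto simp: indicator_def\<close>)
qed

lemma causal_absolutely_integrable:
  assumes "causal a"
  shows "a absolutely_integrable_on {p..q}"
  using causal_set_integrable[OF assms, of p q] causal_measurable[OF assms]
  unfolding set_integrable_def by (subst integrable_completion) auto

lemma causal_integrable_on: "causal a \<Longrightarrow> a integrable_on {p..q}"
  using causal_absolutely_integrable set_lebesgue_integral_eq_integral(1) by blast

lemma conv_one_eq_integral:
  assumes "causal a"
  shows "conv one a t = integral {0..t} a"
  using set_borel_integral_eq_integral(2)[OF causal_set_integrable[OF assms]] 
  by (simp add: conv_one_eq_LINT[OF assms])

lemma integral_causal_diff:
  assumes "causal a" "0 \<le> p" "p \<le> q"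
  shows "conv one a q - conv one a p = integral {p..q} a"
  using Henstock_Kurzweil_Integration.integral_combine[OF assms(2,3) causal_integrable_on[OF assms(1)]]
  by (simp add: conv_one_eq_integral[OF assms(1)])

section \<open>Shifted integrals against a finite measure\<close>

text \<open>
  Either of the two parts of the Jordan decomposition of \<open>\<mu>\<close>.
\<close>

locale delay_measure = finite_measure \<nu> for \<nu> :: "real measure" +
  fixes \<tau> :: real
  assumes tau_pos: "\<tau> > 0" and sets_nu: "sets \<nu> = sets (borel_Icc (-\<tau>) 0)"
begin

lemma space_nu: "space \<nu> = {-\<tau>..0}"
  using sets_eq_imp_space_eq[OF sets_nu] by (simp add: space_restrict_space)

lemma measurable_nu: "f \<in> borel_measurable borel \<Longrightarrow> f \<in> borel_measurable \<nu>"
  using measurable_cong_sets[OF sets_nu refl] measurable_restrict_space1 by blast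

lemma id_measurable_nu: "(\<lambda>x. x) \<in> \<nu> \<rightarrow>\<^sub>M borel"
  by (rule measurable_nu) simp

lemma integrable_bounded:
  fixes y :: "real \<Rightarrow> real"
  assumes "y \<in> borel_measurable borel" "\<And>u. u \<in> {-\<tau>..0} \<Longrightarrow> \<bar>y u\<bar> \<le> B"
  shows "integrable \<nu> y"
  by (rule integrable_const_bound[of _ B]) (use assms in \<open>auto simp: space_nu intro: measurable_nu\<close>)

lemma integral_bounded:
  fixes y :: "real \<Rightarrow> real"
  assumes "y \<in> borel_measurable borel" "\<And>u. u \<in> {-\<tau>..0} \<Longrightarrow> \<bar>y u\<bar> \<le> B"
  shows "\<bar>LINT u|\<nu>. y u\<bar> \<le> measure \<nu> {-\<tau>..0} * B"
proof -
  have "\<bar>LINT u|\<nu>. y u\<bar> \<le> (LINT u|\<nu>. \<bar>y u\<bar>)" by (rule integral_abs_bound)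
  also have "\<dots> \<le> (LINT u|\<nu>. B)"
    using assms by (intro integral_mono integrable_abs integrable_bounded[OF assms]) (auto simp: space_nu)
  also have "\<dots> = measure \<nu> {-\<tau>..0} * B" by (simp add: space_nu)
  finally show ?thesis .
qed

lemma integrable_shift:
  assumes "causal y"
  shows "integrable \<nu> (\<lambda>u. y (t + u))"
proof -
  note [measurable] = id_measurable_nu assms[THEN causal_measurable]
  obtain B where B: "B \<ge> 0" "\<And>s. s \<le> t \<Longrightarrow> \<bar>y s\<bar> \<le> B" using causal_bound[OF assms] by blast
  show ?thesis by (rule integrable_bounded[of _ B]) (use B in auto)
qed

lemma causal_shift_integral:
  assumes "causal y"
  shows "causal (\<lambda>t. LINT u|\<nu>. y (t + u))"
  unfolding causal_def
proof (intro conjI allI impI)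
  note [measurable] = id_measurable_nu assms[THEN causal_measurable]
  show "(\<lambda>t. LINT u|\<nu>. y (t + u)) \<in> borel_measurable borel"
    by measurable
  show "(LINT u|\<nu>. y (t + u)) = 0" if "t < 0" for t
  proof -
    have "(LINT u|\<nu>. y (t + u)) = (LINT u|\<nu>. 0)"
      by (rule Bochner_Integration.integral_cong) (use that causal_neg[OF assms] in \<open>auto simp: space_nu\<close>)
    then show ?thesis by simp
  qed
  fix T
  obtain B where B: "B \<ge> 0" "\<And>s. s \<le> T \<Longrightarrow> \<bar>y s\<bar> \<le> B" using causal_bound[OF assms] by blast
  have "\<bar>LINT u|\<nu>. y (t + u)\<bar> \<le> measure \<nu> {-\<tau>..0} * B" if "t \<le> T" for t
    by (rule integral_bounded) (use that B in auto)
  then show "\<exists>B. \<forall>t\<le>T. \<bar>LINT u|\<nu>. y (t + u)\<bar> \<le> B" by blast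
qed

text \<open>
  Integrating translates commutes with convolution, since convolution commutes with translations;
  this is the only use of Fubini's theorem for the delay.
\<close>

lemma shift_integral_conv:
  assumes a: "causal a" and b: "causal b"
  shows "(LINT u|\<nu>. conv a b (t + u)) = conv (\<lambda>t. LINT u|\<nu>. a (t + u)) b t"
proof -
  note [measurable] = id_measurable_nu a[THEN causal_measurable] b[THEN causal_measurable]
  interpret P: pair_sigma_finite \<nu> lborel by unfold_locales
  obtain C where C: "C \<ge> 0" "\<And>r s. r \<le> t \<Longrightarrow> \<bar>a (r - s) * b s\<bar> \<le> C * indicator {0..r} s"
    using conv_integrand_bound[OF assms, of t] by blast
  have int: "integrable (\<nu> \<Otimes>\<^sub>M lborel) (\<lambda>(u, s). a (t + u - s) * b s)"
  proof (rule Bochner_Integration.integrable_bound)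
    show "integrable (\<nu> \<Otimes>\<^sub>M lborel) (\<lambda>p. C * indicator ({-\<tau>..0} \<times> {0..t}) p :: real)"
    proof (intro integrable_mult_right integrable_real_indicator)
      show "{-\<tau>..0} \<times> {0..t} \<in> sets (\<nu> \<Otimes>\<^sub>M lborel)"
        using sets.top[of \<nu>] by (simp add: space_nu)
      show "emeasure (\<nu> \<Otimes>\<^sub>M lborel) ({-\<tau>..0} \<times> {0..t}) < \<infinity>"
        using sets.top[of \<nu>] emeasure_finite[of "{-\<tau>..0}"]
        by (simp add: lborel.emeasure_pair_measure_Times space_nu emeasure_lborel_Icc_eq ennreal_mult_less_top
            emeasure_eq_measure)
    qed
    show "AE p in \<nu> \<Otimes>\<^sub>M lborel. norm (case p of (u, s) \<Rightarrow> a (t + u - s) * b s)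
        \<le> norm (C * indicator ({-\<tau>..0} \<times> {0..t}) p :: real)"
    proof (rule AE_I2, clarify)
      fix u s :: real assume "(u, s) \<in> space (\<nu> \<Otimes>\<^sub>M lborel)"
      then have "u \<in> {-\<tau>..0}" by (simp add: space_pair_measure space_nu)
      then have "C * indicator {0..t + u} s \<le> C * indicator ({-\<tau>..0} \<times> {0..t}) (u, s)"
        using C(1) by (intro mult_left_mono) (auto simp: indicator_def)
      moreover have "\<bar>a (t + u - s) * b s\<bar> \<le> C * indicator {0..t + u} s"
        using \<open>u \<in> {-\<tau>..0}\<close> by (intro C(2)) simp
      ultimately show "norm (a (t + u - s) * b s) \<le> norm (C * indicator ({-\<tau>..0} \<times> {0..t}) (u, s) :: real)"
        unfolding real_norm_def by linarith
    qed
  qed measurable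
  have "(LINT u|\<nu>. conv a b (t + u)) = (LINT u|\<nu>. (LINT s|lborel. a (t + u - s) * b s))"
    by (simp add: conv_def)
  also have "\<dots> = (LINT s|lborel. (LINT u|\<nu>. a (t + u - s) * b s))"
    by (rule P.Fubini_integral[OF int, symmetric])
  also have "\<dots> = conv (\<lambda>t. LINT u|\<nu>. a (t + u)) b t"
    by (simp add: conv_def algebra_simps)
  finally show ?thesis .
qed

end

section \<open>The integrated form of a differential equation\<close>

lemma L1_loc_iff: "g \<in> L1_loc \<longleftrightarrow> (\<forall>T\<ge>0. g absolutely_integrable_on {0..T})"
proof
  assume "g \<in> L1_loc"
  then show "\<forall>T\<ge>0. g absolutely_integrable_on {0..T}"
    unfolding L1_loc_def by auto
next
  assume g: "\<forall>T\<ge>0. g absolutely_integrable_on {0..T}"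
  show "g \<in> L1_loc"
    unfolding L1_loc_def
  proof (intro CollectI allI impI, elim conjE)
    fix K :: "real set" assume K: "compact K" "K \<subseteq> {0..}"
    then obtain B where B: "\<And>x. x \<in> K \<Longrightarrow> norm x \<le> B"
      using compact_imp_bounded bounded_iff by metis
    then have "K \<subseteq> {0..\<bar>B\<bar>}" using K by fastforce
    moreover have "g absolutely_integrable_on {0..\<bar>B\<bar>}" using g by simp
    moreover have "K \<in> sets lebesgue" using K(1) by (simp add: compact_imp_closed)
    ultimately show "g absolutely_integrable_on K"
      using set_integrable_subset by blast
  qed
qed

lemma L1_loc_integrable: "g \<in> L1_loc \<Longrightarrow> 0 \<le> a \<Longrightarrow> g integrable_on {a..b}"
proof -
  assume g: "g \<in> L1_loc" and a: "0 \<le> a"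
  have "g absolutely_integrable_on {a..b}"
    using g a unfolding L1_loc_def by auto
  then show ?thesis by (rule set_lebesgue_integral_eq_integral(1))
qed

lemma absolutely_continuous_on_imp_continuous_on:
  fixes g :: "real \<Rightarrow> real"
  assumes "absolutely_continuous_on {a..b} g"
  shows "continuous_on {a..b} g"
  unfolding continuous_on_iff
proof (intro ballI allI impI)
  fix s e :: real assume s: "s \<in> {a..b}" and e: "e > 0"
  obtain \<delta> where \<delta>ac: "\<delta> > 0 \<and> (\<forall>D. D division_of \<Union>D \<and> \<Union>D \<subseteq> {a..b} \<and> (\<Sum>K\<in>D. Sup K - Inf K) < \<delta>
              \<longrightarrow> (\<Sum>K\<in>D. \<bar>g (Sup K) - g (Inf K)\<bar>) < e)"
    using assms[unfolded absolutely_continuous_on_def, THEN spec, THEN mp, OF e] ..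
  note \<delta> = \<delta>ac[THEN conjunct1] and ac = \<delta>ac[THEN conjunct2, THEN spec, THEN mp]
  show "\<exists>d>0. \<forall>t\<in>{a..b}. dist t s < d \<longrightarrow> dist (g t) (g s) < e"
  proof (intro exI[of _ \<delta>] conjI \<delta> ballI impI)
    fix t assume t: "t \<in> {a..b}" "dist t s < \<delta>"
    let ?D = "{{min s t..max s t}}"
    have le: "min s t \<le> max s t" by simp
    have U: "\<Union>?D = {min s t..max s t}" by blast
    have "cbox (min s t) (max s t) \<noteq> {}" using le by (simp only: box_real atLeastAtMost_iff) auto
    then have "{cbox (min s t) (max s t)} division_of cbox (min s t) (max s t)"
      by (rule division_of_self)
    then have "?D division_of \<Union>?D"
      by (simp only: U box_real)
    moreover have "\<Union>?D \<subseteq> {a..b}"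
      using s t(1) by (simp add: min_def max_def)
    moreover have "(\<Sum>K\<in>?D. Sup K - Inf K) < \<delta>"
      using t(2) by (auto simp add: dist_real_def min_def max_def)
    ultimately have "(\<Sum>K\<in>?D. \<bar>g (Sup K) - g (Inf K)\<bar>) < e"
      using ac by blast
    then show "dist (g t) (g s) < e"
      by (auto simp: dist_real_def min_def max_def abs_minus_commute split: if_splits)
  qed
qed

lemma causal_continuousI:
  assumes "\<And>t. t < 0 \<Longrightarrow> a t = 0" and cont: "continuous_on {0..} a"
  shows "causal a"
  unfolding causal_def
proof (intro conjI allI impI)
  have "(\<lambda>t. indicator {0..} t *\<^sub>R a t) \<in> borel_measurable borel"
    by (rule borel_measurable_continuous_on_indicator[OF _ cont]) simp
  moreover have "(\<lambda>t. indicator {0..} t *\<^sub>R a t) = a"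
    using assms(1) by (force simp: indicator_def fun_eq_iff)
  ultimately show "a \<in> borel_measurable borel" by simp
  fix T
  have "bounded (a ` {0..T})"
    using cont by (intro compact_imp_bounded compact_continuous_image continuous_on_subset[OF cont]) auto
  then obtain B where B: "\<And>t. t \<in> {0..T} \<Longrightarrow> \<bar>a t\<bar> \<le> B"
    unfolding bounded_iff real_norm_def by blast
  have "\<bar>a t\<bar> \<le> \<bar>B\<bar>" if "t \<le> T" for t
    using B[of t] assms(1)[of t] that by (cases "t < 0") auto
  then show "\<exists>B. \<forall>t\<le>T. \<bar>a t\<bar> \<le> B" by blast
qed (use assms in auto)

text \<open>
  This replaces the differential equation by an equation between functions, without derivatives.
\<close>

lemma locally_absolutely_continuous_iff_integral:
  assumes g: "g \<in> L1_loc"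
  shows "locally_absolutely_continuous x \<and> (AE t in lebesgue. t > 0 \<longrightarrow> (x has_real_derivative g t) (at t))
    \<longleftrightarrow> (\<forall>t\<ge>0. x t = x 0 + integral {0..t} g)"
proof (intro iffI conjI allI impI; (elim conjE)?)
  fix t :: real
  assume ac: "locally_absolutely_continuous x" and t: "0 \<le> t"
    and der: "AE t in lebesgue. t > 0 \<longrightarrow> (x has_real_derivative g t) (at t)"
  from der obtain N where "N \<in> null_sets lebesgue"
    and Nsub: "{s \<in> space lebesgue. \<not> (s > 0 \<longrightarrow> (x has_real_derivative g s) (at s))} \<subseteq> N"
    unfolding eventually_ae_filter by blast
  then have N1: "negligible N" by (simp add: negligible_iff_null_sets)
  have N2: "(x has_real_derivative g s) (at s)" if "s \<notin> N" "s > 0" for s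
  proof -
    have "s \<notin> {s \<in> space lebesgue. \<not> (s > 0 \<longrightarrow> (x has_real_derivative g s) (at s))}"
      using that(1) Nsub by (rule contra_subsetD[rotated])
    then show ?thesis using that(2) by simp
  qed
  show "x t = x 0 + integral {0..t} g"
  proof (cases "t = 0")
    case False
    then have "absolutely_continuous_on {0..t} x"
      using ac t unfolding locally_absolutely_continuous_def by simp
    moreover have "negligible (insert 0 N)" using N1 by simp
    ultimately have "(g has_integral (x t - x 0)) {0..t}"
    proof (rule absolutely_continuous_on_has_integral[OF t])
      show "(x has_real_derivative g s) (at s within {0..t})" if "s \<in> {0..t} - insert 0 N" for s
        using that by (intro has_field_derivative_at_within[OF N2]) auto
    qed
    then show ?thesis by (simp add: integral_unique)
  qed simp
next
  assume x: "\<forall>t\<ge>0. x t = x 0 + integral {0..t} g"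
  show "locally_absolutely_continuous x"
    unfolding locally_absolutely_continuous_def
  proof (intro allI impI)
    fix T :: real assume "T > 0"
    show "absolutely_continuous_on {0..T} x"
    proof (rule absolutely_continuous_on_indefinite_integral)
      show "g absolutely_integrable_on {0..T}"
        using g \<open>T > 0\<close> by (simp add: L1_loc_iff)
      show "x t = x 0 + integral {0..t} g" if "t \<in> {0..T}" for t
        using that by (intro x[rule_format]) simp
    qed
  qed
  define g0 where "g0 = (\<lambda>t. if t \<ge> 0 then g t else 0)"
  have "g0 integrable_on {a..b}" for a b
  proof -
    have "g integrable_on {max 0 a..b}" by (rule L1_loc_integrable[OF g]) simp
    then have "(\<lambda>t. if t \<in> {0..} then g t else 0) integrable_on {a..b}"
    proof (subst integrable_restrict_Int)
      have "{0..} \<inter> {a..b} = {max 0 a..b}" by auto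
      then show "g integrable_on {0..} \<inter> {a..b}" if "g integrable_on {max 0 a..b}"
        using that by simp
    qed
    then show ?thesis by (simp add: g0_def)
  qed
  then have "AE t in lebesgue. t > 0 \<longrightarrow> (x has_real_derivative g0 t) (at t)"
  proof (rule indefinite_integral_derivative_AE)
    fix t :: real assume "t > 0"
    have "integral {0..t} g = integral {0..t} g0" by (rule integral_cong) (simp add: g0_def)
    then show "x t = x 0 + integral {0..t} g0" using x[rule_format, of t] \<open>t > 0\<close> by linarith
  qed
  then show "AE t in lebesgue. t > 0 \<longrightarrow> (x has_real_derivative g t) (at t)"
    by eventually_elim (simp add: g0_def)
qed

lemma locally_absolutely_continuous_imp_continuous_on:
  assumes "locally_absolutely_continuous x"
  shows "continuous_on {0..} x"
proof -
  have "continuous_on ({0..} \<inter> {..<T}) x" if "T > 0" for T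
  proof (rule continuous_on_subset[OF absolutely_continuous_on_imp_continuous_on])
    show "absolutely_continuous_on {0..T} x"
      using assms that by (simp add: locally_absolutely_continuous_def)
  qed auto
  then have *: "\<forall>t\<in>{0..} \<inter> {..<T}. continuous (at t within {0..} \<inter> {..<T}) x" if "T > 0" for T
    using that by (simp add: continuous_on_eq_continuous_within)
  show ?thesis
    unfolding continuous_on_eq_continuous_within
  proof
    fix t :: real assume t: "t \<in> {0..}"
    have "continuous (at t within {0..} \<inter> {..<t + 1}) x"
      using *[of "t + 1"] t by auto
    moreover have "at t within {0..} \<inter> {..<t + 1} = at t within {0..}"
      by (rule at_within_nhd[of _ "{..<t + 1}"]) auto
    ultimately show "continuous (at t within {0..}) x" by simp
  qed
qed

lemma causal_L1_loc: "causal a \<Longrightarrow> a \<in> L1_loc"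
  by (simp add: L1_loc_iff causal_absolutely_integrable)

lemma causal_add_L1_loc:
  assumes "causal a" "f \<in> L1_loc"
  shows "(\<lambda>t. a t + f t) \<in> L1_loc"
  unfolding L1_loc_iff
proof (intro allI impI)
  show "(\<lambda>t. a t + f t) absolutely_integrable_on {0..T}" if "T \<ge> 0" for T
    by (rule set_integral_add(1)[OF causal_absolutely_integrable[OF assms(1)]])
      (use assms(2) that in \<open>simp add: L1_loc_iff\<close>)
qed

definition primitive :: "(real \<Rightarrow> real) \<Rightarrow> real \<Rightarrow> real" where
  "primitive f t = (if t \<ge> 0 then integral {0..t} f else 0)"

lemma primitive_continuous:
  assumes "f \<in> L1_loc"
  shows "continuous_on {0..} (primitive f)"
proof -
  have "\<forall>t\<ge>0. primitive f t = primitive f 0 + integral {0..t} f"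
    by (simp add: primitive_def)
  then show ?thesis
    using locally_absolutely_continuous_iff_integral[OF assms]
      locally_absolutely_continuous_imp_continuous_on by blast
qed

lemma primitive_causal: "causal y \<Longrightarrow> primitive y = conv one y"
  using causal_neg[OF causal_conv[OF causal_one]]
  by (auto simp: fun_eq_iff primitive_def conv_one_eq_integral)

lemma conv_one_continuous:
  assumes "causal a"
  shows "continuous_on UNIV (conv one a)"
proof -
  have "continuous_on UNIV (\<lambda>t. primitive a (max 0 t))"
    by (rule continuous_on_compose2[OF primitive_continuous[OF causal_L1_loc[OF assms]]])
      (auto intro!: continuous_intros)
  moreover have "primitive a (max 0 t) = conv one a t" for t
    using assms by (cases "t \<ge> 0")
      (auto simp: primitive_causal max_def conv_one_eq_integral causal_neg[OF causal_conv[OF causal_one]])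
  ultimately show ?thesis by simp
qed

lemma causal_primitive: "f \<in> L1_loc \<Longrightarrow> causal (primitive f)"
  by (rule causal_continuousI[OF _ primitive_continuous]) (auto simp: primitive_def)

section \<open>The delay operator\<close>

locale delay_equation =
  fixes \<tau> :: real and \<mu> :: "real set \<Rightarrow> real"
  assumes tau_pos: "\<tau> > 0" and fsm: "finite_signed_measure (borel_Icc (-\<tau>) 0) \<mu>"
begin

sublocale pos: delay_measure "upper_variation (borel_Icc (-\<tau>) 0) \<mu>" \<tau>
  using jordan_decomposition[OF fsm] tau_pos
  by (simp add: delay_measure_def delay_measure_axioms_def)

sublocale neg: delay_measure "lower_variation (borel_Icc (-\<tau>) 0) \<mu>" \<tau>
  using jordan_decomposition[OF fsm] tau_pos
  by (simp add: delay_measure_def delay_measure_axioms_def)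

abbreviation "D \<equiv> delay_term \<tau> \<mu>"
abbreviation "pos_part \<equiv> upper_variation (borel_Icc (-\<tau>) 0) \<mu>"
abbreviation "neg_part \<equiv> lower_variation (borel_Icc (-\<tau>) 0) \<mu>"

definition total_variation :: real where
  "total_variation = measure pos_part {-\<tau>..0}
     + measure neg_part {-\<tau>..0}"

lemma total_variation_nonneg: "total_variation \<ge> 0"
  by (simp add: total_variation_def)

lemma variation_mass_diff: "measure pos_part {-\<tau>..0}
     - measure neg_part {-\<tau>..0} = \<mu> {-\<tau>..0}"
proof (rule jordan_decomposition(5)[OF fsm])
  show "{- \<tau>..0} \<in> sets (borel_Icc (- \<tau>) 0)" 
    using sets.top[of "borel_Icc (- \<tau>) 0"] by (simp add: space_restrict_space)
qed

lemma D_eq: "D y t = (LINT u|pos_part. y (t + u))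
    - (LINT u|neg_part. y (t + u))"
  by (simp add: delay_term_def signed_integral_def)

lemma D_bound:
  assumes [measurable]: "y \<in> borel_measurable borel" and B: "\<And>u. u \<in> {-\<tau>..0} \<Longrightarrow> \<bar>y (t + u)\<bar> \<le> B"
  shows "\<bar>D y t\<bar> \<le> total_variation * B"
proof -
  have m: "(\<lambda>u. y (t + u)) \<in> borel_measurable borel" by measurable
  show ?thesis
    using pos.integral_bounded[OF m B] neg.integral_bounded[OF m B]
    unfolding D_eq total_variation_def distrib_right by linarith
qed

lemma causal_D: "causal y \<Longrightarrow> causal (D y)"
  using causal_diff[OF pos.causal_shift_integral neg.causal_shift_integral] by (simp add: D_eq[abs_def])

text \<open>
  The algebra of the resolvent rests on this identity and on associativity of convolution.
\<close>

lemma D_conv: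
  assumes "causal a" "causal b"
  shows "D (conv a b) = conv (D a) b"
  using conv_diff_left[OF pos.causal_shift_integral[OF assms(1)] neg.causal_shift_integral[OF assms(1)] assms(2)]
  by (simp add: D_eq[abs_def] pos.shift_integral_conv[OF assms] neg.shift_integral_conv[OF assms])

lemma D_diff:
  assumes "causal a" "causal b"
  shows "D (\<lambda>t. a t - b t) = (\<lambda>t. D a t - D b t)"
  using pos.integrable_shift[OF assms(1)] pos.integrable_shift[OF assms(2)]
    neg.integrable_shift[OF assms(1)] neg.integrable_shift[OF assms(2)]
  by (auto simp: D_eq)

lemma D_add:
  assumes "causal a" "causal b"
  shows "D (\<lambda>t. a t + b t) = (\<lambda>t. D a t + D b t)"
  using pos.integrable_shift[OF assms(1)] pos.integrable_shift[OF assms(2)]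
    neg.integrable_shift[OF assms(1)] neg.integrable_shift[OF assms(2)]
  by (auto simp: D_eq)

lemma conv_one_D: "causal y \<Longrightarrow> conv one (D y) = D (conv one y)"
  using D_conv[of y one] by (simp add: causal_one conv_commute[of one])

section \<open>Volterra equations and the resolvent\<close>

text \<open>
  The exponential rate at which \<open>1 * D\<close> becomes a contraction with constant \<open>1/2\<close> in the weighted
  supremum norm.
\<close>

definition growth :: real where "growth = 2 * total_variation + 1"

lemma growth_pos: "growth > 0"
  using total_variation_nonneg by (simp add: growth_def)

text \<open>
  Integrating \<open>exp (growth * s)\<close> gains the factor \<open>1 / growth\<close>, which outweighs the norm of \<open>D\<close>; and \<open>D\<close>
  looks only into the past, where the weight is smaller.
\<close>

lemma picard_halving:
  assumes y: "causal y" and bound: "\<And>t. t \<le> T \<Longrightarrow> \<bar>y t\<bar> \<le> c * exp (growth * t)" and "t \<le> T"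
  shows "\<bar>conv one (D y) t\<bar> \<le> c / 2 * exp (growth * t)"
proof -
  have "0 \<le> c * exp (growth * T)" using bound[of T] by (meson abs_ge_zero order_refl order_trans)
  then have c: "c \<ge> 0" by (simp add: zero_le_mult_iff)
  show ?thesis
  proof (cases "t \<ge> 0")
    case False
    then show ?thesis using causal_neg[OF causal_conv[OF causal_one causal_D[OF y]]] c by simp
  next
    case True
    have Dy: "\<bar>D y s\<bar> \<le> total_variation * c * exp (growth * s)" if "s \<in> {0..t}" for s
    proof -
      have "\<bar>y (s + u)\<bar> \<le> c * exp (growth * s)" if "u \<in> {-\<tau>..0}" for u
      proof -
        have "\<bar>y (s + u)\<bar> \<le> c * exp (growth * (s + u))"
          using that \<open>s \<in> {0..t}\<close> \<open>t \<le> T\<close> by (intro bound) auto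
        also have "\<dots> \<le> c * exp (growth * s)"
          using that c growth_pos by (intro mult_left_mono) auto
        finally show ?thesis .
      qed
      from D_bound[OF causal_measurable[OF y] this] show ?thesis by (simp add: mult.assoc)
    qed
    have hi: "((\<lambda>s. total_variation * c * exp (growth * s)) has_integral
        (total_variation * c / growth * exp (growth * t) - total_variation * c / growth * exp (growth * 0))) {0..t}"
      using True growth_pos
      by (intro fundamental_theorem_of_calculus)
        (auto intro!: derivative_eq_intros simp flip: has_real_derivative_iff_has_vector_derivative)
    have "\<bar>conv one (D y) t\<bar> \<le> integral {0..t} (\<lambda>s. total_variation * c * exp (growth * s))"
      unfolding conv_one_eq_integral[OF causal_D[OF y]] real_norm_def[symmetric]
      by (rule integral_norm_bound_integral)
        (use Dy hi causal_integrable_on[OF causal_D[OF y]] in \<open>auto simp: has_integral_integrable\<close>)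
    also have "\<dots> \<le> total_variation * c / growth * exp (growth * t)"
      using integral_unique[OF hi] c total_variation_nonneg growth_pos by simp
    also have "\<dots> \<le> c / 2 * exp (growth * t)"
    proof (rule mult_right_mono)
      have "total_variation * c * 2 \<le> growth * c"
        using c by (simp add: growth_def algebra_simps)
      then show "total_variation * c / growth \<le> c / 2" using growth_pos by (simp add: field_simps)
    qed simp
    finally show ?thesis .
  qed
qed

text \<open>
  By \<open>picard_halving\<close> any bound for \<open>y\<close> in the weighted norm can be halved.
\<close>

lemma volterra_zero:
  assumes y: "causal y" and eq: "\<And>t. y t = conv one (D y) t"
  shows "y t = 0"
proof -
  obtain B where B: "B \<ge> 0" "\<And>s. s \<le> t \<Longrightarrow> \<bar>y s\<bar> \<le> B" using causal_bound[OF y] by blast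
  have "\<forall>s\<le>t. \<bar>y s\<bar> \<le> B / 2 ^ n * exp (growth * s)" for n
  proof (induction n)
    case 0
    have "\<bar>y s\<bar> \<le> B * exp (growth * s)" if "s \<le> t" for s
    proof (cases "s < 0")
      case False
      then have "B * 1 \<le> B * exp (growth * s)" using B(1) growth_pos by (intro mult_left_mono) auto
      then show ?thesis using B(2)[OF that] by simp
    qed (use causal_neg[OF y] B in auto)
    then show ?case by simp
  next
    case (Suc n)
    then show ?case
      using picard_halving[OF y, of t "B / 2 ^ n"] by (auto simp: eq[symmetric] field_simps)
  qed
  then have "\<bar>y t\<bar> \<le> (B * exp (growth * t)) / 2 ^ n" for n by simp
  moreover have "(\<lambda>n. (B * exp (growth * t)) / 2 ^ n) \<longlonglongrightarrow> 0"
    using tendsto_mult_right_zero[OF LIMSEQ_inverse_realpow_zero[of 2], of "B * exp (growth * t)"]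
    by (simp add: divide_inverse)
  ultimately have "\<bar>y t\<bar> \<le> 0" by (intro LIMSEQ_le_const) auto
  then show ?thesis by simp
qed

lemma volterra_unique:
  assumes "causal y" "causal z"
    and "\<And>t. y t = H t + conv one (D y) t" "\<And>t. z t = H t + conv one (D z) t"
  shows "y = z"
proof
  fix t
  have "y t - z t = 0"
  proof (rule volterra_zero[OF causal_diff[OF assms(1,2)]])
    show "y t - z t = conv one (D (\<lambda>t. y t - z t)) t" for t
      using assms(3,4)[of t] conv_diff_right[OF causal_D causal_D causal_one] assms(1,2)
      by (simp add: D_diff[OF assms(1,2)])
  qed
  then show "y t = z t" by simp
qed

primrec picard :: "nat \<Rightarrow> real \<Rightarrow> real" where
  "picard 0 = one"
| "picard (Suc n) = (\<lambda>t. one t + conv one (D (picard n)) t)"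

lemma causal_picard: "causal (picard n)"
  by (induction n) (auto intro: causal_one causal_add causal_conv causal_D)

lemma picard_step: "\<bar>picard (Suc n) t - picard n t\<bar> \<le> 1 / 2 ^ Suc n * exp (growth * t)"
proof (induction n arbitrary: t)
  case 0
  have "\<bar>one t\<bar> \<le> 1 * exp (growth * t)" for t :: real
    using growth_pos by (auto simp: indicator_def)
  from picard_halving[OF causal_one this, of t t] show ?case by simp
next
  case (Suc n)
  have "picard (Suc (Suc n)) t - picard (Suc n) t = conv one (D (\<lambda>t. picard (Suc n) t - picard n t)) t"
    using conv_diff_right[OF causal_D[OF causal_picard[of "Suc n"]] causal_D[OF causal_picard[of n]] causal_one]
    by (simp add: D_diff[OF causal_picard causal_picard, of "Suc n" n, simplified])
  then show ?case
    using picard_halving[OF causal_diff[OF causal_picard causal_picard] Suc, of t t] by simp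
qed

lemma picard_diff: "\<bar>picard (n + k) t - picard n t\<bar> \<le> (1 / 2 ^ n - 1 / 2 ^ (n + k)) * exp (growth * t)"
proof (induction k)
  case (Suc k)
  have "\<bar>picard (n + Suc k) t - picard n t\<bar>
      \<le> \<bar>picard (Suc (n + k)) t - picard (n + k) t\<bar> + \<bar>picard (n + k) t - picard n t\<bar>"
    by simp
  also have "\<dots> \<le> 1 / 2 ^ Suc (n + k) * exp (growth * t) + (1 / 2 ^ n - 1 / 2 ^ (n + k)) * exp (growth * t)"
    by (intro add_mono picard_step Suc)
  also have "\<dots> = (1 / 2 ^ n - 1 / 2 ^ (n + Suc k)) * exp (growth * t)"
    by (simp add: field_simps)
  finally show ?case .
qed simp

lemma picard_limit: "\<exists>r. \<forall>t. (\<lambda>n. picard n t) \<longlonglongrightarrow> r t"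
proof -
  have "convergent (\<lambda>n. picard n t)" for t
  proof (rule Cauchy_convergent, rule CauchyI')
    fix e :: real assume e: "e > 0"
    have "(\<lambda>n. exp (growth * t) * inverse (2 ^ n)) \<longlonglongrightarrow> 0"
      by (intro tendsto_mult_right_zero LIMSEQ_inverse_realpow_zero) simp
    then have "\<forall>\<^sub>F n in sequentially. exp (growth * t) * inverse (2 ^ n) < e"
      using e by (rule order_tendstoD)
    then obtain N where N: "exp (growth * t) * inverse (2 ^ N) < e"
      unfolding eventually_sequentially by blast
    show "\<exists>M. \<forall>m\<ge>M. \<forall>n>m. dist (picard m t) (picard n t) < e"
    proof (intro exI[of _ N] allI impI)
      fix m n assume mn: "N \<le> m" "m < n"
      have "dist (picard m t) (picard n t) \<le> (1 / 2 ^ m - 1 / 2 ^ n) * exp (growth * t)"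
        using picard_diff[of m "n - m" t] mn by (simp add: dist_real_def abs_minus_commute)
      also have "\<dots> \<le> inverse (2 ^ N) * exp (growth * t)"
      proof (rule mult_right_mono)
        have "1 / 2 ^ m \<le> inverse (2 ^ N :: real)" using mn(1) by (simp add: field_simps power_increasing)
        then show "1 / 2 ^ m - 1 / 2 ^ n \<le> inverse (2 ^ N :: real)"
          by (smt (verit) zero_less_divide_1_iff zero_less_power)
      qed simp
      finally show "dist (picard m t) (picard n t) < e" using N by (simp add: mult.commute)
    qed
  qed
  then show ?thesis unfolding convergent_def by metis
qed

lemma volterra_resolvent_exists: "\<exists>r. causal r \<and> (\<forall>t. r t = one t + conv one (D r) t)"
proof -
  obtain r where r: "\<And>t. (\<lambda>n. picard n t) \<longlonglongrightarrow> r t" using picard_limit by blast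
  have rn: "\<bar>r t - picard n t\<bar> \<le> 1 / 2 ^ n * exp (growth * t)" for n t
  proof (rule LIMSEQ_le_const2)
    show "(\<lambda>k. \<bar>picard (n + k) t - picard n t\<bar>) \<longlonglongrightarrow> \<bar>r t - picard n t\<bar>"
      using LIMSEQ_ignore_initial_segment[OF r[of t], of n]
      by (intro tendsto_intros) (simp add: add.commute)
    have "(1 / 2 ^ n - 1 / 2 ^ (n + k)) * exp (growth * t) \<le> 1 / 2 ^ n * exp (growth * t)" for k
      by (intro mult_right_mono) auto
    then show "\<exists>N. \<forall>k\<ge>N. \<bar>picard (n + k) t - picard n t\<bar> \<le> 1 / 2 ^ n * exp (growth * t)"
      using picard_diff order_trans by blast
  qed
  have "causal r"
    unfolding causal_def
  proof (intro conjI allI impI)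
    show "r \<in> borel_measurable borel"
      by (rule borel_measurable_LIMSEQ_real[OF r]) (rule causal_measurable[OF causal_picard])
    show "r t = 0" if "t < 0" for t
      using LIMSEQ_unique[OF r[of t], of 0] causal_neg[OF causal_picard that] by simp
    fix T
    obtain B where B: "B \<ge> 0" "\<And>t. t \<le> T \<Longrightarrow> \<bar>picard 0 t\<bar> \<le> B" using causal_bound[OF causal_picard] by blast
    have "\<bar>r t\<bar> \<le> B + exp (growth * T)" if "t \<le> T" for t
    proof -
      have "exp (growth * t) \<le> exp (growth * T)" using that growth_pos by simp
      moreover have "\<bar>r t - picard 0 t\<bar> \<le> exp (growth * t)" using rn[of t 0] by simp
      ultimately show ?thesis using B(2)[OF that] by linarith
    qed
    then show "\<exists>B. \<forall>t\<le>T. \<bar>r t\<bar> \<le> B" by blast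
  qed
  moreover have "r t = one t + conv one (D r) t" for t
  proof -
    have "\<bar>conv one (D (picard n)) t - conv one (D r) t\<bar> \<le> inverse (2 ^ n) * exp (growth * t)" for n
    proof -
      have "\<bar>conv one (D (\<lambda>t. r t - picard n t)) t\<bar> \<le> 1 / 2 ^ n / 2 * exp (growth * t)"
        by (rule picard_halving[OF causal_diff[OF \<open>causal r\<close> causal_picard] rn order_refl])
      also have "\<dots> \<le> inverse (2 ^ n) * exp (growth * t)" by (intro mult_right_mono) (auto simp: field_simps)
      finally show ?thesis
        using conv_diff_right[OF causal_D[OF \<open>causal r\<close>] causal_D[OF causal_picard] causal_one]
        by (simp add: D_diff[OF \<open>causal r\<close> causal_picard])
    qed
    moreover have "(\<lambda>n. inverse (2 ^ n) * exp (growth * t)) \<longlonglongrightarrow> 0"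
      by (intro tendsto_mult_left_zero LIMSEQ_inverse_realpow_zero) simp
    ultimately have "(\<lambda>n. conv one (D (picard n)) t - conv one (D r) t) \<longlonglongrightarrow> 0"
      using Lim_null_comparison[OF eventuallyI,
          of "\<lambda>n. conv one (D (picard n)) t - conv one (D r) t" "\<lambda>n. inverse (2 ^ n) * exp (growth * t)" sequentially]
      by simp
    then have "(\<lambda>n. conv one (D (picard n)) t) \<longlonglongrightarrow> conv one (D r) t"
      by (rule LIM_zero_cancel)
    from tendsto_add[OF tendsto_const[of "one t"] this]
    have "(\<lambda>n. picard (Suc n) t) \<longlonglongrightarrow> one t + conv one (D r) t"
      by simp
    moreover have "(\<lambda>n. picard (Suc n) t) \<longlonglongrightarrow> r t"
      using r by (rule LIMSEQ_Suc)
    ultimately show ?thesis by (simp add: LIMSEQ_unique)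
  qed
  ultimately show ?thesis by blast
qed

lemma is_resolvent_iff:
  "is_resolvent \<tau> \<mu> r \<longleftrightarrow> causal r \<and> (\<forall>t. r t = one t + conv one (D r) t)"
proof -
  have main: "locally_absolutely_continuous r \<and> (AE t in lebesgue. t > 0 \<longrightarrow> (r has_real_derivative D r t) (at t))
    \<longleftrightarrow> (\<forall>t\<ge>0. r t = r 0 + conv one (D r) t)" if "causal r"
    using locally_absolutely_continuous_iff_integral[OF causal_L1_loc[OF causal_D[OF that]], of r]
    by (simp add: conv_one_eq_integral[OF causal_D[OF that]])
  have zero: "conv one (D r) t = 0" if "causal r" "t \<le> 0" for t
    using that by (cases "t = 0") (auto simp: conv_one_eq_integral causal_D causal_conv causal_one causal_neg)
  show ?thesis
  proof
    assume r: "is_resolvent \<tau> \<mu> r"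
    then have c: "causal r"
      using locally_absolutely_continuous_imp_continuous_on
      by (intro causal_continuousI) (auto simp: is_resolvent_def)
    then have "r t = one t + conv one (D r) t" for t
      using main[OF c] r zero[OF c, of t] unfolding is_resolvent_def
      by (cases "t \<ge> 0") auto
    with c show "causal r \<and> (\<forall>t. r t = one t + conv one (D r) t)" by blast
  next
    assume r: "causal r \<and> (\<forall>t. r t = one t + conv one (D r) t)"
    then have c: "causal r" by blast
    have "r 0 = 1" using r zero[OF c, of 0] by simp
    moreover have "\<forall>t\<ge>0. r t = r 0 + conv one (D r) t" using r \<open>r 0 = 1\<close> by (auto simp: indicator_def)
    ultimately show "is_resolvent \<tau> \<mu> r"
      using main[OF c] causal_neg[OF c] unfolding is_resolvent_def by blast
  qed
qed

abbreviation "r \<equiv> resolvent \<tau> \<mu>"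

lemma is_resolvent_resolvent: "is_resolvent \<tau> \<mu> r"
proof -
  obtain r' where r': "causal r'" "\<And>t. r' t = one t + conv one (D r') t"
    using volterra_resolvent_exists by blast
  show ?thesis
    unfolding resolvent_def
  proof (rule theI[of "is_resolvent \<tau> \<mu>" r'])
    show "is_resolvent \<tau> \<mu> r'" using r' by (simp add: is_resolvent_iff)
    show "q = r'" if "is_resolvent \<tau> \<mu> q" for q
      using that r' volterra_unique[of q r' one] by (auto simp: is_resolvent_iff)
  qed
qed

lemma causal_r: "causal r" and r_eq: "r t = one t + conv one (D r) t"
  using is_resolvent_resolvent by (auto simp: is_resolvent_iff)

lemma conv_D_r: "conv one (D r) = (\<lambda>t. r t - one t)"
  using r_eq by (auto simp: fun_eq_iff)

text \<open>
  Convolve the resolvent equation with \<open>H\<close>.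
\<close>

lemma conv_r_solves:
  assumes H: "causal H"
  shows "conv r H t = conv one H t + conv one (D (conv r H)) t"
proof -
  have "conv one (D (conv r H)) = conv (conv one (D r)) H"
    by (simp add: D_conv[OF causal_r H] conv_assoc[OF causal_one causal_D[OF causal_r] H])
  also have "\<dots> = (\<lambda>t. conv r H t - conv one H t)"
    by (simp add: conv_D_r conv_diff_left[OF causal_r causal_one H])
  finally show ?thesis by simp
qed

text \<open>
  Both sides solve \<open>Y = 1 * H + 1 * D Y\<close>.
\<close>

lemma volterra_solution_unique_integrated:
  assumes "causal y" and H: "causal H" and eq: "\<And>t. y t = H t + conv one (D y) t"
  shows "conv one y = conv r H"
proof (rule volterra_unique)
  show "causal (conv one y)" "causal (conv r H)"
    by (intro causal_conv causal_one causal_r assms)+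
  show "conv r H t = conv one H t + conv one (D (conv r H)) t" for t by (rule conv_r_solves[OF H])
  have "conv one y = conv one (\<lambda>t. H t + conv one (D y) t)" using eq by (simp flip: eq)
  also have "\<dots> = (\<lambda>t. conv one H t + conv one (conv one (D y)) t)"
    by (rule conv_add_right) (intro causal_conv causal_one causal_D assms)+
  also have "conv one (D y) = D (conv one y)" by (rule conv_one_D[OF assms(1)])
  finally show "conv one y t = conv one H t + conv one (D (conv one y)) t" for t by (rule fun_cong)
qed

text \<open>
  The variation of constants formula, with \<open>D r\<close> in the role of the derivative of \<open>r\<close>; in this form
  no derivative of \<open>H\<close> occurs.
\<close>

lemma volterra_solution_exists:
  assumes H: "causal H"
  shows "\<exists>y. causal y \<and> (\<forall>t. y t = H t + conv one (D y) t)"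
proof (intro exI conjI allI)
  let ?y = "\<lambda>t. H t + conv (D r) H t"
  have DrH: "causal (conv (D r) H)" by (intro causal_conv causal_D causal_r H)
  show "causal ?y" by (intro causal_add H DrH)
  fix t
  have "conv one (D ?y) = conv one (\<lambda>t. D H t + D (conv (D r) H) t)"
    by (simp add: D_add[OF H DrH])
  also have "\<dots> = (\<lambda>t. conv one (D H) t + conv one (D (conv (D r) H)) t)"
    by (intro conv_add_right causal_D H DrH causal_one)
  also have "conv one (D (conv (D r) H)) = D (conv one (conv (D r) H))"
    by (rule conv_one_D[OF DrH])
  also have "conv one (conv (D r) H) = conv (conv one (D r)) H"
    by (rule conv_assoc[symmetric]) (intro causal_one causal_D causal_r H)+
  also have "\<dots> = (\<lambda>t. conv r H t - conv one H t)"
    by (simp add: conv_D_r conv_diff_left[OF causal_r causal_one H])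
  also have "D \<dots> = (\<lambda>t. conv (D r) H t - conv one (D H) t)"
    using D_diff[OF causal_conv[OF causal_r H] causal_conv[OF causal_one H]]
    by (simp add: D_conv[OF causal_r H] conv_one_D[OF H])
  finally show "?y t = H t + conv one (D ?y) t" by simp
qed

section \<open>The solution of the delay equation\<close>

text \<open>
  The part of the solution to the left of \<open>0\<close>. The value at \<open>0\<close> belongs to the causal part, so that
  the two parts add up to the solution.
\<close>

definition history :: "(real \<Rightarrow> real) \<Rightarrow> real \<Rightarrow> real" where
  "history \<psi> t = (if t \<in> {-\<tau>..<0} then \<psi> t else 0)"

text \<open>
  What the history contributes to the right-hand side of the equation at times \<open>t \<ge> 0\<close>. It vanishes
  after time \<open>\<tau>\<close>.
\<close>

definition history_forcing :: "(real \<Rightarrow> real) \<Rightarrow> real \<Rightarrow> real" where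
  "history_forcing \<psi> t = one t * D (history \<psi>) t"

definition initial_data :: "(real \<Rightarrow> real) \<Rightarrow> real \<Rightarrow> real" where
  "initial_data \<psi> t = one t * \<psi> 0 + conv one (history_forcing \<psi>) t"

lemma history_measurable:
  assumes "continuous_on {-\<tau>..0} \<psi>"
  shows "history \<psi> \<in> borel_measurable borel"
proof -
  have "(\<lambda>t. indicator {-\<tau>..<0} t *\<^sub>R \<psi> t) \<in> borel_measurable borel"
    by (rule borel_measurable_continuous_on_indicator) (auto intro: continuous_on_subset[OF assms])
  moreover have "(\<lambda>t. indicator {-\<tau>..<0} t *\<^sub>R \<psi> t) = history \<psi>"
    by (auto simp: history_def indicator_def)
  ultimately show ?thesis by simp
qed

lemma history_bound:
  assumes "continuous_on {-\<tau>..0} \<psi>"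
  shows "\<exists>B. \<forall>t. \<bar>history \<psi> t\<bar> \<le> B"
proof -
  have "bounded (\<psi> ` {-\<tau>..0})"
    by (intro compact_imp_bounded compact_continuous_image assms) simp
  then obtain B where B: "\<And>t. t \<in> {-\<tau>..0} \<Longrightarrow> \<bar>\<psi> t\<bar> \<le> B"
    unfolding bounded_iff real_norm_def by blast
  have "\<bar>history \<psi> t\<bar> \<le> \<bar>B\<bar>" for t
    using B[of t] by (auto simp: history_def)
  then show ?thesis by blast
qed

lemma history_integrable:
  assumes "continuous_on {-\<tau>..0} \<psi>"
  shows "integrable pos_part (\<lambda>u. history \<psi> (t + u))"
    "integrable neg_part (\<lambda>u. history \<psi> (t + u))"
proof -
  note [measurable] = history_measurable[OF assms]
  obtain B where B: "\<And>t. \<bar>history \<psi> t\<bar> \<le> B" using history_bound[OF assms] by blast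
  show "integrable pos_part (\<lambda>u. history \<psi> (t + u))"
    by (rule pos.integrable_bounded[of _ B]) (use B in auto)
  show "integrable neg_part (\<lambda>u. history \<psi> (t + u))"
    by (rule neg.integrable_bounded[of _ B]) (use B in auto)
qed

lemma causal_history_forcing:
  assumes "continuous_on {-\<tau>..0} \<psi>"
  shows "causal (history_forcing \<psi>)"
  unfolding causal_def
proof (intro conjI allI impI)
  note [measurable] = pos.id_measurable_nu neg.id_measurable_nu history_measurable[OF assms]
  have "(\<lambda>t. D (history \<psi>) t) \<in> borel_measurable borel"
    unfolding D_eq by measurable
  then show "history_forcing \<psi> \<in> borel_measurable borel"
    unfolding history_forcing_def by measurable
  obtain B where B: "\<And>t. \<bar>history \<psi> t\<bar> \<le> B" using history_bound[OF assms] by blast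
  have DB: "\<bar>D (history \<psi>) t\<bar> \<le> total_variation * B" for t
    by (rule D_bound) (use B in auto)
  have "\<bar>history_forcing \<psi> t\<bar> \<le> total_variation * B" for t
    using DB[of t] order_trans[OF abs_ge_zero DB[of t]] by (auto simp: history_forcing_def indicator_def)
  then show "\<exists>B. \<forall>t\<le>T. \<bar>history_forcing \<psi> t\<bar> \<le> B" for T by blast
qed (simp add: history_forcing_def)

lemma causal_initial_data:
  assumes "continuous_on {-\<tau>..0} \<psi>"
  shows "causal (initial_data \<psi>)"
  using causal_add[OF causal_cmult[OF causal_one] causal_conv[OF causal_one causal_history_forcing[OF assms]]]
  by (simp add: initial_data_def[abs_def] mult.commute)

lemma initial_data_zero: "initial_data (\<lambda>_. 0) t = 0"
  by (simp add: initial_data_def history_forcing_def history_def[abs_def] D_eq conv_def)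

lemma bounded_initial_data:
  assumes "continuous_on {-\<tau>..0} \<psi>"
  shows "\<exists>B. \<forall>t. \<bar>initial_data \<psi> t\<bar> \<le> B"
proof -
  note c = causal_history_forcing[OF assms]
  obtain B where B: "B \<ge> 0" "\<And>t. t \<le> \<tau> \<Longrightarrow> \<bar>initial_data \<psi> t\<bar> \<le> B"
    using causal_bound[OF causal_initial_data[OF assms]] by blast
  have "\<bar>initial_data \<psi> t\<bar> \<le> B" for t
  proof (cases "t \<le> \<tau>")
    case False
    have h0: "history_forcing \<psi> s = 0" if "s \<ge> \<tau>" for s
    proof -
      have "\<bar>D (history \<psi>) s\<bar> \<le> total_variation * 0"
        by (rule D_bound[OF history_measurable[OF assms]]) (use that in \<open>auto simp: history_def\<close>)
      then show ?thesis by (simp add: history_forcing_def)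
    qed
    have "conv one (history_forcing \<psi>) t - conv one (history_forcing \<psi>) \<tau> = integral {\<tau>..t} (history_forcing \<psi>)"
      using False tau_pos by (intro integral_causal_diff c) auto
    also have "\<dots> = integral {\<tau>..t} (\<lambda>_. 0)" by (rule integral_cong) (simp add: h0)
    finally have "initial_data \<psi> t = initial_data \<psi> \<tau>"
      using False tau_pos by (simp add: initial_data_def)
    then show ?thesis using B(2)[of \<tau>] by simp
  qed (use B in auto)
  then show ?thesis by blast
qed

lemma D_plus_history:
  assumes "continuous_on {-\<tau>..0} \<psi>" "causal y"
  shows "D (\<lambda>t. y t + history \<psi> t) t = D y t + D (history \<psi>) t"
  using history_integrable[OF assms(1), of t] pos.integrable_shift[OF assms(2), of t] neg.integrable_shift[OF assms(2), of t]
  by (simp add: D_eq)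

text \<open>
  Splitting off the history leaves a Volterra equation for the causal part. Existence and uniqueness
  of the solution are thereby those of the Volterra equation.
\<close>

lemma is_solution_iff:
  assumes \<psi>: "continuous_on {-\<tau>..0} \<psi>" and f: "f \<in> L1_loc"
  shows "is_solution \<tau> \<mu> f \<psi> x \<and> (\<forall>t < - \<tau>. x t = 0) \<longleftrightarrow>
    (\<exists>y. causal y \<and> (\<forall>t. y t = (primitive f t + initial_data \<psi> t) + conv one (D y) t)
        \<and> x = (\<lambda>t. y t + history \<psi> t))"
proof -
  define rhs where "rhs = (\<lambda>y t. D y t + history_forcing \<psi> t + f t)"
  have main: "locally_absolutely_continuous x \<and> (AE t in lebesgue. t > 0 \<longrightarrow> (x has_real_derivative D x t + f t) (at t))
    \<longleftrightarrow> (\<forall>t\<ge>0. x t = x 0 + (primitive f t + conv one (history_forcing \<psi>) t) + conv one (D y) t)"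
    if y: "causal y" and x: "x = (\<lambda>t. y t + history \<psi> t)" for x y
  proof -
    note cD = causal_D[OF y] and ch = causal_history_forcing[OF \<psi>]
    have "(\<lambda>t. (D y t + history_forcing \<psi> t) + f t) \<in> L1_loc"
      by (rule causal_add_L1_loc[OF causal_add[OF cD ch] f])
    then have g: "rhs y \<in> L1_loc" by (simp add: rhs_def)
    have "D x t + f t = rhs y t" if "t > 0" for t
      unfolding x rhs_def D_plus_history[OF \<psi> y] using that by (simp add: history_forcing_def)
    then have "(AE t in lebesgue. t > 0 \<longrightarrow> (x has_real_derivative D x t + f t) (at t)) \<longleftrightarrow>
        (AE t in lebesgue. t > 0 \<longrightarrow> (x has_real_derivative rhs y t) (at t))"
      by (intro AE_cong) auto
    moreover have "integral {0..t} (rhs y) = (primitive f t + conv one (history_forcing \<psi>) t) + conv one (D y) t"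
      if "t \<ge> 0" for t
    proof -
      have "integral {0..t} (rhs y) = integral {0..t} (D y) + integral {0..t} (history_forcing \<psi>) + integral {0..t} f"
        unfolding rhs_def
        by (subst integral_add integrable_add, (intro integrable_add causal_integrable_on cD ch L1_loc_integrable[OF f] order_refl)+)+ simp
      then show ?thesis
        using that by (simp add: primitive_def conv_one_eq_integral cD ch)
    qed
    ultimately show ?thesis
      using locally_absolutely_continuous_iff_integral[OF g, of x] by (simp add: add.assoc)
  qed
  have zero: "conv one a 0 = 0" if "causal a" for a
    by (simp add: conv_one_eq_integral[OF that])
  show ?thesis
  proof
    assume x: "is_solution \<tau> \<mu> f \<psi> x \<and> (\<forall>t < - \<tau>. x t = 0)"
    define y where "y = (\<lambda>t. if t \<ge> 0 then x t else 0)"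
    have "continuous_on {0..} x"
      using x locally_absolutely_continuous_imp_continuous_on by (auto simp: is_solution_def)
    then have "continuous_on {0..} y"
      by (rule continuous_on_eq) (simp add: y_def)
    then have y: "causal y" by (rule causal_continuousI[rotated]) (simp add: y_def)
    have xy: "x = (\<lambda>t. y t + history \<psi> t)"
    proof
      fix t
      show "x t = y t + history \<psi> t"
        using x tau_pos by (cases "t < - \<tau>"; cases "t \<ge> 0") (auto simp: y_def history_def is_solution_def)
    qed
    have x0: "x 0 = \<psi> 0" using x tau_pos by (auto simp: is_solution_def)
    have "y t = (primitive f t + initial_data \<psi> t) + conv one (D y) t" for t
    proof (cases "t \<ge> 0")
      case True
      then show ?thesis
        using main[OF y xy] x x0 unfolding is_solution_def by (simp add: y_def initial_data_def)
    next
      case False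
      then show ?thesis
        using causal_neg[OF y] causal_neg[OF causal_primitive[OF f]] causal_neg[OF causal_initial_data[OF \<psi>]]
          causal_neg[OF causal_conv[OF causal_one causal_D[OF y]]] by simp
    qed
    with y xy show "\<exists>y. causal y \<and> (\<forall>t. y t = (primitive f t + initial_data \<psi> t) + conv one (D y) t)
        \<and> x = (\<lambda>t. y t + history \<psi> t)" by blast
  next
    assume "\<exists>y. causal y \<and> (\<forall>t. y t = (primitive f t + initial_data \<psi> t) + conv one (D y) t)
        \<and> x = (\<lambda>t. y t + history \<psi> t)"
    then obtain y where y: "causal y" "\<And>t. y t = (primitive f t + initial_data \<psi> t) + conv one (D y) t"
      and xy: "x = (\<lambda>t. y t + history \<psi> t)" by blast
    have y0: "y 0 = \<psi> 0"
      using y(2)[of 0] by (simp add: primitive_def initial_data_def zero causal_D[OF y(1)] causal_history_forcing[OF \<psi>])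
    have "x t = x 0 + (primitive f t + conv one (history_forcing \<psi>) t) + conv one (D y) t" if "t \<ge> 0" for t
      using y(2)[of t] y0 that by (simp add: xy history_def initial_data_def)
    then have "locally_absolutely_continuous x \<and> (AE t in lebesgue. t > 0 \<longrightarrow> (x has_real_derivative D x t + f t) (at t))"
      using main[OF y(1) xy] by blast
    moreover have "x t = \<psi> t" if "t \<in> {-\<tau>..0}" for t
      using that y0 causal_neg[OF y(1)] by (cases "t = 0") (auto simp: xy history_def)
    moreover have "x t = 0" if "t < - \<tau>" for t
      using that tau_pos causal_neg[OF y(1), of t] by (simp add: xy history_def)
    ultimately show "is_solution \<tau> \<mu> f \<psi> x \<and> (\<forall>t < - \<tau>. x t = 0)"
      unfolding is_solution_def by blast
  qed
qed

lemma solution_volterra: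
  assumes \<psi>: "continuous_on {-\<tau>..0} \<psi>" and f: "f \<in> L1_loc"
  shows "\<exists>y. causal y \<and> (\<forall>t. y t = (primitive f t + initial_data \<psi> t) + conv one (D y) t)
        \<and> solution \<tau> \<mu> f \<psi> = (\<lambda>t. y t + history \<psi> t)"
    and "is_solution \<tau> \<mu> f \<psi> (solution \<tau> \<mu> f \<psi>)"
proof -
  let ?P = "\<lambda>x. is_solution \<tau> \<mu> f \<psi> x \<and> (\<forall>t < - \<tau>. x t = 0)"
  have "causal (\<lambda>t. primitive f t + initial_data \<psi> t)"
    by (intro causal_add causal_primitive causal_initial_data assms)
  then obtain y where y: "causal y" "\<And>t. y t = (primitive f t + initial_data \<psi> t) + conv one (D y) t"
    using volterra_solution_exists by blast
  have "?P (solution \<tau> \<mu> f \<psi>)"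
    unfolding solution_def
  proof (rule theI[of ?P "\<lambda>t. y t + history \<psi> t"])
    show "?P (\<lambda>t. y t + history \<psi> t)"
      unfolding is_solution_iff[OF assms] using y by blast
    show "x = (\<lambda>t. y t + history \<psi> t)" if "?P x" for x
      using that volterra_unique[OF _ y(1) _ y(2)] unfolding is_solution_iff[OF assms] by blast
  qed
  then show "is_solution \<tau> \<mu> f \<psi> (solution \<tau> \<mu> f \<psi>)"
    "\<exists>y. causal y \<and> (\<forall>t. y t = (primitive f t + initial_data \<psi> t) + conv one (D y) t)
        \<and> solution \<tau> \<mu> f \<psi> = (\<lambda>t. y t + history \<psi> t)"
    using is_solution_iff[OF assms] by blast+
qed

end

section \<open>Linear growth rates under convolution\<close>

lemma filterlim_shift_at_top: "filterlim (\<lambda>t. t + u) at_top (at_top :: real filter)"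
  using filterlim_tendsto_add_at_top[OF tendsto_const[of u] filterlim_ident] by (simp add: add.commute)

lemma tendsto_div_ident_shift:
  fixes F :: "real \<Rightarrow> real"
  assumes "((\<lambda>t. F t / t) \<longlongrightarrow> C) at_top"
  shows "((\<lambda>t. F (t + u) / t) \<longlongrightarrow> C) at_top"
proof -
  have "((\<lambda>t. F (t + u) / (t + u) * (1 + u / t)) \<longlongrightarrow> C * (1 + 0)) at_top"
    by (intro tendsto_intros filterlim_compose[OF assms filterlim_shift_at_top]
        tendsto_divide_0[OF tendsto_const] filterlim_at_top_imp_at_infinity filterlim_ident)
  moreover have "\<forall>\<^sub>F t in at_top. F (t + u) / (t + u) * (1 + u / t) = F (t + u) / t"
    using eventually_gt_at_top[of "\<bar>u\<bar>"]
  proof eventually_elim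
    case (elim t)
    then have "1 + u / t = (t + u) / t" "t + u \<noteq> 0" by (auto simp: field_simps)
    then show ?case by simp
  qed
  ultimately have "((\<lambda>t. F (t + u) / t) \<longlongrightarrow> C * (1 + 0)) at_top"
    by (rule Lim_transform_eventually)
  then show ?thesis by simp
qed

lemma causal_linear_bound:
  assumes F: "causal F" and lim: "((\<lambda>t. F t / t) \<longlongrightarrow> C) at_top"
  shows "\<exists>A\<ge>0. \<forall>t\<ge>1. \<forall>s\<le>t. \<bar>F s\<bar> \<le> A * t"
proof -
  have "((\<lambda>t. \<bar>F t / t\<bar>) \<longlongrightarrow> \<bar>C\<bar>) at_top" using lim by (rule tendsto_rabs)
  then have "\<forall>\<^sub>F t in at_top. \<bar>F t / t\<bar> < \<bar>C\<bar> + 1" by (rule order_tendstoD) simp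
  then obtain T where T: "\<And>t. t \<ge> T \<Longrightarrow> \<bar>F t / t\<bar> < \<bar>C\<bar> + 1"
    unfolding eventually_at_top_linorder by blast
  obtain B where B: "B \<ge> 0" "\<And>t. t \<le> max T 1 \<Longrightarrow> \<bar>F t\<bar> \<le> B" using causal_bound[OF F] by blast
  show ?thesis
  proof (intro exI[of _ "B + \<bar>C\<bar> + 1"] conjI allI impI)
    fix s t :: real assume t: "1 \<le> t" "s \<le> t"
    show "\<bar>F s\<bar> \<le> (B + \<bar>C\<bar> + 1) * t"
    proof (cases "s \<le> max T 1")
      case True
      then have "\<bar>F s\<bar> \<le> B * 1" using B by simp
      also have "\<dots> \<le> (B + \<bar>C\<bar> + 1) * t" using t B by (intro mult_mono) auto
      finally show ?thesis .
    next
      case False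
      then have "\<bar>F s\<bar> < (\<bar>C\<bar> + 1) * s" using T[of s] by (simp add: field_simps)
      then have "\<bar>F s\<bar> \<le> (\<bar>C\<bar> + 1) * s" by simp
      also have "\<dots> \<le> (B + \<bar>C\<bar> + 1) * t" using t False B by (intro mult_mono) auto
      finally show ?thesis .
    qed
  qed (use B in auto)
qed

lemma conv_tendsto_div_ident:
  assumes a: "causal a" "integrable lborel a" and F: "causal F"
    and lim: "((\<lambda>t. F t / t) \<longlongrightarrow> C) at_top"
  shows "((\<lambda>t. conv a F t / t) \<longlongrightarrow> C * (LINT s|lborel. a s)) at_top"
proof -
  note [measurable] = a(1)[THEN causal_measurable] F[THEN causal_measurable]
  obtain A where bound: "\<And>s t. \<lbrakk>t \<ge> 1; s \<le> t\<rbrakk> \<Longrightarrow> \<bar>F s\<bar> \<le> A * t"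
    using causal_linear_bound[OF F lim] by blast
  have "((\<lambda>t. LINT s|lborel. F (t - s) / t * a s) \<longlongrightarrow> (LINT s|lborel. C * a s)) at_top"
  proof (rule integral_dominated_convergence_at_top[where w = "\<lambda>s. A * \<bar>a s\<bar>"])
    show "AE s in lborel. ((\<lambda>t. F (t - s) / t * a s) \<longlongrightarrow> C * a s) at_top"
    proof (rule AE_I2)
      show "((\<lambda>t. F (t - s) / t * a s) \<longlongrightarrow> C * a s) at_top" for s
        using tendsto_mult_right[OF tendsto_div_ident_shift[OF lim, of "- s"], of "a s"] by simp
    qed
    show "\<forall>\<^sub>F t in at_top. AE s in lborel. norm (F (t - s) / t * a s) \<le> A * \<bar>a s\<bar>"
      using eventually_ge_at_top[of 1]
    proof eventually_elim
      fix t :: real assume t: "t \<ge> 1"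
      show "AE s in lborel. norm (F (t - s) / t * a s) \<le> A * \<bar>a s\<bar>"
      proof (rule AE_I2)
        fix s
        show "norm (F (t - s) / t * a s) \<le> A * \<bar>a s\<bar>"
        proof (cases "s < 0")
          case False
          then have "\<bar>F (t - s)\<bar> / t \<le> A"
            using bound[OF t, of "t - s"] t by (simp add: field_simps)
          then have "\<bar>F (t - s)\<bar> / t * \<bar>a s\<bar> \<le> A * \<bar>a s\<bar>" by (rule mult_right_mono) simp
          then show ?thesis using t by (simp add: abs_mult)
        qed (simp add: causal_neg[OF a(1)])
      qed
    qed
    show "integrable lborel (\<lambda>s. A * \<bar>a s\<bar>)" using a(2) by simp
  qed measurable
  moreover have "conv a F t / t = (LINT s|lborel. F (t - s) / t * a s)" for t
    unfolding conv_commute[of a] conv_def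
    by (simp flip: Bochner_Integration.integral_divide_zero)
  ultimately show ?thesis by (simp del: times_divide_eq_left)
qed

lemma const_div_ident_tendsto_0: "((\<lambda>t. c / t) \<longlongrightarrow> (0 :: real)) at_top"
  by (intro tendsto_divide_0[OF tendsto_const] filterlim_at_top_imp_at_infinity filterlim_ident)

lemma bounded_div_ident_tendsto_0:
  fixes b :: "real \<Rightarrow> real"
  assumes "\<And>t. \<bar>b t\<bar> \<le> B"
  shows "((\<lambda>t. b t / t) \<longlongrightarrow> 0) at_top"
proof (rule Lim_null_comparison)
  show "\<forall>\<^sub>F t in at_top. norm (b t / t) \<le> B / t"
    using eventually_gt_at_top[of 0] by eventually_elim (simp add: assms divide_right_mono)
qed (rule const_div_ident_tendsto_0)

lemma causal_indicator: "0 \<le> a \<Longrightarrow> causal (indicator {a..b})"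
  by (auto simp: causal_def indicator_def intro!: exI[of _ 1])

lemma conv_indicator:
  assumes F: "causal F" and "0 \<le> \<theta>" "\<theta> \<le> t"
  shows "conv (indicator {0..\<theta>}) F t = conv one F t - conv one F (t - \<theta>)"
proof -
  have "conv (indicator {0..\<theta>}) F t = (LINT s:{t - \<theta>..t}|lborel. F s)"
    unfolding conv_def set_lebesgue_integral_def
    by (rule Bochner_Integration.integral_cong) (auto simp: indicator_def)
  also have "\<dots> = integral {t - \<theta>..t} F"
    by (rule set_borel_integral_eq_integral(2)[OF causal_set_integrable[OF F]])
  finally show ?thesis
    using integral_causal_diff[OF F, of "t - \<theta>" t] assms by simp
qed

lemma integrable_indicator_lborel: "integrable lborel (indicator {a..b::real} :: real \<Rightarrow> real)"
  by (intro integrable_real_indicator) (auto simp: emeasure_lborel_Icc_eq)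

text \<open>
  A window integral is a convolution with the indicator of \<open>[0, \<theta>]\<close>.
\<close>

lemma window_tendsto_div_ident:
  assumes F: "causal F" and lim: "((\<lambda>t. F t / t) \<longlongrightarrow> C) at_top" and \<theta>: "0 \<le> \<theta>"
  shows "((\<lambda>t. (conv one F (t + \<theta>) - conv one F t) / t) \<longlongrightarrow> C * \<theta>) at_top"
proof -
  have "((\<lambda>t. conv (indicator {0..\<theta>}) F t / t) \<longlongrightarrow> C * (LINT s|lborel. indicator {0..\<theta>} s)) at_top"
    by (rule conv_tendsto_div_ident[OF causal_indicator integrable_indicator_lborel F lim]) simp
  then have "((\<lambda>t. conv (indicator {0..\<theta>}) F (t + \<theta>) / t) \<longlongrightarrow> C * \<theta>) at_top"
    using \<theta> by (intro tendsto_div_ident_shift) simp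
  moreover have "\<forall>\<^sub>F t in at_top. conv (indicator {0..\<theta>}) F (t + \<theta>) / t = (conv one F (t + \<theta>) - conv one F t) / t"
    using eventually_ge_at_top[of 0] by eventually_elim (simp add: conv_indicator[OF F \<theta>])
  ultimately show ?thesis by (rule Lim_transform_eventually)
qed

context delay_measure
begin

lemma shift_integral_tendsto_div_ident:
  assumes F: "causal F" and lim: "((\<lambda>t. F t / t) \<longlongrightarrow> C) at_top"
  shows "((\<lambda>t. (LINT u|\<nu>. F (t + u)) / t) \<longlongrightarrow> C * measure \<nu> {-\<tau>..0}) at_top"
proof -
  note [measurable] = id_measurable_nu F[THEN causal_measurable]
  obtain A where bound: "\<And>s t. \<lbrakk>t \<ge> 1; s \<le> t\<rbrakk> \<Longrightarrow> \<bar>F s\<bar> \<le> A * t"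
    using causal_linear_bound[OF F lim] by blast
  have "((\<lambda>t. LINT u|\<nu>. F (t + u) / t) \<longlongrightarrow> (LINT u|\<nu>. C)) at_top"
  proof (rule integral_dominated_convergence_at_top[where w = "\<lambda>_. A"])
    show "AE u in \<nu>. ((\<lambda>t. F (t + u) / t) \<longlongrightarrow> C) at_top"
      using tendsto_div_ident_shift[OF lim] by simp
    show "\<forall>\<^sub>F t in at_top. AE u in \<nu>. norm (F (t + u) / t) \<le> A"
      using eventually_ge_at_top[of 1]
    proof eventually_elim
      fix t :: real assume t: "t \<ge> 1"
      show "AE u in \<nu>. norm (F (t + u) / t) \<le> A"
      proof (rule AE_I2)
        show "norm (F (t + u) / t) \<le> A" if "u \<in> space \<nu>" for u
          using bound[OF t, of "t + u"] t that by (simp add: field_simps space_nu)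
      qed
    qed
  qed auto
  then show ?thesis by (simp add: space_nu mult.commute)
qed

end

context delay_equation
begin

lemma D_tendsto_div_ident:
  assumes "causal F" "((\<lambda>t. F t / t) \<longlongrightarrow> C) at_top"
  shows "((\<lambda>t. D F t / t) \<longlongrightarrow> C * \<mu> {-\<tau>..0}) at_top"
  using tendsto_diff[OF pos.shift_integral_tendsto_div_ident[OF assms] neg.shift_integral_tendsto_div_ident[OF assms]]
  by (simp add: D_eq diff_divide_distrib right_diff_distrib flip: variation_mass_diff)

abbreviation "rint \<equiv> (LINT s|lborel. r s)"

lemma resolvent_L1_iff_integrable: "r \<in> L1 \<longleftrightarrow> integrable lborel r"
proof -
  have "(\<lambda>s. indicator {0..} s *\<^sub>R r s) = r"
    using causal_neg[OF causal_r] by (force simp: indicator_def fun_eq_iff)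
  then have "r \<in> L1 \<longleftrightarrow> integrable lebesgue r"
    by (simp add: L1_def set_integrable_def)
  also have "\<dots> \<longleftrightarrow> integrable lborel r"
    using causal_measurable[OF causal_r] by (intro integrable_completion) simp
  finally show ?thesis .
qed

text \<open>
  Take the constant forcing \<open>1\<close>, whose primitive is \<open>F t = t\<close>. The integrated solution \<open>Y = r * F\<close>
  grows like \<open>t \<integral> r\<close>, so its derivative \<open>F + D Y\<close> grows like \<open>t (1 + \<mu> [-\<tau>, 0] \<integral> r)\<close>, and
  unless this factor vanishes the increments of \<open>Y\<close> over unit intervals are too large.
\<close>

lemma resolvent_integral_times_mass:
  assumes r: "integrable lborel r"
  shows "rint * \<mu> {-\<tau>..0} = -1"
proof -
  define F where "F = conv one one"
  define Y where "Y = conv r F"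
  have cF: "causal F" and cY: "causal Y"
    unfolding F_def Y_def by (intro causal_conv causal_one causal_r)+
  have "integral {0..t} one = integral {0..t} (\<lambda>_. 1)" for t :: real
    by (rule integral_cong) simp
  then have "F t / t = 1" if "t > 0" for t
    using that by (simp add: F_def conv_one_eq_integral[OF causal_one])
  then have F: "((\<lambda>t. F t / t) \<longlongrightarrow> 1) at_top"
    by (intro tendsto_eventually eventually_mono[OF eventually_gt_at_top[of 0]])
  have Y: "((\<lambda>t. Y t / t) \<longlongrightarrow> rint) at_top"
    using conv_tendsto_div_ident[OF causal_r r cF F] by (simp add: Y_def)
  have "((\<lambda>t. F t / t + D Y t / t) \<longlongrightarrow> 1 + rint * \<mu> {-\<tau>..0}) at_top"
    by (intro tendsto_add F D_tendsto_div_ident[OF cY Y])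
  then have "((\<lambda>t. (F t + D Y t) / t) \<longlongrightarrow> 1 + rint * \<mu> {-\<tau>..0}) at_top"
    by (simp add: add_divide_distrib)
  from window_tendsto_div_ident[OF causal_add[OF cF causal_D[OF cY]] this, of 1]
  have "((\<lambda>t. (Y (t + 1) - Y t) / t) \<longlongrightarrow> 1 + rint * \<mu> {-\<tau>..0}) at_top"
    using conv_add_right[OF cF causal_D[OF cY] causal_one] conv_r_solves[OF cF] by (simp add: Y_def)
  moreover have "((\<lambda>t. (Y (t + 1) - Y t) / t) \<longlongrightarrow> rint - rint) at_top"
    unfolding diff_divide_distrib by (intro tendsto_diff Y tendsto_div_ident_shift[OF Y])
  ultimately have "1 + rint * \<mu> {-\<tau>..0} = rint - rint"
    by (rule tendsto_unique[OF trivial_limit_at_top_linorder])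
  then show ?thesis by simp
qed

lemma resolvent_integral_eq:
  assumes "integrable lborel r"
  shows "rint = - 1 / \<mu> {-\<tau>..0}"
  using resolvent_integral_times_mass[OF assms] by (cases "\<mu> {-\<tau>..0} = 0") (auto simp: field_simps)

text \<open>
  Since \<open>G\<close> is the derivative of \<open>1 * G\<close>, this is an integration by parts in which the derivative
  of \<open>r\<close> has been replaced by means of the resolvent equation.
\<close>

lemma conv_r_derivative:
  assumes G: "causal G"
  shows "conv r G t = conv one G t + conv r (D (conv one G)) t"
proof -
  have "conv one (D (conv r G)) = conv one (D (conv G r))" by (simp add: conv_commute)
  also have "\<dots> = conv (conv one (D G)) r"
    by (simp add: D_conv[OF G causal_r] conv_assoc[OF causal_one causal_D[OF G] causal_r])
  also have "\<dots> = conv r (D (conv one G))"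
    by (simp add: conv_one_D[OF G] conv_commute)
  finally show ?thesis using conv_r_solves[OF G] by simp
qed

end

section \<open>Uniform boundedness of window means\<close>

text \<open>
  Convergence for each single \<open>\<theta>\<close> gives a bound that depends on \<open>\<theta>\<close>. By Baire's theorem one bound
  serves a whole interval \<open>[\<alpha>, \<beta>]\<close> of window lengths. Subtracting the window of length \<open>\<alpha>\<close> gives
  a bound for all short windows, and chaining short windows gives one for all lengths up to \<open>1\<close>.
\<close>

lemma window_uniform_bound:
  fixes \<Phi> :: "real \<Rightarrow> real"
  assumes cont: "continuous_on UNIV \<Phi>"
    and lim: "\<And>\<theta>. \<theta> \<in> {0<..1} \<Longrightarrow> \<exists>l. ((\<lambda>t. (\<Phi> (t + \<theta>) - \<Phi> t) / t) \<longlongrightarrow> l) at_top"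
  shows "\<exists>A\<ge>0. \<forall>t\<ge>2. \<forall>v\<in>{0..1}. \<bar>\<Phi> (t + v) - \<Phi> t\<bar> \<le> A * t"
proof -
  define E where "E = (\<lambda>n::nat. {v\<in>{0..1::real}. \<forall>t\<ge>1. \<bar>\<Phi> (t + v) - \<Phi> t\<bar> \<le> real n * t})"
  have closedE: "closed (E n)" for n
  proof -
    have "E n = {0..1} \<inter> (\<Inter>t\<in>{1..}. {v. \<bar>\<Phi> (t + v) - \<Phi> t\<bar> \<le> real n * t})"
      by (auto simp: E_def)
    moreover have "closed {v. \<bar>\<Phi> (t + v) - \<Phi> t\<bar> \<le> real n * t}" for t
      by (intro closed_Collect_le continuous_intros continuous_on_compose2[OF cont]) auto
    ultimately show ?thesis by (simp add: closed_Int closed_INT)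
  qed
  have cover: "\<exists>n. v \<in> E n" if v: "v \<in> {0..1}" for v
  proof -
    have "\<exists>l. ((\<lambda>t. (\<Phi> (t + v) - \<Phi> t) / t) \<longlongrightarrow> l) at_top"
    proof (cases "v = 0")
      case True
      then show ?thesis by (intro exI[of _ 0]) simp
    qed (use lim v in auto)
    then obtain l where l: "((\<lambda>t. (\<Phi> (t + v) - \<Phi> t) / t) \<longlongrightarrow> l) at_top" ..
    have "\<forall>\<^sub>F t in at_top. \<bar>(\<Phi> (t + v) - \<Phi> t) / t\<bar> < \<bar>l\<bar> + 1"
      by (rule order_tendstoD(2)[OF tendsto_rabs[OF l]]) simp
    then obtain T where T: "\<And>t. t \<ge> T \<Longrightarrow> \<bar>(\<Phi> (t + v) - \<Phi> t) / t\<bar> < \<bar>l\<bar> + 1"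
      unfolding eventually_at_top_linorder by blast
    have "continuous_on {1..T} (\<lambda>t. (\<Phi> (t + v) - \<Phi> t) / t)"
      by (intro continuous_intros continuous_on_compose2[OF cont]) auto
    then have "bounded ((\<lambda>t. (\<Phi> (t + v) - \<Phi> t) / t) ` {1..T})"
      by (intro compact_imp_bounded compact_continuous_image) auto
    then obtain B where B: "\<And>t. t \<in> {1..T} \<Longrightarrow> \<bar>(\<Phi> (t + v) - \<Phi> t) / t\<bar> \<le> B"
      unfolding bounded_iff real_norm_def by blast
    obtain n :: nat where n: "max B (\<bar>l\<bar> + 1) \<le> n" using real_arch_simple by blast
    have "\<bar>\<Phi> (t + v) - \<Phi> t\<bar> \<le> real n * t" if t: "t \<ge> 1" for t
    proof -
      have "\<bar>(\<Phi> (t + v) - \<Phi> t) / t\<bar> \<le> n"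
        using T[of t] B[of t] n t by (cases "t \<le> T") auto
      then show ?thesis using t by (simp add: field_simps)
    qed
    then show ?thesis using v by (auto simp: E_def)
  qed
  have "\<exists>n. \<not> {0..1} \<subseteq> closure ({0..1} - E n)"
  proof (rule ccontr)
    assume "\<not> (\<exists>n. \<not> {0..1} \<subseteq> closure ({0..1} - E n))"
    then have "{0..1::real} \<subseteq> closure (\<Inter>(range (\<lambda>n. {0..1} - E n)))"
      using closedE by (intro Baire) (auto intro!: openin_diff closed_subset simp: E_def)
    moreover have "\<Inter>(range (\<lambda>n. {0..1} - E n)) = {}" using cover by fastforce
    ultimately have "{0..1::real} \<subseteq> closure {}" by (simp only:)
    then show False by simp
  qed
  then obtain n v0 where v0: "v0 \<in> {0..1}" "v0 \<notin> closure ({0..1} - E n)" by blast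
  have "open (- closure ({0..1} - E n))" by (rule open_Compl[OF closed_closure])
  moreover have "v0 \<in> - closure ({0..1} - E n)" using v0(2) by simp
  ultimately obtain e where e: "e > 0" "ball v0 e \<subseteq> - closure ({0..1} - E n)"
    by (rule openE)
  have "{0..1} - E n \<subseteq> closure ({0..1} - E n)" by (rule closure_subset)
  with e(2) have e2: "ball v0 e \<inter> ({0..1} - E n) = {}" by blast
  define \<alpha> \<beta> where "\<alpha> = max 0 (v0 - e / 2)" and "\<beta> = min 1 (v0 + e / 2)"
  have ab: "\<alpha> < \<beta>" "0 \<le> \<alpha>" "\<alpha> \<le> 1"
    using e v0 by (auto simp: \<alpha>_def \<beta>_def)
  have inE: "v \<in> E n" if "v \<in> {\<alpha>..\<beta>}" for v
  proof -
    have "v \<in> ball v0 e" using that e(1) by (auto simp: \<alpha>_def \<beta>_def dist_real_def)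
    moreover have "v \<in> {0..1}" using that by (auto simp: \<alpha>_def \<beta>_def)
    ultimately show ?thesis using e2 by blast
  qed
  define d where "d = \<beta> - \<alpha>"
  have d: "d > 0" using ab by (simp add: d_def)
  have small: "\<bar>\<Phi> (t + v) - \<Phi> t\<bar> \<le> 2 * real n * t" if "t \<ge> 2" "v \<in> {0..d}" for t v
  proof -
    have "\<alpha> + v \<in> E n" "\<alpha> \<in> E n" using that ab by (auto intro!: inE simp: d_def)
    moreover have "t - \<alpha> \<ge> 1" using that ab by simp
    ultimately have "\<bar>\<Phi> (t - \<alpha> + (\<alpha> + v)) - \<Phi> (t - \<alpha>)\<bar> \<le> real n * (t - \<alpha>)"
      "\<bar>\<Phi> (t - \<alpha> + \<alpha>) - \<Phi> (t - \<alpha>)\<bar> \<le> real n * (t - \<alpha>)"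
      unfolding E_def by blast+
    moreover have "real n * (t - \<alpha>) \<le> real n * t" using ab by (intro mult_left_mono) auto
    ultimately show ?thesis by simp
  qed
  have chain: "\<forall>t\<ge>2. \<forall>v\<in>{0..real k * d}. \<bar>\<Phi> (t + v) - \<Phi> t\<bar> \<le> 2 * real n * real k * (t + real k * d)" for k
  proof (induction k)
    case (Suc k)
    show ?case
    proof (intro allI impI ballI)
      fix t v :: real assume t: "t \<ge> 2" and v: "v \<in> {0..real (Suc k) * d}"
      have mono: "2 * real n * x \<le> 2 * real n * y" if "x \<le> y" for x y
        using that by (intro mult_left_mono) auto
      show "\<bar>\<Phi> (t + v) - \<Phi> t\<bar> \<le> 2 * real n * real (Suc k) * (t + real (Suc k) * d)"
      proof (cases "v \<le> d")
        case True
        have "t \<le> real (Suc k) * (t + real (Suc k) * d)"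
          using t d by (simp add: algebra_simps add_nonneg_nonneg)
        from small[OF t, of v] mono[OF this] show ?thesis using True v by (simp add: mult.assoc)
      next
        case False
        have "\<bar>\<Phi> (t + d + (v - d)) - \<Phi> (t + d)\<bar> \<le> 2 * real n * real k * (t + d + real k * d)"
          using t d v False by (intro Suc[rule_format]) (auto simp: algebra_simps)
        moreover have "\<bar>\<Phi> (t + d) - \<Phi> t\<bar> \<le> 2 * real n * t"
          using d t by (intro small) auto
        moreover have "2 * real n * real k * (t + d + real k * d) + 2 * real n * t
            \<le> 2 * real n * real (Suc k) * (t + real (Suc k) * d)"
          using d by (simp add: algebra_simps)
        ultimately show ?thesis by simp
      qed
    qed
  qed simp
  obtain k :: nat where k: "1 / d \<le> k" using real_arch_simple by blast
  then have kd: "1 \<le> real k * d" using d by (simp add: field_simps)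
  show ?thesis
  proof (intro exI[of _ "2 * real n * real k * (1 + real k * d)"] conjI allI impI ballI)
    fix t v :: real assume t: "t \<ge> 2" and v: "v \<in> {0..1}"
    have "\<bar>\<Phi> (t + v) - \<Phi> t\<bar> \<le> 2 * real n * real k * (t + real k * d)"
      using chain[of k] t v kd by auto
    also have "\<dots> \<le> 2 * real n * real k * ((1 + real k * d) * t)"
    proof (rule mult_left_mono)
      have "real k * d * 1 \<le> real k * d * t" using t d by (intro mult_left_mono) auto
      then show "t + real k * d \<le> (1 + real k * d) * t" by (simp add: algebra_simps)
    qed simp
    finally show "\<bar>\<Phi> (t + v) - \<Phi> t\<bar> \<le> 2 * real n * real k * (1 + real k * d) * t"
      by (simp add: mult.assoc)
  qed (use d in simp)
qed

section \<open>Cesaro means as growth rates of primitives\<close>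

lemma integral_shift_interval:
  fixes F :: "real \<Rightarrow> real"
  assumes "F integrable_on {a + c..b + c}"
  shows "integral {a..b} (\<lambda>s. F (s + c)) = integral {a + c..b + c} F"
proof -
  have "(F has_integral integral {a + c..b + c} F) (cbox (a + c) (b + c))"
    using assms by (simp add: integrable_integral)
  from has_integral_affinity'[OF this, of 1 c]
  have "((\<lambda>s. F (s + c)) has_integral integral {a + c..b + c} F) {a..b}" by simp
  then show ?thesis by (rule integral_unique)
qed

lemma L1_loc_cong:
  assumes "\<And>t. t \<ge> 0 \<Longrightarrow> f t = g t"
  shows "f \<in> L1_loc \<longleftrightarrow> g \<in> L1_loc"
proof -
  have "f absolutely_integrable_on {0..T} \<longleftrightarrow> g absolutely_integrable_on {0..T}" for T
    by (rule absolutely_integrable_spike_eq[of "{}"]) (use assms in auto)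
  then show ?thesis by (simp add: L1_loc_iff)
qed

lemma cesaro_mean_cong:
  assumes "\<And>t. t \<ge> 0 \<Longrightarrow> f t = g t"
  shows "cesaro_mean f = cesaro_mean g"
proof
  fix t
  have "(LINT s:{0..t}|lebesgue. f s) = (LINT s:{0..t}|lebesgue. g s)"
    unfolding set_lebesgue_integral_def
    by (rule Bochner_Integration.integral_cong) (use assms in \<open>auto simp: indicator_def\<close>)
  then show "cesaro_mean f t = cesaro_mean g t" by (simp add: cesaro_mean_def)
qed

lemma cesaro_mean_eq_primitive:
  assumes "f \<in> L1_loc" "t \<ge> 0"
  shows "cesaro_mean f t = primitive f t / t"
  using assms set_lebesgue_integral_eq_integral(2)[of "{0..t}" f]
  by (simp add: cesaro_mean_def primitive_def L1_loc_iff)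

lemma cesaro_mean_tendsto_iff:
  assumes "f \<in> L1_loc"
  shows "(cesaro_mean f \<longlongrightarrow> C) at_top \<longleftrightarrow> ((\<lambda>t. primitive f t / t) \<longlongrightarrow> C) at_top"
  by (rule tendsto_cong, rule eventually_mono[OF eventually_ge_at_top[of 0]])
    (simp add: cesaro_mean_eq_primitive[OF assms])

lemma window_integral_eq:
  assumes f: "f \<in> L1_loc" and "\<theta> \<ge> 0" "t \<ge> 0"
  shows "window_integral \<theta> f t = primitive f (t + \<theta>) - primitive f t"
proof -
  have "f absolutely_integrable_on {t..t + \<theta>}"
    using f assms unfolding L1_loc_def by auto
  then have "window_integral \<theta> f t = integral {t..t + \<theta>} f"
    by (simp add: window_integral_def set_lebesgue_integral_eq_integral(2))
  moreover have "integral {0..t} f + integral {t..t + \<theta>} f = integral {0..t + \<theta>} f"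
    using assms by (intro Henstock_Kurzweil_Integration.integral_combine L1_loc_integrable[OF f]) auto
  ultimately show ?thesis using assms by (simp add: primitive_def)
qed

lemma window_integral_L1_loc:
  assumes f: "f \<in> L1_loc" and \<theta>: "\<theta> \<ge> 0"
  shows "window_integral \<theta> f \<in> L1_loc"
proof -
  have "(\<lambda>t. primitive f (t + \<theta>) - primitive f t) absolutely_integrable_on {0..T}" for T
    using \<theta> by (intro absolutely_integrable_continuous_real continuous_on_diff
        continuous_on_compose2[OF primitive_continuous[OF f]] continuous_on_subset[OF primitive_continuous[OF f]])
      (auto intro!: continuous_intros)
  then have "(\<lambda>t. primitive f (t + \<theta>) - primitive f t) \<in> L1_loc" by (simp add: L1_loc_iff)
  then show ?thesis
    by (subst L1_loc_cong[OF window_integral_eq[OF f \<theta>]])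
qed

text \<open>
  The two sides differ by \<open>(1 * F) \<theta> / t\<close>, which tends to \<open>0\<close>.
\<close>

lemma cesaro_mean_window_tendsto_iff:
  assumes f: "f \<in> L1_loc" and \<theta>: "\<theta> \<ge> 0"
  shows "(cesaro_mean (window_integral \<theta> f) \<longlongrightarrow> l) at_top \<longleftrightarrow>
    ((\<lambda>t. (conv one (primitive f) (t + \<theta>) - conv one (primitive f) t) / t) \<longlongrightarrow> l) at_top"
proof -
  let ?F = "primitive f"
  note cF = causal_primitive[OF f]
  have "primitive (window_integral \<theta> f) t / t
      = (conv one ?F (t + \<theta>) - conv one ?F t) / t - conv one ?F \<theta> / t" if "t \<ge> 0" for t
  proof -
    have "primitive (window_integral \<theta> f) t = integral {0..t} (\<lambda>s. ?F (s + \<theta>) - ?F s)"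
      using that by (auto simp: primitive_def[of "window_integral \<theta> f"] window_integral_eq[OF f \<theta>] intro!: integral_cong)
    also have "\<dots> = integral {0..t} (\<lambda>s. ?F (s + \<theta>)) - integral {0..t} ?F"
    proof (rule integral_diff)
      show "(\<lambda>s. ?F (s + \<theta>)) integrable_on {0..t}"
        using \<theta> by (intro integrable_continuous_real continuous_on_compose2[OF primitive_continuous[OF f]])
          (auto intro!: continuous_intros)
    qed (rule causal_integrable_on[OF cF])
    also have "integral {0..t} (\<lambda>s. ?F (s + \<theta>)) = integral {\<theta>..t + \<theta>} ?F"
      using integral_shift_interval[of ?F 0 \<theta> t] causal_integrable_on[OF cF] by simp
    also have "\<dots> = conv one ?F (t + \<theta>) - conv one ?F \<theta>"
      using \<theta> that by (intro integral_causal_diff[OF cF, symmetric]) auto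
    finally show ?thesis by (simp add: conv_one_eq_integral[OF cF] diff_divide_distrib)
  qed
  then have ev: "\<forall>\<^sub>F t in at_top. primitive (window_integral \<theta> f) t / t
      = (conv one ?F (t + \<theta>) - conv one ?F t) / t - conv one ?F \<theta> / t"
    by (intro eventually_mono[OF eventually_ge_at_top[of 0]])
  have z: "((\<lambda>t. conv one ?F \<theta> / t) \<longlongrightarrow> 0) at_top" by (rule const_div_ident_tendsto_0)
  have "((\<lambda>t. (conv one ?F (t + \<theta>) - conv one ?F t) / t - conv one ?F \<theta> / t) \<longlongrightarrow> l) at_top
     \<longleftrightarrow> ((\<lambda>t. (conv one ?F (t + \<theta>) - conv one ?F t) / t) \<longlongrightarrow> l) at_top"
    (is "(?g \<longlongrightarrow> l) at_top \<longleftrightarrow> (?h \<longlongrightarrow> l) at_top")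
  proof
    assume "(?g \<longlongrightarrow> l) at_top"
    from tendsto_add[OF this z] show "(?h \<longlongrightarrow> l) at_top" by simp
  next
    assume "(?h \<longlongrightarrow> l) at_top"
    from tendsto_diff[OF this z] show "(?g \<longlongrightarrow> l) at_top" by simp
  qed
  then show ?thesis
    using cesaro_mean_tendsto_iff[OF window_integral_L1_loc[OF assms]] tendsto_cong[OF ev] by simp
qed

context delay_equation
begin

section \<open>From window limits to the limit of the resolvent convolution\<close>

text \<open>
  With \<open>k\<close> the indicator of \<open>[0, 1]\<close>, split \<open>F = u + G\<close> where \<open>u = k * F\<close>. The window limit for
  \<open>\<theta> = 1\<close> is the growth rate of \<open>u\<close>. The primitive \<open>V\<close> of \<open>G\<close> is the average over \<open>v \<in> [0, 1]\<close> of
  the windows of length \<open>v\<close>, so \<open>V t / t\<close> converges to some \<open>K\<close>, and \<open>K\<close> cancels in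
  \<open>r * G = V + r * D V\<close>. That the window limit is linear in \<open>\<theta>\<close> follows too: windows of \<open>F\<close> and of
  \<open>u\<close> differ by \<open>V (t + \<theta>) - V t\<close>, which is \<open>o(t)\<close>.
\<close>

lemma conv_r_tendsto_of_windows:
  assumes rint: "integrable lborel r" and F: "causal F"
    and win: "\<And>\<theta>. \<theta> \<in> {0<..1} \<Longrightarrow> \<exists>l. ((\<lambda>t. (conv one F (t + \<theta>) - conv one F t) / t) \<longlongrightarrow> l) at_top"
  shows "\<exists>C. ((\<lambda>t. conv r F t / t) \<longlongrightarrow> C * rint) at_top \<and>
     (\<forall>\<theta>\<in>{0<..1}. ((\<lambda>t. (conv one F (t + \<theta>) - conv one F t) / t) \<longlongrightarrow> C * \<theta>) at_top)"
proof -
  define \<Phi> where "\<Phi> = conv one F"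
  define k where "k = (indicator {0..1} :: real \<Rightarrow> real)"
  define u where "u = conv k F"
  define G where "G = (\<lambda>t. F t - u t)"
  define V where "V = conv one G"
  have k: "causal k" "integrable lborel k"
    unfolding k_def by (auto intro: causal_indicator integrable_indicator_lborel)
  have ck: "(LINT s|lborel. k s) = 1" by (simp add: k_def)
  have \<Phi>: "causal \<Phi>" "continuous_on UNIV \<Phi>"
    unfolding \<Phi>_def by (auto intro: causal_conv causal_one F conv_one_continuous)
  have cu: "causal u" unfolding u_def by (intro causal_conv k F)
  have cG: "causal G" unfolding G_def by (intro causal_diff F cu)
  have cV: "causal V" unfolding V_def by (intro causal_conv causal_one cG)
  obtain c where c0: "\<And>\<theta>. \<theta> \<in> {0<..1} \<Longrightarrow> ((\<lambda>t. (\<Phi> (t + \<theta>) - \<Phi> t) / t) \<longlongrightarrow> c \<theta>) at_top"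
    using win unfolding \<Phi>_def by metis
  define c' where "c' = (\<lambda>v. if v = 0 then 0 else c v)"
  have c: "((\<lambda>t. (\<Phi> t - \<Phi> (t - v)) / t) \<longlongrightarrow> c' v) at_top" if v: "v \<in> {0..1}" for v
  proof (cases "v = 0")
    case False
    then have "v \<in> {0<..1}" using v by auto
    from tendsto_div_ident_shift[OF c0[OF this], of "- v"] show ?thesis using False by (simp add: c'_def)
  qed (simp add: c'_def)
  obtain A where A: "A \<ge> 0" "\<And>t v. \<lbrakk>t \<ge> 2; v \<in> {0..1}\<rbrakk> \<Longrightarrow> \<bar>\<Phi> (t + v) - \<Phi> t\<bar> \<le> A * t"
    using window_uniform_bound[OF \<Phi>(2)] c0 by meson
  have Veq: "V t = (LINT v|lborel. (\<Phi> t - \<Phi> (t - v)) * k v)" for t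
  proof -
    have "conv one u = conv k \<Phi>"
      unfolding u_def \<Phi>_def
      by (simp add: conv_assoc[symmetric] k F causal_one conv_commute[of k one])
    then have "V t = \<Phi> t - conv \<Phi> k t"
      using conv_diff_right[OF F cu causal_one] by (simp add: V_def G_def \<Phi>_def conv_commute)
    also have "\<Phi> t = (LINT v|lborel. \<Phi> t * k v)" using ck by simp
    also have "\<dots> - conv \<Phi> k t = (LINT v|lborel. \<Phi> t * k v - \<Phi> (t - v) * k v)"
      unfolding conv_def
      by (rule Bochner_Integration.integral_diff[symmetric]) (use k conv_integrable[OF \<Phi>(1) k(1)] in auto)
    finally show ?thesis by (simp add: left_diff_distrib)
  qed
  have lim_k: "((\<lambda>t. (\<Phi> t - \<Phi> (t - v)) / t * k v) \<longlongrightarrow> c' v * k v) at_top" for v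
    using tendsto_mult_right[OF c, of v "k v"] by (cases "v \<in> {0..1}") (auto simp: k_def)
  note [measurable] = causal_measurable[OF \<Phi>(1)] causal_measurable[OF k(1)]
  define K where "K = (LINT v|lborel. c' v * k v)"
  have VK: "((\<lambda>t. V t / t) \<longlongrightarrow> K) at_top"
  proof -
    have "((\<lambda>t. LINT v|lborel. (\<Phi> t - \<Phi> (t - v)) / t * k v) \<longlongrightarrow> K) at_top"
      unfolding K_def
    proof (rule integral_dominated_convergence_at_top[where w = "\<lambda>v. A * k v"])
      show "(\<lambda>v. c' v * k v) \<in> borel_measurable lborel"
      proof (rule borel_measurable_LIMSEQ_real)
        show "(\<lambda>n. (\<Phi> (real n) - \<Phi> (real n - v)) / real n * k v) \<longlonglongrightarrow> c' v * k v" for v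
          by (rule filterlim_compose[OF lim_k filterlim_real_sequentially])
      qed measurable
      show "AE v in lborel. ((\<lambda>t. (\<Phi> t - \<Phi> (t - v)) / t * k v) \<longlongrightarrow> c' v * k v) at_top"
        using lim_k by simp
      show "\<forall>\<^sub>F t in at_top. AE v in lborel. norm ((\<Phi> t - \<Phi> (t - v)) / t * k v) \<le> A * k v"
        using eventually_ge_at_top[of 3]
      proof eventually_elim
        fix t :: real assume t: "t \<ge> 3"
        have "norm ((\<Phi> t - \<Phi> (t - v)) / t * k v) \<le> A * k v" for v
        proof (cases "v \<in> {0..1}")
          case True
          then have "\<bar>\<Phi> t - \<Phi> (t - v)\<bar> \<le> A * (t - v)" using A(2)[of "t - v" v] t by simp
          also have "\<dots> \<le> A * t" using True A(1) by (intro mult_left_mono) auto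
          finally show ?thesis using True t by (simp add: k_def field_simps)
        qed (simp add: k_def)
        then show "AE v in lborel. norm ((\<Phi> t - \<Phi> (t - v)) / t * k v) \<le> A * k v" by simp
      qed
    qed (use k in \<open>auto intro: integrable_mult_right\<close>)
    moreover have "V t / t = (LINT v|lborel. (\<Phi> t - \<Phi> (t - v)) / t * k v)" for t
      unfolding Veq by (simp flip: Bochner_Integration.integral_divide_zero)
    ultimately show ?thesis by (simp del: times_divide_eq_left)
  qed
  have uC: "((\<lambda>t. u t / t) \<longlongrightarrow> c 1) at_top"
  proof (rule Lim_transform_eventually)
    show "((\<lambda>t. (\<Phi> t - \<Phi> (t - 1)) / t) \<longlongrightarrow> c 1) at_top"
      using c[of 1] by (simp add: c'_def)
    show "\<forall>\<^sub>F t in at_top. (\<Phi> t - \<Phi> (t - 1)) / t = u t / t"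
      using eventually_ge_at_top[of 1]
      by eventually_elim (simp add: u_def k_def \<Phi>_def conv_indicator[OF F])
  qed
  have "((\<lambda>t. conv r G t / t) \<longlongrightarrow> 0) at_top"
  proof -
    have "((\<lambda>t. conv r (D V) t / t) \<longlongrightarrow> K * \<mu> {-\<tau>..0} * rint) at_top"
      by (intro conv_tendsto_div_ident[OF causal_r rint] causal_D cV D_tendsto_div_ident VK)
    then have "((\<lambda>t. V t / t + conv r (D V) t / t) \<longlongrightarrow> K + K * \<mu> {-\<tau>..0} * rint) at_top"
      by (intro tendsto_add VK)
    moreover have "K + K * \<mu> {-\<tau>..0} * rint = 0"
      using resolvent_integral_times_mass[OF rint] by (simp add: mult.assoc mult.commute[of "\<mu> {-\<tau>..0}"])
    moreover have "conv r G t / t = V t / t + conv r (D V) t / t" for t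
      using conv_r_derivative[OF cG, of t] by (simp add: V_def add_divide_distrib)
    ultimately show ?thesis by simp
  qed
  then have "((\<lambda>t. conv r u t / t + conv r G t / t) \<longlongrightarrow> c 1 * rint + 0) at_top"
    by (intro tendsto_add conv_tendsto_div_ident[OF causal_r rint cu uC])
  moreover have "conv r u t / t + conv r G t / t = conv r F t / t" for t
    using conv_diff_right[OF F cu causal_r] by (simp add: G_def diff_divide_distrib)
  ultimately have 1: "((\<lambda>t. conv r F t / t) \<longlongrightarrow> c 1 * rint) at_top" by simp
  have 2: "((\<lambda>t. (\<Phi> (t + \<theta>) - \<Phi> t) / t) \<longlongrightarrow> c 1 * \<theta>) at_top" if \<theta>: "\<theta> \<in> {0<..1}" for \<theta>
  proof -
    have "((\<lambda>t. (conv one u (t + \<theta>) - conv one u t) / t + (V (t + \<theta>) / t - V t / t)) \<longlongrightarrow> c 1 * \<theta> + (K - K)) at_top"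
      using \<theta> by (intro tendsto_add tendsto_diff VK tendsto_div_ident_shift[OF VK] window_tendsto_div_ident[OF cu uC]) auto
    moreover have "(conv one u (t + \<theta>) - conv one u t) / t + (V (t + \<theta>) / t - V t / t) = (\<Phi> (t + \<theta>) - \<Phi> t) / t" for t
      using conv_diff_right[OF F cu causal_one]
      by (simp add: V_def G_def \<Phi>_def diff_divide_distrib)
    ultimately show ?thesis by simp
  qed
  show ?thesis using 1 2 unfolding \<Phi>_def by blast
qed

text \<open>
  Integrate \<open>H = y - D (1 * y)\<close> over a window; the increments of \<open>1 * y\<close> are \<open>o(t)\<close>.
\<close>

lemma windows_tendsto_of_solution:
  assumes y: "causal y" and H: "causal H" and eq: "\<And>t. y t = H t + conv one (D y) t"
    and L: "((\<lambda>t. conv one y t / t) \<longlongrightarrow> L) at_top" and \<theta>: "\<theta> \<ge> 0"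
  shows "((\<lambda>t. (conv one H (t + \<theta>) - conv one H t) / t) \<longlongrightarrow> - L * \<mu> {-\<tau>..0} * \<theta>) at_top"
proof -
  define Y where "Y = conv one y"
  have cY: "causal Y" unfolding Y_def by (intro causal_conv causal_one y)
  have L': "((\<lambda>t. Y t / t) \<longlongrightarrow> L) at_top" using L by (simp add: Y_def)
  have "H = (\<lambda>t. y t - D Y t)"
    using eq by (simp add: Y_def conv_one_D[OF y])
  then have H1: "conv one H = (\<lambda>t. Y t - conv one (D Y) t)"
    using conv_diff_right[OF y causal_D[OF cY] causal_one] by (simp add: Y_def)
  have "((\<lambda>t. (Y (t + \<theta>) / t - Y t / t) - (conv one (D Y) (t + \<theta>) - conv one (D Y) t) / t)
      \<longlongrightarrow> (L - L) - L * \<mu> {-\<tau>..0} * \<theta>) at_top"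
    by (intro tendsto_diff L' tendsto_div_ident_shift[OF L']
        window_tendsto_div_ident[OF causal_D[OF cY] D_tendsto_div_ident[OF cY L'] \<theta>])
  moreover have "(Y (t + \<theta>) / t - Y t / t) - (conv one (D Y) (t + \<theta>) - conv one (D Y) t) / t
      = (conv one H (t + \<theta>) - conv one H t) / t" for t
    by (simp add: H1 diff_divide_distrib)
  ultimately show ?thesis by simp
qed

end

section \<open>Integrable resolvents\<close>

lemma Ces_iff: "f \<in> Ces \<longleftrightarrow> f \<in> L1_loc \<and> (\<exists>C. (cesaro_mean f \<longlongrightarrow> C) at_top)"
  by (simp add: Ces_def)

lemma Ces_imp_window_Ces:
  assumes "f \<in> Ces" "\<theta> \<ge> 0"
  shows "window_integral \<theta> f \<in> Ces"
proof -
  from assms have f: "f \<in> L1_loc" by (simp add: Ces_iff)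
  obtain C where "(cesaro_mean f \<longlongrightarrow> C) at_top" using assms(1) by (auto simp: Ces_iff)
  then have "((\<lambda>t. primitive f t / t) \<longlongrightarrow> C) at_top" by (simp add: cesaro_mean_tendsto_iff[OF f])
  from window_tendsto_div_ident[OF causal_primitive[OF f] this assms(2)]
  have "(cesaro_mean (window_integral \<theta> f) \<longlongrightarrow> C * \<theta>) at_top"
    by (simp add: cesaro_mean_window_tendsto_iff[OF f assms(2)])
  then show ?thesis using window_integral_L1_loc[OF f assms(2)] by (auto simp: Ces_iff)
qed

context delay_equation
begin

lemma solution_volterra_form:
  assumes \<psi>: "continuous_on {-\<tau>..0} \<psi>" and f: "f \<in> L1_loc"
  shows "\<exists>y. causal y \<and> (\<forall>t. y t = (primitive f t + initial_data \<psi> t) + conv one (D y) t)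
    \<and> (\<forall>t\<ge>0. solution \<tau> \<mu> f \<psi> t = y t)
    \<and> (\<forall>L. (cesaro_mean (solution \<tau> \<mu> f \<psi>) \<longlongrightarrow> L) at_top \<longleftrightarrow> ((\<lambda>t. conv one y t / t) \<longlongrightarrow> L) at_top)"
proof -
  obtain y where y: "causal y" "\<forall>t. y t = (primitive f t + initial_data \<psi> t) + conv one (D y) t"
     "solution \<tau> \<mu> f \<psi> = (\<lambda>t. y t + history \<psi> t)"
    using solution_volterra(1)[OF assms] by blast
  have eq: "solution \<tau> \<mu> f \<psi> t = y t" if "t \<ge> 0" for t
    using that by (simp add: y(3) history_def)
  have "(cesaro_mean (solution \<tau> \<mu> f \<psi>) \<longlongrightarrow> L) at_top \<longleftrightarrow> ((\<lambda>t. conv one y t / t) \<longlongrightarrow> L) at_top" for L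
    using cesaro_mean_cong[OF eq] cesaro_mean_tendsto_iff[OF causal_L1_loc[OF y(1)]]
    by (simp add: primitive_causal[OF y(1)])
  with y(1,2) eq show ?thesis by blast
qed

lemma initial_data_div_ident_tendsto_0:
  assumes "continuous_on {-\<tau>..0} \<psi>"
  shows "((\<lambda>t. initial_data \<psi> t / t) \<longlongrightarrow> 0) at_top"
  using bounded_initial_data[OF assms] bounded_div_ident_tendsto_0 by blast

lemma causal_data:
  assumes "continuous_on {-\<tau>..0} \<psi>" "f \<in> L1_loc"
  shows "causal (\<lambda>t. primitive f t + initial_data \<psi> t)"
  by (intro causal_add causal_primitive causal_initial_data assms)

lemma solution_L1_loc:
  assumes "continuous_on {-\<tau>..0} \<psi>" "f \<in> L1_loc"
  shows "solution \<tau> \<mu> f \<psi> \<in> L1_loc"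
proof -
  obtain y where y: "causal y" "\<forall>t\<ge>0. solution \<tau> \<mu> f \<psi> t = y t"
    using solution_volterra_form[OF assms] by blast
  then show ?thesis using L1_loc_cong[of "solution \<tau> \<mu> f \<psi>" y] causal_L1_loc[OF y(1)] by blast
qed

lemma solution_cesaro_iff:
  assumes \<psi>: "continuous_on {-\<tau>..0} \<psi>" and f: "f \<in> L1_loc"
  shows "(cesaro_mean (solution \<tau> \<mu> f \<psi>) \<longlongrightarrow> L) at_top \<longleftrightarrow>
    ((\<lambda>t. conv r (\<lambda>t. primitive f t + initial_data \<psi> t) t / t) \<longlongrightarrow> L) at_top"
proof -
  obtain y where y: "causal y" "\<And>t. y t = (primitive f t + initial_data \<psi> t) + conv one (D y) t"
    "\<And>L. (cesaro_mean (solution \<tau> \<mu> f \<psi>) \<longlongrightarrow> L) at_top \<longleftrightarrow> ((\<lambda>t. conv one y t / t) \<longlongrightarrow> L) at_top"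
    using solution_volterra_form[OF assms] by blast
  have "conv one y = conv r (\<lambda>t. primitive f t + initial_data \<psi> t)"
    by (rule volterra_solution_unique_integrated[OF y(1) causal_data[OF assms] y(2)])
  then show ?thesis by (simp add: y(3))
qed

text \<open>
  The initial data drop out, since they contribute a bounded term to \<open>H\<close>.
\<close>

lemma solution_cesaro_iff_integrable:
  assumes \<psi>: "continuous_on {-\<tau>..0} \<psi>" and f: "f \<in> L1_loc" and rint: "integrable lborel r"
  shows "(cesaro_mean (solution \<tau> \<mu> f \<psi>) \<longlongrightarrow> L) at_top \<longleftrightarrow>
    ((\<lambda>t. conv r (primitive f) t / t) \<longlongrightarrow> L) at_top"
proof -
  have z: "((\<lambda>t. conv r (initial_data \<psi>) t / t) \<longlongrightarrow> 0) at_top"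
    using conv_tendsto_div_ident[OF causal_r rint causal_initial_data[OF \<psi>] initial_data_div_ident_tendsto_0[OF \<psi>]] by simp
  have eq: "conv r (\<lambda>t. primitive f t + initial_data \<psi> t) t / t
      = conv r (primitive f) t / t + conv r (initial_data \<psi>) t / t" for t
    using conv_add_right[OF causal_primitive[OF f] causal_initial_data[OF \<psi>] causal_r]
    by (simp add: add_divide_distrib)
  show ?thesis
    unfolding solution_cesaro_iff[OF \<psi> f] eq
  proof
    assume "((\<lambda>t. conv r (primitive f) t / t + conv r (initial_data \<psi>) t / t) \<longlongrightarrow> L) at_top"
    from tendsto_diff[OF this z] show "((\<lambda>t. conv r (primitive f) t / t) \<longlongrightarrow> L) at_top" by simp
  next
    assume "((\<lambda>t. conv r (primitive f) t / t) \<longlongrightarrow> L) at_top"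
    from tendsto_add[OF this z]
    show "((\<lambda>t. conv r (primitive f) t / t + conv r (initial_data \<psi>) t / t) \<longlongrightarrow> L) at_top" by simp
  qed
qed

lemma solution_Ces_imp_window_Ces:
  assumes \<psi>: "continuous_on {-\<tau>..0} \<psi>" and f: "f \<in> L1_loc"
    and x: "solution \<tau> \<mu> f \<psi> \<in> Ces" and \<theta>: "\<theta> \<ge> 0"
  shows "window_integral \<theta> f \<in> Ces"
proof -
  let ?F = "primitive f" and ?b = "initial_data \<psi>"
  obtain L where L: "(cesaro_mean (solution \<tau> \<mu> f \<psi>) \<longlongrightarrow> L) at_top" using x by (auto simp: Ces_iff)
  obtain y where y: "causal y" "\<And>t. y t = (?F t + ?b t) + conv one (D y) t"
    "((\<lambda>t. conv one y t / t) \<longlongrightarrow> L) at_top"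
    using solution_volterra_form[OF \<psi> f] L by blast
  note H = windows_tendsto_of_solution[OF y(1) causal_data[OF \<psi> f] y(2,3) \<theta>]
  note b = window_tendsto_div_ident[OF causal_initial_data[OF \<psi>] initial_data_div_ident_tendsto_0[OF \<psi>] \<theta>]
  have "(conv one (\<lambda>t. ?F t + ?b t) (t + \<theta>) - conv one (\<lambda>t. ?F t + ?b t) t) / t
      - (conv one ?b (t + \<theta>) - conv one ?b t) / t = (conv one ?F (t + \<theta>) - conv one ?F t) / t" for t
    using conv_add_right[OF causal_primitive[OF f] causal_initial_data[OF \<psi>] causal_one]
    by (simp add: diff_divide_distrib add_divide_distrib)
  with tendsto_diff[OF H b]
  have "((\<lambda>t. (conv one ?F (t + \<theta>) - conv one ?F t) / t) \<longlongrightarrow> - L * \<mu> {-\<tau>..0} * \<theta>) at_top"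
    by simp
  then have "(cesaro_mean (window_integral \<theta> f) \<longlongrightarrow> - L * \<mu> {-\<tau>..0} * \<theta>) at_top"
    by (simp only: cesaro_mean_window_tendsto_iff[OF f \<theta>])
  then show ?thesis using window_integral_L1_loc[OF f \<theta>] by (auto simp: Ces_iff)
qed

lemma window_Ces_imp_solution_limit:
  assumes \<psi>: "continuous_on {-\<tau>..0} \<psi>" and f: "f \<in> L1_loc" and rint: "integrable lborel r"
    and win: "\<forall>\<theta>\<in>{0<..1}. window_integral \<theta> f \<in> Ces"
  shows "\<exists>C. (\<forall>\<theta>\<in>{0<..1}. (cesaro_mean (window_integral \<theta> f) \<longlongrightarrow> C * \<theta>) at_top) \<and>
                  (cesaro_mean (solution \<tau> \<mu> f \<psi>) \<longlongrightarrow> - C / \<mu> {-\<tau>..0}) at_top"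
proof -
  have "\<exists>l. ((\<lambda>t. (conv one (primitive f) (t + \<theta>) - conv one (primitive f) t) / t) \<longlongrightarrow> l) at_top"
    if "\<theta> \<in> {0<..1}" for \<theta>
  proof -
    have "window_integral \<theta> f \<in> Ces" using win that by blast
    then obtain l where "(cesaro_mean (window_integral \<theta> f) \<longlongrightarrow> l) at_top" by (auto simp: Ces_iff)
    then show ?thesis using cesaro_mean_window_tendsto_iff[OF f, of \<theta> l] that by auto
  qed
  from conv_r_tendsto_of_windows[OF rint causal_primitive[OF f] this]
  obtain C where C: "((\<lambda>t. conv r (primitive f) t / t) \<longlongrightarrow> C * rint) at_top"
    "\<And>\<theta>. \<theta> \<in> {0<..1} \<Longrightarrow> ((\<lambda>t. (conv one (primitive f) (t + \<theta>) - conv one (primitive f) t) / t) \<longlongrightarrow> C * \<theta>) at_top"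
    by blast
  show ?thesis
  proof (intro exI[of _ C] conjI ballI)
    show "(cesaro_mean (window_integral \<theta> f) \<longlongrightarrow> C * \<theta>) at_top" if "\<theta> \<in> {0<..1}" for \<theta>
      using C(2)[OF that] cesaro_mean_window_tendsto_iff[OF f, of \<theta>] that by simp
    show "(cesaro_mean (solution \<tau> \<mu> f \<psi>) \<longlongrightarrow> - C / \<mu> {-\<tau>..0}) at_top"
      using C(1) solution_cesaro_iff_integrable[OF \<psi> f rint] resolvent_integral_eq[OF rint] by simp
  qed
qed

lemma deriv_solution:
  assumes \<psi>: "continuous_on {-\<tau>..0} \<psi>" and f: "f \<in> L1_loc"
  defines "x \<equiv> solution \<tau> \<mu> f \<psi>"
  shows "deriv x \<in> L1_loc" "t \<ge> 0 \<Longrightarrow> cesaro_mean (deriv x) t = (x t - x 0) / t"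
proof -
  define g where "g = (\<lambda>t. D x t + f t)"
  obtain y where y: "causal y" "x = (\<lambda>t. y t + history \<psi> t)"
    using solution_volterra(1)[OF \<psi> f] unfolding x_def by blast
  have sol: "locally_absolutely_continuous x" "AE t in lebesgue. t > 0 \<longrightarrow> (x has_real_derivative g t) (at t)"
    using solution_volterra(2)[OF \<psi> f] unfolding is_solution_def x_def g_def by blast+
  have "(\<lambda>t. (D y t + history_forcing \<psi> t) + f t) \<in> L1_loc"
    by (rule causal_add_L1_loc[OF causal_add[OF causal_D[OF y(1)] causal_history_forcing[OF \<psi>]] f])
  moreover have "g t = (D y t + history_forcing \<psi> t) + f t" if "t \<ge> 0" for t
    unfolding g_def y(2) D_plus_history[OF \<psi> y(1)] using that by (simp add: history_forcing_def)
  ultimately have g: "g \<in> L1_loc"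
    using L1_loc_cong[of g "\<lambda>t. (D y t + history_forcing \<psi> t) + f t"] by simp
  have xg: "\<And>t. t \<ge> 0 \<Longrightarrow> x t = x 0 + integral {0..t} g"
    using locally_absolutely_continuous_iff_integral[OF g, of x] sol by blast
  from sol(2) obtain N where "N \<in> null_sets lebesgue"
    and Nsub: "{s \<in> space lebesgue. \<not> (s > 0 \<longrightarrow> (x has_real_derivative g s) (at s))} \<subseteq> N"
    unfolding eventually_ae_filter by blast
  then have N: "negligible (insert 0 N)" by (simp add: negligible_iff_null_sets[symmetric])
  have eq: "deriv x s = g s" if "s \<in> {0..T} - insert 0 N" for s T
  proof -
    have "s \<notin> {s \<in> space lebesgue. \<not> (s > 0 \<longrightarrow> (x has_real_derivative g s) (at s))}"
      using that Nsub by (meson DiffD2 contra_subsetD insertCI)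
    then have "(x has_real_derivative g s) (at s)" using that by simp
    then show ?thesis by (rule DERIV_imp_deriv)
  qed
  show dx: "deriv x \<in> L1_loc"
    unfolding L1_loc_iff
  proof (intro allI impI)
    show "deriv x absolutely_integrable_on {0..T}" if "T \<ge> 0" for T
      by (rule absolutely_integrable_spike[OF _ N eq[of _ T]]) (use g that in \<open>simp_all add: L1_loc_iff\<close>)
  qed
  show "cesaro_mean (deriv x) t = (x t - x 0) / t" if "t \<ge> 0"
  proof -
    have "integral {0..t} g = integral {0..t} (deriv x)"
      by (rule integral_spike[OF N eq])
    then show ?thesis
      using xg[OF that] that by (simp add: cesaro_mean_eq_primitive[OF dx that] primitive_def)
  qed
qed

text \<open>
  The mean of the derivative is \<open>(x t - x 0) / t\<close>. By the integrated equation its limit is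
  \<open>C + C \<mu> [-\<tau>, 0] \<integral> r\<close>, which is \<open>0\<close>.
\<close>

lemma Ces_imp_solution_limits:
  assumes \<psi>: "continuous_on {-\<tau>..0} \<psi>" and f: "f \<in> Ces" and rint: "integrable lborel r"
  shows "\<exists>C. (cesaro_mean f \<longlongrightarrow> C) at_top \<and>
      (cesaro_mean (solution \<tau> \<mu> f \<psi>) \<longlongrightarrow> - C / \<mu> {-\<tau>..0}) at_top \<and>
      (cesaro_mean (deriv (solution \<tau> \<mu> f \<psi>)) \<longlongrightarrow> 0) at_top"
proof -
  let ?x = "solution \<tau> \<mu> f \<psi>" and ?b = "initial_data \<psi>"
  have f1: "f \<in> L1_loc" using f by (simp add: Ces_iff)
  obtain C where C: "(cesaro_mean f \<longlongrightarrow> C) at_top" using f by (auto simp: Ces_iff)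
  then have FC: "((\<lambda>t. primitive f t / t) \<longlongrightarrow> C) at_top" by (simp add: cesaro_mean_tendsto_iff[OF f1])
  from conv_tendsto_div_ident[OF causal_r rint causal_primitive[OF f1] this]
  have xC: "(cesaro_mean ?x \<longlongrightarrow> C * rint) at_top"
    by (simp add: solution_cesaro_iff_integrable[OF \<psi> f1 rint])
  obtain y where y: "causal y" "\<And>t. y t = (primitive f t + ?b t) + conv one (D y) t"
    "\<And>t. t \<ge> 0 \<Longrightarrow> ?x t = y t" and YC: "((\<lambda>t. conv one y t / t) \<longlongrightarrow> C * rint) at_top"
    using solution_volterra_form[OF \<psi> f1] xC by blast
  note b = initial_data_div_ident_tendsto_0[OF \<psi>]
  have "((\<lambda>t. primitive f t / t + ?b t / t + D (conv one y) t / t) \<longlongrightarrow> C + 0 + C * rint * \<mu> {-\<tau>..0}) at_top"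
    by (intro tendsto_add FC b D_tendsto_div_ident causal_conv causal_one y(1) YC)
  moreover have "C + 0 + C * rint * \<mu> {-\<tau>..0} = 0"
    using resolvent_integral_times_mass[OF rint] by (simp add: mult.assoc)
  moreover have "primitive f t / t + ?b t / t + D (conv one y) t / t = y t / t" for t
    by (subst y(2)) (simp add: conv_one_D[OF y(1)] add_divide_distrib)
  ultimately have y0: "((\<lambda>t. y t / t) \<longlongrightarrow> 0) at_top" by simp
  have "((\<lambda>t. ?x 0 / t) \<longlongrightarrow> 0) at_top"
    by (rule const_div_ident_tendsto_0)
  from tendsto_diff[OF y0 this] have "((\<lambda>t. y t / t - ?x 0 / t) \<longlongrightarrow> 0) at_top" by simp
  moreover have "\<forall>\<^sub>F t in at_top. y t / t - ?x 0 / t = cesaro_mean (deriv ?x) t"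
    by (rule eventually_mono[OF eventually_ge_at_top[of 0]])
      (simp add: deriv_solution(2)[OF \<psi> f1] y(3) diff_divide_distrib)
  ultimately have "(cesaro_mean (deriv ?x) \<longlongrightarrow> 0) at_top" by (rule Lim_transform_eventually)
  then show ?thesis using C xC resolvent_integral_eq[OF rint] by (intro exI[of _ C]) simp
qed

text \<open>
  Solve the integrated equation for the primitive of \<open>f\<close>.
\<close>

lemma solution_Ces_imp_Ces:
  assumes \<psi>: "continuous_on {-\<tau>..0} \<psi>" and f: "f \<in> L1_loc"
    and x: "solution \<tau> \<mu> f \<psi> \<in> Ces" and x': "deriv (solution \<tau> \<mu> f \<psi>) \<in> Ces"
  shows "f \<in> Ces"
proof -
  let ?x = "solution \<tau> \<mu> f \<psi>" and ?b = "initial_data \<psi>"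
  obtain L where L: "(cesaro_mean ?x \<longlongrightarrow> L) at_top" using x by (auto simp: Ces_iff)
  obtain L' where L': "(cesaro_mean (deriv ?x) \<longlongrightarrow> L') at_top" using x' by (auto simp: Ces_iff)
  obtain y where y: "causal y" "\<And>t. y t = (primitive f t + ?b t) + conv one (D y) t"
    "\<And>t. t \<ge> 0 \<Longrightarrow> ?x t = y t" and YL: "((\<lambda>t. conv one y t / t) \<longlongrightarrow> L) at_top"
    using solution_volterra_form[OF \<psi> f] L by blast
  have x0: "((\<lambda>t. ?x 0 / t) \<longlongrightarrow> 0) at_top"
    by (rule const_div_ident_tendsto_0)
  have "\<forall>\<^sub>F t in at_top. cesaro_mean (deriv ?x) t + ?x 0 / t = y t / t"
    by (rule eventually_mono[OF eventually_ge_at_top[of 0]])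
      (simp add: deriv_solution(2)[OF \<psi> f] y(3) diff_divide_distrib)
  from Lim_transform_eventually[OF tendsto_add[OF L' x0] this]
  have yL: "((\<lambda>t. y t / t) \<longlongrightarrow> L') at_top" by simp
  note b = initial_data_div_ident_tendsto_0[OF \<psi>]
  have "((\<lambda>t. y t / t - ?b t / t - D (conv one y) t / t) \<longlongrightarrow> L' - 0 - L * \<mu> {-\<tau>..0}) at_top"
    by (intro tendsto_diff yL b D_tendsto_div_ident causal_conv causal_one y(1) YL)
  moreover have "y t / t - ?b t / t - D (conv one y) t / t = primitive f t / t" for t
    by (subst y(2)) (simp add: conv_one_D[OF y(1)] add_divide_distrib)
  ultimately have "((\<lambda>t. primitive f t / t) \<longlongrightarrow> L' - 0 - L * \<mu> {-\<tau>..0}) at_top" by simp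
  then show ?thesis using f cesaro_mean_tendsto_iff[OF f] by (auto simp: Ces_iff)
qed

end

section \<open>A gliding hump for resolvents that are not integrable\<close>

lemma conv_cong_le:
  assumes "causal a" "\<And>s. s \<le> t \<Longrightarrow> b s = c s"
  shows "conv a b t = conv a c t"
  unfolding conv_def
proof (rule Bochner_Integration.integral_cong[OF refl])
  show "a (t - s) * b s = a (t - s) * c s" for s
    using assms(2)[of s] causal_neg[OF assms(1), of "t - s"] by (cases "s \<le> t") auto
qed

lemma causal_abs: "causal a \<Longrightarrow> causal (\<lambda>t. \<bar>a t\<bar>)"
  by (auto simp: causal_def)

lemma conv_one_abs_mono:
  assumes "causal a" "s \<le> t"
  shows "conv one (\<lambda>t. \<bar>a t\<bar>) s \<le> conv one (\<lambda>t. \<bar>a t\<bar>) t"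
proof -
  have "integral {0..s} (\<lambda>t. \<bar>a t\<bar>) \<le> integral {0..t} (\<lambda>t. \<bar>a t\<bar>)"
    using assms by (intro integral_subset_le causal_integrable_on causal_abs) auto
  then show ?thesis by (simp add: conv_one_eq_integral[OF causal_abs[OF assms(1)]])
qed

lemma causal_integrable_if_bounded:
  assumes a: "causal a" and B: "\<And>t. conv one (\<lambda>t. \<bar>a t\<bar>) t \<le> B"
  shows "integrable lborel a"
proof -
  note [measurable] = causal_measurable[OF a]
  let ?I = "conv one (\<lambda>t. \<bar>a t\<bar>)"
  have "incseq (\<lambda>n. ?I (real n))"
    by (intro incseq_SucI conv_one_abs_mono[OF a]) simp
  then obtain x where x: "(\<lambda>n. ?I (real n)) \<longlonglongrightarrow> x"
    using incseq_convergent[of "\<lambda>n. ?I (real n)" B] B by blast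
  have eq: "?I t = (LINT s|lborel. \<bar>a s\<bar> * indicator {..t} s)" for t
    unfolding conv_def
    by (rule Bochner_Integration.integral_cong) (auto simp: indicator_def)
  have "integrable lborel (\<lambda>s. \<bar>a s\<bar>)"
  proof (rule integrable_monotone_convergence)
    show "integrable lborel (\<lambda>s. \<bar>a s\<bar> * indicator {..real n} s)" for n
    proof -
      have "(\<lambda>s. one (real n - s) * \<bar>a s\<bar>) = (\<lambda>s. \<bar>a s\<bar> * indicator {..real n} s)"
        by (auto simp: indicator_def)
      then show ?thesis using conv_integrable[OF causal_one causal_abs[OF a], of "real n"] by simp
    qed
    show "AE s in lborel. mono (\<lambda>n. \<bar>a s\<bar> * indicator {..real n} s)"
      by (intro AE_I2 monoI mult_left_mono) (auto simp: indicator_def)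
    show "AE s in lborel. (\<lambda>n. \<bar>a s\<bar> * indicator {..real n} s) \<longlonglongrightarrow> \<bar>a s\<bar>"
    proof (intro AE_I2 tendsto_eventually)
      fix s :: real
      obtain m :: nat where "s \<le> m" using real_arch_simple by blast
      then show "\<forall>\<^sub>F n in sequentially. \<bar>a s\<bar> * indicator {..real n} s = \<bar>a s\<bar>"
        by (intro eventually_sequentiallyI[of m]) auto
    qed
    show "(\<lambda>n. LINT s|lborel. \<bar>a s\<bar> * indicator {..real n} s) \<longlonglongrightarrow> x" using x by (simp add: eq)
  qed measurable
  then show ?thesis by (simp add: integrable_abs_iff)
qed

text \<open>
  The primitive of \<open>g\<close> is \<open>P s = (s - T) q s\<close> on \<open>[T, t]\<close>, where the polynomial \<open>q\<close> approximates the
  sign of \<open>s \<mapsto> a (t - s)\<close>, and it runs linearly back to \<open>0\<close> on \<open>[t, t + 1]\<close>. A polynomial is taken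
  because the primitive has to be differentiable. Up to a small error, half of \<open>\<bar>a (t - s)\<bar>\<close> is picked up with weight \<open>s - T\<close>, which is at least \<open>t / 4\<close> for
  \<open>s \<ge> t / 2\<close>.
\<close>

lemma hump_exists:
  assumes a: "causal a" and cont: "continuous_on {0..} a" and T: "0 \<le> T" "4 * T \<le> t" "1 \<le> t"
  shows "\<exists>g. causal g \<and> (\<forall>s. s \<notin> {T<..t + 1} \<longrightarrow> g s = 0) \<and> (\<forall>s. s \<notin> {T<..<t + 1} \<longrightarrow> conv one g s = 0) \<and>
    (\<forall>s\<ge>0. \<bar>conv one g s\<bar> \<le> 2 * s) \<and>
    conv a (conv one g) t \<ge> t * (conv one (\<lambda>t. \<bar>a t\<bar>) (t / 2) / 8 - 1)"
proof -
  \<comment> \<open>The function \<open>w\<close> below is a continuous substitute for the sign. It loses at most \<open>\<delta>\<close>, hence in total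
    \<open>\<delta> t\<^sup>2 = t\<close>.\<close>
  define \<delta> where "\<delta> = 1 / t"
  have \<delta>: "\<delta> > 0" "\<delta> * t = 1" using T by (auto simp: \<delta>_def)
  define w where "w = (\<lambda>s. a (t - s) / (\<bar>a (t - s)\<bar> + \<delta>))"
  have den: "\<bar>a s\<bar> + \<delta> > 0" for s using \<delta> by (simp add: add_nonneg_pos)
  then have den0: "\<bar>a s\<bar> + \<delta> \<noteq> 0" for s using less_irrefl by metis
  have contw: "continuous_on {T..t} w"
    unfolding w_def
    by (intro continuous_intros continuous_on_compose2[OF cont]) (use den0 in auto)
  obtain q where q: "real_polynomial_function q" "\<And>s. s \<in> {T..t} \<Longrightarrow> \<bar>w s - q s\<bar> < 1 / 2"
    using Stone_Weierstrass_real_polynomial_function[OF _ contw, of "1 / 2"] by auto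
  obtain q' where q': "real_polynomial_function q'" "\<And>s. (q has_real_derivative q' s) (at s)"
    using has_real_derivative_polynomial_function[OF q(1)] by blast
  have wq: "\<bar>w s\<bar> \<le> 1" for s
    using den[of "t - s"] \<delta> by (simp add: w_def abs_divide)
  have q2: "\<bar>q s\<bar> \<le> 2" if "s \<in> {T..t}" for s
    using q(2)[OF that] wq[of s] by linarith
  have aq: "a (t - s) * q s \<ge> \<bar>a (t - s)\<bar> / 2 - \<delta>" if s: "s \<in> {T..t}" for s
  proof -
    let ?a = "a (t - s)"
    have "(\<bar>?a\<bar> - \<delta>) * (\<bar>?a\<bar> + \<delta>) \<le> ?a * ?a"
      using zero_le_square[of \<delta>] by (simp add: algebra_simps)
    then have "\<bar>?a\<bar> - \<delta> \<le> ?a * w s"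
      using den[of "t - s"] by (simp add: w_def pos_le_divide_eq)
    moreover have "\<bar>?a * (w s - q s)\<bar> \<le> \<bar>?a\<bar> * (1 / 2)"
      unfolding abs_mult using q(2)[OF s] by (intro mult_left_mono) auto
    moreover have "?a * (w s - q s) = ?a * w s - ?a * q s" by (rule right_diff_distrib)
    ultimately show ?thesis by linarith
  qed
  define P where "P = (\<lambda>s. (s - T) * q s)"
  define P' where "P' = (\<lambda>s. q s + (s - T) * q' s)"
  have P': "(P has_real_derivative P' s) (at s)" for s
    unfolding P_def P'_def by (auto intro!: derivative_eq_intros q'(2))
  have contq: "continuous_on S q" "continuous_on S q'" for S
    using q(1) q'(1) continuous_on_polymonial_function real_polynomial_function_eq by blast+
  define g where "g = (\<lambda>s. indicator {T<..t} s * P' s - P t * indicator {t<..t + 1} s)"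
  \<comment> \<open>The primitive of \<open>g\<close>; the clamped arguments make it continuous at \<open>T\<close>, \<open>t\<close> and \<open>t + 1\<close>.\<close>
  define Z where "Z = (\<lambda>s. P (min t (max T s)) * (1 - max 0 (min 1 (s - t))))"
  have contP: "continuous_on UNIV P"
    unfolding P_def by (intro continuous_intros contq)
  have contZ: "continuous_on S Z" for S
    unfolding Z_def by (intro continuous_intros continuous_on_compose2[OF contP]) auto
  have PT: "P T = 0" by (simp add: P_def)
  have tT: "T \<le> t" using T by linarith
  have cg: "causal g"
    unfolding causal_def
  proof (intro conjI allI impI)
    have "P' \<in> borel_measurable borel"
      unfolding P'_def by (intro borel_measurable_continuous_onI continuous_intros contq)
    then show "g \<in> borel_measurable borel"
      unfolding g_def by (intro borel_measurable_diff borel_measurable_times borel_measurable_indicator) auto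
    show "g s = 0" if "s < 0" for s using that T by (auto simp: g_def indicator_def)
    have "continuous_on {T..t} P'"
      unfolding P'_def by (intro continuous_intros contq)
    then have "bounded (P' ` {T..t})" by (intro compact_imp_bounded compact_continuous_image) auto
    then obtain B where B: "\<And>s. s \<in> {T..t} \<Longrightarrow> \<bar>P' s\<bar> \<le> B"
      unfolding bounded_iff real_norm_def by blast
    have "\<bar>g s\<bar> \<le> \<bar>B\<bar> + \<bar>P t\<bar>" for s
      using B[of s] by (auto simp: g_def indicator_def)
    then show "\<exists>B. \<forall>s\<le>S. \<bar>g s\<bar> \<le> B" for S by blast
  qed
  have Z0: "Z s = 0" if "s \<notin> {T<..<t + 1}" for s
    using that tT PT by (auto simp: Z_def)
  have derZ: "(Z has_real_derivative g s) (at s)" if s: "s \<notin> {T, t, t + 1}" for s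
  proof -
    consider "s < T" | "T < s" "s < t" | "t < s" "s < t + 1" | "t + 1 < s" using s by fastforce
    then show ?thesis
    proof cases
      case 1
      have "(Z has_real_derivative 0) (at s)"
        by (rule has_field_derivative_transform_within_open[of "\<lambda>_. 0" _ _ "{..<T}"])
          (use 1 Z0 in auto)
      then show ?thesis using 1 tT by (simp add: g_def)
    next
      case 2
      have "(Z has_real_derivative P' s) (at s)"
        by (rule has_field_derivative_transform_within_open[of P _ _ "{T<..<t}", OF P'])
          (use 2 in \<open>auto simp: Z_def\<close>)
      then show ?thesis using 2 by (simp add: g_def)
    next
      case 3
      have "((\<lambda>s. P t * (1 - (s - t))) has_real_derivative - P t) (at s)"
        by (auto intro!: derivative_eq_intros)
      then have "(Z has_real_derivative - P t) (at s)"
        by (rule has_field_derivative_transform_within_open[of _ _ _ "{t<..<t + 1}"])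
          (use 3 tT in \<open>auto simp: Z_def\<close>)
      then show ?thesis using 3 by (simp add: g_def)
    next
      case 4
      have "(Z has_real_derivative 0) (at s)"
        by (rule has_field_derivative_transform_within_open[of "\<lambda>_. 0" _ _ "{t + 1<..}"])
          (use 4 Z0 in auto)
      then show ?thesis using 4 tT by (simp add: g_def)
    qed
  qed
  have Zg: "conv one g s = Z s" for s
  proof (cases "s \<ge> 0")
    case True
    have "(g has_integral (Z s - Z 0)) {0..s}"
    proof (rule fundamental_theorem_of_calculus_strong[of "{T, t, t + 1}"])
      show "(Z has_vector_derivative g x) (at x)" if "x \<in> {0..s} - {T, t, t + 1}" for x
        using derZ[of x] that by (simp add: has_real_derivative_iff_has_vector_derivative)
    qed (use True contZ in auto)
    moreover have "Z 0 = 0" using T PT by (simp add: Z_def)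
    ultimately show ?thesis by (simp add: conv_one_eq_integral[OF cg] integral_unique)
  next
    case False
    then show ?thesis using Z0[of s] T causal_neg[OF causal_conv[OF causal_one cg]] by simp
  qed
  have ZP: "Z s = P s" if "s \<in> {T..t}" for s using that by (simp add: Z_def)
  have Zb: "\<bar>Z s\<bar> \<le> 2 * s" if "s \<ge> 0" for s
  proof (cases "s \<in> {T<..<t + 1}")
    case True
    define p where "p = min t s"
    have p: "p \<in> {T..t}" "p \<le> s" using True tT by (auto simp: p_def)
    have "\<bar>P p\<bar> \<le> p * 2"
      unfolding P_def abs_mult using p T q2[OF p(1)] by (intro mult_mono) auto
    moreover have "\<bar>Z s\<bar> \<le> \<bar>P p\<bar>"
    proof -
      have Zs: "Z s = P p * (1 - max 0 (min 1 (s - t)))"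
        using True by (simp add: Z_def p_def max_def)
      have "\<bar>P p\<bar> * \<bar>1 - max 0 (min 1 (s - t))\<bar> \<le> \<bar>P p\<bar> * 1"
        by (intro mult_left_mono) auto
      then show ?thesis unfolding Zs abs_mult by simp
    qed
    ultimately show ?thesis using p(2) by linarith
  qed (use Z0 that in auto)
  have big: "conv a Z t \<ge> t * (conv one (\<lambda>t. \<bar>a t\<bar>) (t / 2) / 8 - 1)"
  proof -
    define I where "I = conv one (\<lambda>t. \<bar>a t\<bar>) (t / 2)"
    have "conv one g = Z" using Zg by blast
    then have cZ: "causal Z" using causal_conv[OF causal_one cg] by simp
    have low: "t / 8 * (\<bar>a (t - s)\<bar> * indicator {..t / 2} (t - s)) - \<delta> * t * indicator {0..t} s \<le> a (t - s) * Z s" for s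
    proof (cases "s \<in> {T..t}")
      case True
      have "(s - T) * (\<bar>a (t - s)\<bar> / 2 - \<delta>) \<le> (s - T) * (a (t - s) * q s)"
        using True by (intro mult_left_mono aq) auto
      then have 1: "(s - T) * \<bar>a (t - s)\<bar> / 2 - (s - T) * \<delta> \<le> a (t - s) * Z s"
        using True by (simp add: ZP P_def algebra_simps)
      have 2: "(s - T) * \<delta> \<le> t * \<delta>" using True T \<delta> by (intro mult_right_mono) auto
      have 3: "t / 8 * (\<bar>a (t - s)\<bar> * indicator {..t / 2} (t - s)) \<le> (s - T) * \<bar>a (t - s)\<bar> / 2"
      proof (cases "t - s \<le> t / 2")
        case True
        then have "t / 8 \<le> (s - T) / 2" using T by simp
        then have "t / 8 * \<bar>a (t - s)\<bar> \<le> (s - T) / 2 * \<bar>a (t - s)\<bar>" by (rule mult_right_mono) simp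
        then show ?thesis using True by simp
      next
        case False
        then show ?thesis using \<open>s \<in> {T..t}\<close> by simp
      qed
      have "indicator {0..t} s = (1::real)" using True T by simp
      then show ?thesis using 1 2 3 by (simp add: mult.commute)
    next
      case False
      have 1: "\<bar>a (t - s)\<bar> * indicator {..t / 2} (t - s) = 0"
      proof (cases "s > t")
        case False
        then have "\<not> t - s \<le> t / 2" using \<open>s \<notin> {T..t}\<close> T by auto
        then show ?thesis by simp
      qed (simp add: causal_neg[OF a])
      have 2: "a (t - s) * Z s = 0"
        using False Z0[of s] causal_neg[OF a, of "t - s"] by (cases "s > t") auto
      show ?thesis unfolding 1 2 using \<delta> by (simp add: indicator_def)
    qed
    have Ieq: "(LINT s|lborel. \<bar>a (t - s)\<bar> * indicator {..t / 2} (t - s)) = I"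
    proof -
      have "(LINT s|lborel. \<bar>a (t - s)\<bar> * indicator {..t / 2} (t - s))
          = (LINT s|lborel. \<bar>a s\<bar> * indicator {..t / 2} s)"
        using lborel_integral_real_affine[of "-1" "\<lambda>s. \<bar>a (t - s)\<bar> * indicator {..t / 2} (t - s)" t] by simp
      also have "\<dots> = I"
        unfolding I_def conv_def by (rule Bochner_Integration.integral_cong) (auto simp: indicator_def)
      finally show ?thesis .
    qed
    have Iint: "integrable lborel (\<lambda>s. \<bar>a (t - s)\<bar> * indicator {..t / 2} (t - s))"
    proof -
      have "integrable lborel (\<lambda>s. one (t / 2 - s) * \<bar>a s\<bar>)"
        by (rule conv_integrable[OF causal_one causal_abs[OF a]])
      then have "integrable lborel (\<lambda>s. \<bar>a s\<bar> * indicator {..t / 2} s)"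
        by (rule Bochner_Integration.integrable_cong[THEN iffD1, rotated -1]) (auto simp: indicator_def)
      from lborel_integrable_real_affine[OF this, of "-1" t] show ?thesis by simp
    qed
    have "(LINT s|lborel. t / 8 * (\<bar>a (t - s)\<bar> * indicator {..t / 2} (t - s)) - \<delta> * t * indicator {0..t} s) \<le> conv a Z t"
      unfolding conv_def
      by (intro integral_mono low Bochner_Integration.integrable_diff integrable_mult_right[OF Iint]
          integrable_indicator_Icc conv_integrable[OF a cZ])
    also have "(LINT s|lborel. t / 8 * (\<bar>a (t - s)\<bar> * indicator {..t / 2} (t - s)) - \<delta> * t * indicator {0..t} s)
        = t / 8 * I - \<delta> * t * t"
      using T integral_indicator_Icc[of 0 t "\<delta> * t"]
      by (subst Bochner_Integration.integral_diff[OF integrable_mult_right[OF Iint] integrable_indicator_Icc])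
        (simp_all only: integral_mult_right_zero Ieq diff_0_right)
    finally show ?thesis using \<delta>(2) by (simp add: I_def algebra_simps)
  qed
  have "conv one g = Z" using Zg by blast
  then show ?thesis
    using cg Z0 Zb big tT by (intro exI[of _ g]) (auto simp: g_def)
qed

context delay_equation
begin

lemma continuous_on_r: "continuous_on {0..} r"
  using is_resolvent_resolvent locally_absolutely_continuous_imp_continuous_on
  by (simp add: is_resolvent_def)

text \<open>
  The primitive returns to \<open>0\<close> at time \<open>T\<close>, so that another hump can be appended.
\<close>

definition balanced_until :: "real \<Rightarrow> (real \<Rightarrow> real) \<Rightarrow> bool" where
  "balanced_until T f \<longleftrightarrow> causal f \<and> (\<forall>s\<ge>T. conv one f s = 0) \<and> (\<forall>s>T. f s = 0)"

lemma balanced_until_Ces: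
  assumes "balanced_until T f"
  shows "f \<in> Ces"
proof -
  have f: "causal f" using assms by (simp add: balanced_until_def)
  have "((\<lambda>t. primitive f t / t) \<longlongrightarrow> 0) at_top"
    by (rule tendsto_eventually, rule eventually_mono[OF eventually_ge_at_top[of T]])
      (use assms in \<open>simp add: balanced_until_def primitive_causal\<close>)
  then show ?thesis
    using cesaro_mean_tendsto_iff[OF causal_L1_loc[OF f]] causal_L1_loc[OF f] by (auto simp: Ces_iff)
qed

text \<open>
  The forcing constructed so far contributes \<open>O(t)\<close>, because it lies in \<open>Ces\<close>. A new hump with relative
  height \<open>1 / (n + 1)\<close>, placed late enough, exceeds this contribution by any prescribed factor, as the
  integral of \<open>\<bar>r\<bar>\<close> is unbounded.
\<close>

lemma gliding_step:
  assumes conv_all: "\<And>f. \<lbrakk>causal f; f \<in> Ces\<rbrakk> \<Longrightarrow> \<exists>L. ((\<lambda>t. conv r (conv one f) t / t) \<longlongrightarrow> L) at_top"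
    and unbounded: "\<And>B. \<exists>t. conv one (\<lambda>t. \<bar>r t\<bar>) t > B"
    and adm: "balanced_until T f" and T: "T \<ge> 0"
  shows "\<exists>T' f'. T' \<ge> T + 1 \<and> balanced_until T' f' \<and> (\<forall>s\<le>T. f' s = f s) \<and>
    (\<forall>s\<ge>T. \<bar>conv one f' s\<bar> \<le> s / (real n + 1)) \<and>
    (\<exists>t. t \<ge> 1 \<and> T \<le> t \<and> t \<le> T' \<and> conv r (conv one f') t \<ge> real n * t)"
proof -
  have cf: "causal f" using adm by (simp add: balanced_until_def)
  obtain L where "((\<lambda>t. conv r (conv one f) t / t) \<longlongrightarrow> L) at_top"
    using conv_all[OF cf balanced_until_Ces[OF adm]] by blast
  then obtain M where M: "M \<ge> 0" "\<And>t. t \<ge> 1 \<Longrightarrow> \<bar>conv r (conv one f) t\<bar> \<le> M * t"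
    using causal_linear_bound[OF causal_conv[OF causal_r causal_conv[OF causal_one cf]]] by blast
  \<comment> \<open>The primitive of a hump is at most \<open>2 s\<close>, so the factor \<open>c\<close> reduces it to \<open>s / (n + 1)\<close>.\<close>
  define c where "c = 1 / (2 * (real n + 1))"
  have c: "c > 0" by (simp add: c_def)
  obtain t0 where t0: "conv one (\<lambda>t. \<bar>r t\<bar>) t0 > 8 * (1 + (real n + M) / c)" using unbounded by blast
  define t where "t = max (2 * t0) (max (4 * T) 1)"
  have t: "4 * T \<le> t" "1 \<le> t" "t0 \<le> t / 2" "T \<le> t" using T by (auto simp: t_def)
  obtain g where g: "causal g" "\<And>s. s \<notin> {T<..t + 1} \<Longrightarrow> g s = 0" "\<And>s. s \<notin> {T<..<t + 1} \<Longrightarrow> conv one g s = 0"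
    "\<And>s. s \<ge> 0 \<Longrightarrow> \<bar>conv one g s\<bar> \<le> 2 * s"
    "conv r (conv one g) t \<ge> t * (conv one (\<lambda>t. \<bar>r t\<bar>) (t / 2) / 8 - 1)"
    using hump_exists[OF causal_r continuous_on_r T t(1,2)] by blast
  define f' where "f' = (\<lambda>s. f s + c * g s)"
  have cf': "causal f'" unfolding f'_def by (intro causal_add causal_cmult cf g)
  have F': "conv one f' s = conv one f s + c * conv one g s" for s
    using conv_add_right[OF cf causal_cmult[OF g(1), of c] causal_one]
    by (simp add: f'_def conv_cmult_right)
  have cF: "causal (conv one f)" "causal (conv one g)" by (intro causal_conv causal_one cf g)+
  have rF': "conv r (conv one f') t = conv r (conv one f) t + c * conv r (conv one g) t"
  proof -
    have "conv one f' = (\<lambda>s. conv one f s + c * conv one g s)" using F' by blast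
    then show ?thesis
      using conv_add_right[OF cF(1) causal_cmult[OF cF(2), of c] causal_r]
      by (simp add: conv_cmult_right)
  qed
  show ?thesis
  proof (rule exI[of _ "t + 1"], rule exI[of _ f'], intro conjI allI impI)
    show "T + 1 \<le> t + 1" using t by simp
    show "balanced_until (t + 1) f'"
      unfolding balanced_until_def using cf' F' adm g(2,3) t by (auto simp: balanced_until_def f'_def)
    show "f' s = f s" if "s \<le> T" for s using that g(2)[of s] by (simp add: f'_def)
    show "\<bar>conv one f' s\<bar> \<le> s / (real n + 1)" if "s \<ge> T" for s
    proof -
      have "\<bar>conv one f' s\<bar> = c * \<bar>conv one g s\<bar>"
        using adm that c by (simp add: F' balanced_until_def abs_mult)
      also have "\<dots> \<le> c * (2 * s)" using c g(4)[of s] that T by (intro mult_left_mono) auto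
      also have "\<dots> = s / (real n + 1)" by (simp add: c_def field_simps)
      finally show ?thesis .
    qed
    show "\<exists>t'. t' \<ge> 1 \<and> T \<le> t' \<and> t' \<le> t + 1 \<and> conv r (conv one f') t' \<ge> real n * t'"
    proof (intro exI[of _ t] conjI)
      have "8 * (1 + (real n + M) / c) < conv one (\<lambda>t. \<bar>r t\<bar>) (t / 2)"
        using t0 conv_one_abs_mono[OF causal_r t(3)] by linarith
      moreover have "k \<le> x / 8 - 1" if "8 * (1 + k) < x" for k x :: real
        using that by (simp add: field_simps)
      ultimately have "(real n + M) / c \<le> conv one (\<lambda>t. \<bar>r t\<bar>) (t / 2) / 8 - 1" by blast
      then have "c * (t * ((real n + M) / c)) \<le> c * (t * (conv one (\<lambda>t. \<bar>r t\<bar>) (t / 2) / 8 - 1))"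
        using c t by (intro mult_left_mono) auto
      also have "\<dots> \<le> c * conv r (conv one g) t"
        using c g(5) by (intro mult_left_mono) auto
      finally have "t * (real n + M) \<le> c * conv r (conv one g) t" using c by simp
      then show "real n * t \<le> conv r (conv one f') t"
        using rF' M(2)[OF t(2)] by (simp add: algebra_simps abs_le_iff)
    qed (use t in auto)
  qed
qed

text \<open>
  The limit \<open>F\<close> of the forcings from \<open>gliding_step\<close> agrees with the \<open>n\<close>-th of them up to time \<open>T n\<close>. The
  heights \<open>1 / (n + 1)\<close> place \<open>F\<close> in \<open>Ces\<close>, while the humps make \<open>(r * (1 * F)) t / t\<close> unbounded.
\<close>

lemma integrable_r_if_means_converge:
  assumes conv_all: "\<And>f. \<lbrakk>causal f; f \<in> Ces\<rbrakk> \<Longrightarrow> \<exists>L. ((\<lambda>t. conv r (conv one f) t / t) \<longlongrightarrow> L) at_top"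
  shows "integrable lborel r"
proof (rule ccontr)
  assume nint: "\<not> integrable lborel r"
  have unbounded: "\<exists>t. conv one (\<lambda>t. \<bar>r t\<bar>) t > B" for B
    using causal_integrable_if_bounded[OF causal_r, of B] nint by (meson not_le)
  define Q where "Q = (\<lambda>n p p'. fst p' \<ge> fst p + 1 \<and> (\<forall>s\<le>fst p. snd p' s = snd p s) \<and>
    (\<forall>s\<ge>fst p. \<bar>conv one (snd p') s\<bar> \<le> s / (real n + 1)) \<and>
    (\<exists>t. t \<ge> 1 \<and> fst p \<le> t \<and> t \<le> fst p' \<and> conv r (conv one (snd p')) t \<ge> real n * t))"
  have "\<exists>p. \<forall>n. (fst (p n) \<ge> 0 \<and> balanced_until (fst (p n)) (snd (p n))) \<and> Q n (p n) (p (Suc n))"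
  proof (rule dependent_nat_choice)
    have "balanced_until 0 (\<lambda>_. 0)"
      by (auto simp: balanced_until_def conv_def causal_def)
    then show "\<exists>p. fst p \<ge> 0 \<and> balanced_until (fst p) (snd p)" by (intro exI[of _ "(0, \<lambda>_. 0)"]) simp
    fix p :: "real \<times> (real \<Rightarrow> real)" and n
    assume p: "fst p \<ge> 0 \<and> balanced_until (fst p) (snd p)"
    obtain T' f' where "T' \<ge> fst p + 1 \<and> balanced_until T' f' \<and> (\<forall>s\<le>fst p. f' s = snd p s) \<and>
      (\<forall>s\<ge>fst p. \<bar>conv one f' s\<bar> \<le> s / (real n + 1)) \<and>
      (\<exists>t. t \<ge> 1 \<and> fst p \<le> t \<and> t \<le> T' \<and> conv r (conv one f') t \<ge> real n * t)"
      using gliding_step[OF conv_all unbounded p[THEN conjunct2] p[THEN conjunct1], of n] by auto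
    then show "\<exists>p'. (fst p' \<ge> 0 \<and> balanced_until (fst p') (snd p')) \<and> Q n p p'"
      using p by (intro exI[of _ "(T', f')"]) (simp add: Q_def)
  qed
  then obtain p where p: "\<And>n. fst (p n) \<ge> 0" "\<And>n. balanced_until (fst (p n)) (snd (p n))" "\<And>n. Q n (p n) (p (Suc n))"
    by blast
  define T where "T = (\<lambda>n. fst (p n))"
  define f where "f = (\<lambda>n. snd (p n))"
  have T0: "T 0 \<ge> 0" and cf: "causal (f n)" for n
    using p by (auto simp: T_def f_def balanced_until_def)
  have Q1: "T (Suc n) \<ge> T n + 1" and Q2: "\<And>s. s \<le> T n \<Longrightarrow> f (Suc n) s = f n s"
    and Q3: "\<And>s. s \<ge> T n \<Longrightarrow> \<bar>conv one (f (Suc n)) s\<bar> \<le> s / (real n + 1)"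
    and Q4: "\<exists>t. t \<ge> 1 \<and> T n \<le> t \<and> t \<le> T (Suc n) \<and> conv r (conv one (f (Suc n))) t \<ge> real n * t" for n
    using p(3)[of n] by (auto simp: Q_def T_def f_def)
  have Tn: "T n \<ge> real n" for n
    by (induction n) (use T0 Q1 in \<open>auto intro: order_trans[OF _ Q1]\<close>)
  have Tmono: "T m \<le> T n" if "m \<le> n" for m n
    by (rule lift_Suc_mono_le[OF _ that]) (use Q1 in \<open>auto intro: order_trans[OF _ Q1]\<close>)
  have fstab: "f n s = f m s" if "m \<le> n" "s \<le> T m" for m n s
    using that(1)
  proof (induction n rule: dec_induct)
    case (step n)
    then have "s \<le> T n" using that(2) Tmono by force
    then show ?case using Q2 step by simp
  qed simp
  \<comment> \<open>At \<open>s\<close> the sequence \<open>f n s\<close> is constant as soon as \<open>T n \<ge> s\<close>, and \<open>T n \<ge> n\<close>.\<close>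
  define F where "F = (\<lambda>s. f (nat \<lceil>s\<rceil>) s)"
  have Feq: "F s = f n s" if "s \<le> T n" for n s
  proof -
    have "s \<le> T (nat \<lceil>s\<rceil>)" using Tn[of "nat \<lceil>s\<rceil>"] real_nat_ceiling_ge[of s] by linarith
    then show ?thesis
      using fstab[of "nat \<lceil>s\<rceil>" n s] fstab[of n "nat \<lceil>s\<rceil>" s] that nat_le_linear[of n "nat \<lceil>s\<rceil>"]
      unfolding F_def by metis
  qed
  have cF: "causal F"
    unfolding causal_def
  proof (intro conjI allI impI)
    show "F \<in> borel_measurable borel"
    proof (rule borel_measurable_LIMSEQ_real)
      show "f n \<in> borel_measurable borel" for n by (rule causal_measurable[OF cf])
      show "(\<lambda>n. f n s) \<longlonglongrightarrow> F s" for s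
      proof (rule tendsto_eventually)
        show "\<forall>\<^sub>F n in sequentially. f n s = F s"
        proof (rule eventually_sequentiallyI[of "nat \<lceil>s\<rceil>"])
          fix n assume "nat \<lceil>s\<rceil> \<le> n"
          then have "s \<le> T n" using Tn[of n] real_nat_ceiling_ge[of s] by linarith
          then show "f n s = F s" by (simp add: Feq)
        qed
      qed
    qed
    show "F s = 0" if "s < 0" for s using Feq[of s 0] T0 that causal_neg[OF cf] by simp
    fix S :: real
    obtain n :: nat where n: "S \<le> n" using real_arch_simple by blast
    obtain B where B: "\<And>s. s \<le> S \<Longrightarrow> \<bar>f n s\<bar> \<le> B" using causal_bound[OF cf[of n], of S] by blast
    have "\<bar>F s\<bar> \<le> B" if "s \<le> S" for s using B[OF that] Feq[of s n] that n Tn[of n] by simp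
    then show "\<exists>B. \<forall>s\<le>S. \<bar>F s\<bar> \<le> B" by blast
  qed
  have PF: "conv one F s = conv one (f n) s" if "s \<le> T n" for s n
    by (rule conv_cong_le[OF causal_one]) (use that Feq in auto)
  have small: "\<bar>conv one F s\<bar> \<le> s / (real n + 1)" if s: "s \<ge> T n" for s n
  proof -
    define m where "m = (GREATEST m. T m \<le> s)"
    have bnd: "\<forall>k. T k \<le> s \<longrightarrow> k \<le> nat \<lceil>s\<rceil>"
    proof (intro allI impI)
      fix k assume "T k \<le> s"
      then have "real k \<le> s" using Tn[of k] by linarith
      then show "k \<le> nat \<lceil>s\<rceil>" using real_nat_ceiling_ge[of s] by linarith
    qed
    have m: "T m \<le> s" unfolding m_def
      by (rule GreatestI_nat[of "\<lambda>m. T m \<le> s", OF s]) (use bnd in blast)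
    have nm: "n \<le> m" unfolding m_def
      by (rule Greatest_le_nat[of "\<lambda>m. T m \<le> s", OF s]) (use bnd in blast)
    have "\<not> T (Suc m) \<le> s"
      using Greatest_le_nat[of "\<lambda>m. T m \<le> s" "Suc m" "nat \<lceil>s\<rceil>"] bnd unfolding m_def by fastforce
    then have "\<bar>conv one F s\<bar> = \<bar>conv one (f (Suc m)) s\<bar>" using PF[of s "Suc m"] by simp
    also have "\<dots> \<le> s / (real m + 1)" by (rule Q3[OF m])
    also have "\<dots> \<le> s / (real n + 1)"
      using nm s T0 Tmono[of 0 n] by (intro divide_left_mono) auto
    finally show ?thesis .
  qed
  have "((\<lambda>t. primitive F t / t) \<longlongrightarrow> 0) at_top"
  proof (rule tendstoI)
    fix e :: real assume "e > 0"
    then obtain n :: nat where n: "inverse (real (Suc n)) < e" using reals_Archimedean by blast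
    show "\<forall>\<^sub>F t in at_top. dist (primitive F t / t) 0 < e"
      using eventually_ge_at_top[of "max 1 (T n)"]
    proof eventually_elim
      case (elim t)
      then have "\<bar>conv one F t\<bar> / t \<le> t / (real n + 1) / t" by (intro divide_right_mono small) auto
      also have "\<dots> = (t / t) / (real n + 1)" by (simp add: divide_divide_eq_left mult.commute)
      also have "\<dots> = inverse (real (Suc n))" using elim by (simp add: inverse_eq_divide add.commute)
      finally show ?case using n elim by (simp add: primitive_causal[OF cF])
    qed
  qed
  then have "F \<in> Ces"
    using cesaro_mean_tendsto_iff[OF causal_L1_loc[OF cF]] causal_L1_loc[OF cF] by (auto simp: Ces_iff)
  then obtain L where L: "((\<lambda>t. conv r (conv one F) t / t) \<longlongrightarrow> L) at_top"
    using conv_all[OF cF] by blast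
  obtain A where A: "\<And>t. t \<ge> 1 \<Longrightarrow> \<bar>conv r (conv one F) t\<bar> \<le> A * t"
    using causal_linear_bound[OF causal_conv[OF causal_r causal_conv[OF causal_one cF]] L] by blast
  obtain n :: nat where n: "A < n" using reals_Archimedean2 by blast
  obtain t where t: "t \<ge> 1" "t \<le> T (Suc n)" "conv r (conv one (f (Suc n))) t \<ge> real n * t"
    using Q4[of n] by blast
  have "conv r (conv one F) t = conv r (conv one (f (Suc n))) t"
    by (rule conv_cong_le[OF causal_r]) (use t PF in auto)
  then have "real n * t \<le> A * t" using A[OF t(1)] t(3) by linarith
  then show False using n t(1) by simp
qed

end

section \<open>The equivalences\<close>

theorem theorem4:
  fixes \<tau> :: real and \<mu> :: "real set \<Rightarrow> real"
  assumes "\<tau> > 0"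
    and "finite_signed_measure (borel_Icc (-\<tau>) 0) \<mu>"
  shows
    "(resolvent \<tau> \<mu> \<in> L1 \<longrightarrow>
       (\<forall>f\<in>L1_loc. \<forall>\<psi>. continuous_on {-\<tau>..0} \<psi> \<longrightarrow>
          ((\<forall>\<theta>\<in>{0<..1}. window_integral \<theta> f \<in> Ces) \<longleftrightarrow> solution \<tau> \<mu> f \<psi> \<in> Ces) \<and>
          (f \<in> Ces \<longleftrightarrow> solution \<tau> \<mu> f \<psi> \<in> Ces \<and> deriv (solution \<tau> \<mu> f \<psi>) \<in> Ces) \<and>
          ((\<forall>\<theta>\<in>{0<..1}. window_integral \<theta> f \<in> Ces) \<longrightarrow>
             (\<exists>C. (\<forall>\<theta>\<in>{0<..1}. (cesaro_mean (window_integral \<theta> f) \<longlongrightarrow> C * \<theta>) at_top) \<and>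
                  (cesaro_mean (solution \<tau> \<mu> f \<psi>) \<longlongrightarrow> - C / \<mu> {-\<tau>..0}) at_top)) \<and>
          (f \<in> Ces \<longrightarrow>
             (\<exists>C. (cesaro_mean f \<longlongrightarrow> C) at_top \<and>
                  (cesaro_mean (solution \<tau> \<mu> f \<psi>) \<longlongrightarrow> - C / \<mu> {-\<tau>..0}) at_top \<and>
                  (cesaro_mean (deriv (solution \<tau> \<mu> f \<psi>)) \<longlongrightarrow> 0) at_top))))
     \<and>
     (resolvent \<tau> \<mu> \<in> L1 \<longleftrightarrow>
       (\<forall>\<psi>. continuous_on {-\<tau>..0} \<psi> \<longrightarrow> (\<forall>f\<in>Ces. solution \<tau> \<mu> f \<psi> \<in> Ces)))
     \<and>
     (resolvent \<tau> \<mu> \<in> L1 \<longleftrightarrow>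
       (\<forall>\<psi>. continuous_on {-\<tau>..0} \<psi> \<longrightarrow>
          (\<forall>f\<in>L1_loc. (\<forall>\<theta>\<in>{0<..1}. window_integral \<theta> f \<in> Ces) \<longrightarrow> solution \<tau> \<mu> f \<psi> \<in> Ces)))"
proof -
  interpret delay_equation \<tau> \<mu> by standard fact+
  let ?x = "solution \<tau> \<mu>"
  have i: "(\<forall>\<theta>\<in>{0<..1}. window_integral \<theta> f \<in> Ces) \<longleftrightarrow> ?x f \<psi> \<in> Ces"
    if "r \<in> L1" "f \<in> L1_loc" "continuous_on {-\<tau>..0} \<psi>" for f \<psi>
  proof
    assume "\<forall>\<theta>\<in>{0<..1}. window_integral \<theta> f \<in> Ces"
    then show "?x f \<psi> \<in> Ces"
      using window_Ces_imp_solution_limit[of \<psi> f] solution_L1_loc[of \<psi> f] that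
      by (auto simp: Ces_iff resolvent_L1_iff_integrable)
  next
    assume "?x f \<psi> \<in> Ces"
    then show "\<forall>\<theta>\<in>{0<..1}. window_integral \<theta> f \<in> Ces"
      using that by (intro ballI solution_Ces_imp_window_Ces[of \<psi> f]) auto
  qed
  have ii: "f \<in> Ces \<longleftrightarrow> ?x f \<psi> \<in> Ces \<and> deriv (?x f \<psi>) \<in> Ces"
    if "r \<in> L1" "f \<in> L1_loc" "continuous_on {-\<tau>..0} \<psi>" for f \<psi>
  proof
    assume "f \<in> Ces"
    then show "?x f \<psi> \<in> Ces \<and> deriv (?x f \<psi>) \<in> Ces"
      using Ces_imp_solution_limits[of \<psi> f] solution_L1_loc[of \<psi> f] deriv_solution(1)[of \<psi> f] that
      by (auto simp: Ces_iff resolvent_L1_iff_integrable)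
  next
    assume "?x f \<psi> \<in> Ces \<and> deriv (?x f \<psi>) \<in> Ces"
    then show "f \<in> Ces" using that by (intro solution_Ces_imp_Ces[of \<psi> f]) auto
  qed
  have Ces_window: "f \<in> L1_loc \<and> (\<forall>\<theta>\<in>{0<..1}. window_integral \<theta> f \<in> Ces)" if "f \<in> Ces" for f
    using that Ces_imp_window_Ces[OF that] by (auto simp: Ces_iff)
  have ii_i: "r \<in> L1" if ii: "\<And>\<psi> f. \<lbrakk>continuous_on {-\<tau>..0} \<psi>; f \<in> Ces\<rbrakk> \<Longrightarrow> ?x f \<psi> \<in> Ces"
    unfolding resolvent_L1_iff_integrable
  proof (rule integrable_r_if_means_converge)
    fix f assume f: "causal f" "f \<in> Ces"
    have "?x f (\<lambda>_. 0) \<in> Ces" by (rule ii) (auto intro: f)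
    then show "\<exists>L. ((\<lambda>t. conv r (conv one f) t / t) \<longlongrightarrow> L) at_top"
      using solution_cesaro_iff[of "\<lambda>_. 0" f] f
      by (auto simp: Ces_iff initial_data_zero primitive_causal)
  qed
  show ?thesis
  proof (intro conjI)
    show "r \<in> L1 \<longleftrightarrow> (\<forall>\<psi>. continuous_on {-\<tau>..0} \<psi> \<longrightarrow> (\<forall>f\<in>Ces. ?x f \<psi> \<in> Ces))"
      using i Ces_window ii_i by meson
    show "r \<in> L1 \<longleftrightarrow> (\<forall>\<psi>. continuous_on {-\<tau>..0} \<psi> \<longrightarrow>
      (\<forall>f\<in>L1_loc. (\<forall>\<theta>\<in>{0<..1}. window_integral \<theta> f \<in> Ces) \<longrightarrow> ?x f \<psi> \<in> Ces))"
      using i Ces_window ii_i by meson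
  qed (intro impI ballI allI conjI i ii window_Ces_imp_solution_limit Ces_imp_solution_limits;
    simp add: resolvent_L1_iff_integrable)
qed

end
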